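(* Let $\{a_n\}$ be a sequence of positive integer valued random variables such that for each $n$, $a_n$ is independent of the random variables $\{X_k\}$, and let $T_n^*=S_{n+a_n}-S_n$. (1) Let $0<\lambda\le\infty$. Assume $\limsup_{n\to\infty}a_n/n<\infty$ a.s. if $0<\lambda<\infty$, and $\limsup_{n\to\infty}a_n/\tau_1(n)<\infty$ a.s. if $\lambda=\infty$. Then for every $\delta>0$ $$\limsup_{n\to\infty}\frac{|T_n^*|}{B_n(\log n)^{(1+\delta)/\alpha_1}}=0\quad\text{a.s.},\qquad \limsup_{n\to\infty}\frac{|T_n^*|}{B_n(\log n)^{1/\alpha_1}}=\infty\quad\text{a.s.}$$ In particular, $$\limsup_{n\to\infty}\left|\frac{T_n^*}{B_n}\right|^{1/\log\log n}=e^{1/\alpha_1}\quad\text{a.s.}$$ (2) Let $\lambda=0$. Assume $\limsup_{n\to\infty}a_n/n<\infty$ a.s. and that for some $\mu>\frac{\alpha_2-\alpha_1}{\alpha_2}$ one has $\tau_1(n)<n^{\alpha_1/\alpha_2}(\log n)^{-\mu}$ for all sufficiently large $n$. Then for every $\delta>0$ $$\limsup_{n\to\infty}\frac{|T_n^*|}{B_n(\log n)^{(1+\delta)/\alpha_2}}=0\quad\text{a.s.},\qquad \limsup_{n\to\infty}\frac{|T_n^*|}{B_n(\log n)^{1/\alpha_2}}=\infty\quad\text{a.s.}$$ In particular, $$\limsup_{n\to\infty}\left|\frac{T_n^*}{B_n}\right|^{1/\log\log n}=e^{1/\alpha_2}\quad\text{a.s.}$$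
   Context: Let $0<\alpha_1<\alpha_2<2$. $\{X_n\}_{n\ge1}$ are independent random variables; $X_n$ has distribution function $F_n\in\{G_1,G_2\}$. For $j=1,2$, $G_j$ is in the domain of normal attraction of the (symmetric, non-normal) stable law with characteristic function $\varphi_j(t)=\exp(-\lambda_j|t|^{\alpha_j})$, $\lambda_j>0$, called the stable $(\alpha_j)$ law; in particular, for $x>0$, $1-G_j(x)=\frac{c_{j1}+\theta_j(x)}{x^{\alpha_j}}$ and $G_j(-x)=\frac{c_{j2}+\beta_j(-x)}{x^{\alpha_j}}$ with $c_{j1},c_{j2}>0$ and $\theta_j(x),\beta_j(-x)\to0$ as $x\to\infty$. $S_n=\sum_{k=1}^n X_k$. $\tau_j(n)$ is the number of $k\le n$ with $F_k=G_j$, so $\tau_1(n)+\tau_2(n)=n$; it is assumed that $\tau_j(n)\to\infty$ for $j=1,2$. Let $U_{\tau_1(n)}$ and $V_{\tau_2(n)}$ be the sums of those $X_k$, $k\le n$, with distribution function $G_1$ and $G_2$ respectively. With $B_j(m)=m^{1/\alpha_j}$, $(U_{\tau_1(n)}-d_1(\tau_1(n)))/B_1(\tau_1(n))$ and $(V_{\tau_2(n)}-d_2(\tau_2(n)))/B_2(\tau_2(n))$ converge in distribution to the stable $(\alpha_1)$ and stable $(\alpha_2)$ laws; the centering convention is that $d_1=d_2=0$ if $\alpha_1\ne1,\alpha_2\neq 1$, while $d_j(n)\sim n\log n$ if $\alpha_j=1$ (here $f_n\sim g_n$ means that $f_n/g_n$ converges to a constant in $(0,\infty)$). It is assumed that $(S_n-A_n)/B_n$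 converges in distribution to a proper random variable for suitable $A_n\in\mathbb{R}$, $B_n>0$; equivalently $\frac{(\tau_1(n))^{\alpha_2}}{(\tau_2(n))^{\alpha_1}}\to\lambda$ for some $\lambda\in[0,\infty]$. The limit law is stable $(\alpha_2)$ if $\lambda=0$, a composition (convolution) of the two stable laws if $0<\lambda<\infty$, and stable $(\alpha_1)$ if $\lambda=\infty$. The normalization is $B_n=(\tau_1(n))^{1/\alpha_1}$ if $\lambda=\infty$ and $B_n=(\tau_2(n))^{1/\alpha_2}$ (of exact order $n^{1/\alpha_2}$) if $0\le\lambda<\infty$. *)

theory Defs
  imports "HOL-Probability.Probability"
begin

text \<open>Random sequences are indexed from 1; the value of a sequence at 0 is never used.\<close>

definition symmetric_stable :: "real \<Rightarrow> real \<Rightarrow> real measure \<Rightarrow> bool" where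
  "symmetric_stable \<alpha> c L \<longleftrightarrow>
     real_distribution L \<and> (\<forall>t. char L t = complex_of_real (exp (- c * \<bar>t\<bar> powr \<alpha>)))"

text \<open>
  Normal attraction to a symmetric stable law, for the centering \<open>d\<close>. Independent copies
  with law \<open>G\<close> are realised as the coordinates on the \<open>n\<close>-fold product of \<open>G\<close>. The
  norming is exactly \<open>n powr (1 / \<alpha>)\<close>: the customary positive factor in front of it is
  absorbed in the scale parameter \<open>c\<close>.
\<close>

definition normally_attracted ::
    "real measure \<Rightarrow> real \<Rightarrow> real \<Rightarrow> (nat \<Rightarrow> real) \<Rightarrow> bool" where
  "normally_attracted G \<alpha> c d \<longleftrightarrow>
     real_distribution G \<and>
     (\<exists>L. symmetric_stable \<alpha> c L \<and>
          weak_conv_m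
            (\<lambda>n. distr (Pi\<^sub>M {..<n} (\<lambda>_. G)) borel
                   (\<lambda>x. ((\<Sum>i<n. x i) - d n) / real n powr (1 / \<alpha>))) L)"

text \<open>
  No centering unless \<open>\<alpha> = 1\<close>; in particular laws with \<open>\<alpha> > 1\<close> have mean zero.
  For \<open>\<alpha> = 1\<close> the usual convention \<open>d n \<sim> n log n\<close> asks for a limit in \<open>(0, \<infinity>)\<close>. The
  limit 0 is admitted as well: a symmetric limit law has equal tail constants, which forces
  \<open>d n = o(n log n)\<close>, so excluding 0 would leave no distribution at all (not even the
  Cauchy law) in the case \<open>\<alpha> = 1\<close>.
\<close>

definition centering_convention :: "real \<Rightarrow> (nat \<Rightarrow> real) \<Rightarrow> bool" where
  "centering_convention \<alpha> d \<longleftrightarrow>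
     (\<alpha> \<noteq> 1 \<longrightarrow> (\<forall>n. d n = 0)) \<and>
     (\<alpha> = 1 \<longrightarrow> (\<exists>c\<ge>0. (\<lambda>n. d n / (real n * ln (real n))) \<longlonglongrightarrow> c))"

definition law_count :: "'a measure \<Rightarrow> (nat \<Rightarrow> 'a \<Rightarrow> real) \<Rightarrow> real measure \<Rightarrow> nat \<Rightarrow> nat" where
  "law_count M X G n = card {k \<in> {1..n}. distr M borel (X k) = G}"

definition partial_sum :: "(nat \<Rightarrow> 'a \<Rightarrow> real) \<Rightarrow> nat \<Rightarrow> 'a \<Rightarrow> real" where
  "partial_sum X n \<omega> = (\<Sum>k=1..n. X k \<omega>)"

definition random_block_sum ::
    "(nat \<Rightarrow> 'a \<Rightarrow> real) \<Rightarrow> (nat \<Rightarrow> 'a \<Rightarrow> nat) \<Rightarrow> nat \<Rightarrow> 'a \<Rightarrow> real" where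
  "random_block_sum X a n \<omega> = partial_sum X (n + a n \<omega>) \<omega> - partial_sum X n \<omega>"

text \<open>
  Independence of \<open>N\<close> from the whole sequence \<open>X 1, X 2, \<dots>\<close>, that is, from the sigma-algebra
  it generates. The library's \<open>indep_var\<close> needs both variables to have the same value type,
  hence the formulation through the generated sigma-algebras.
\<close>

definition indep_of_sequence ::
    "'a measure \<Rightarrow> ('a \<Rightarrow> nat) \<Rightarrow> (nat \<Rightarrow> 'a \<Rightarrow> real) \<Rightarrow> bool" where
  "indep_of_sequence M N X \<longleftrightarrow>
     prob_space.indep_set M
       (sets (vimage_algebra (space M) N (count_space UNIV)))
       (sets (vimage_algebra (space M) (\<lambda>\<omega>. \<lambda>k\<in>{1..}. X k \<omega>) (Pi\<^sub>M {1..} (\<lambda>_. borel))))"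

definition norming :: "ereal \<Rightarrow> real \<Rightarrow> real \<Rightarrow> (nat \<Rightarrow> nat) \<Rightarrow> (nat \<Rightarrow> nat) \<Rightarrow> nat \<Rightarrow> real" where
  "norming l \<alpha>1 \<alpha>2 \<tau>1 \<tau>2 n =
     (if l = \<infinity> then real (\<tau>1 n) powr (1 / \<alpha>1) else real (\<tau>2 n) powr (1 / \<alpha>2))"

end

theory Submission
  imports Defs "HOL-Real_Asymp.Real_Asymp"
begin

text \<open>
Why the result holds. The normal attraction of \<open>G\<^sub>j\<close> to a symmetric stable law is used only
through its consequences for absolute values: \<open>P(|X| > x)\<close> lies between two positive multiples
of \<open>x powr (- \<alpha>\<^sub>j)\<close> for large \<open>x\<close>, and the mean is zero when \<open>\<alpha>\<^sub>j > 1\<close>. These are read off the characteristic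
function \<open>\<phi>\<close> of \<open>G\<^sub>j\<close>: convergence of \<open>|\<phi>(t / n powr (1 / \<alpha>))| ^ n\<close> makes \<open>1 - |\<phi>(s)|\<^sup>2\<close>, which
is \<open>E (1 - cos (s Z))\<close> for the difference \<open>Z\<close> of two independent copies, of exact order
\<open>s powr \<alpha>\<close>, and this order is equivalent to the tail bounds because \<open>\<alpha> < 2\<close>
(\<open>attracted_two_sided_tails\<close>, \<open>attracted_mean_zero\<close>).

Write \<open>\<alpha>\<close> for the exponent \<open>\<alpha>\<^sub>1\<close> or \<open>\<alpha>\<^sub>2\<close> that appears in the conclusion and
\<open>\<theta> n = B n * (ln n) powr (1 / \<alpha>)\<close>. In each regime the assumptions on \<open>\<tau>\<^sub>1\<close> and \<open>\<tau>\<^sub>2\<close> imply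
that \<open>\<tau>\<^sub>i(n) ln n\<close> is at most of the order \<open>\<theta> n powr \<alpha>\<^sub>i\<close> for both classes, with
equality of orders for the class whose exponent is \<open>\<alpha>\<close>. Since the \<open>k\<close>-th summand exceeds \<open>\<theta> k\<close>
with probability of order \<open>\<theta> k powr (- \<alpha>\<^sub>i)\<close>, and since \<open>k\<close> is the \<open>\<tau>\<^sub>i(k)\<close>-th member of its
class, everything is governed by the series of \<open>1 / (m (ln m) powr p)\<close>, convergent for
\<open>p > 1\<close> and divergent for \<open>p = 1\<close>.

Upper bound (\<open>block_upper\<close>). With the additional factor \<open>(ln n) powr \<delta>\<close> the series converges.
Truncating each summand at the norming level, Kolmogorov's maximal inequality and Kronecker's
lemma give \<open>S n = o(\<theta> n (ln n) powr \<delta>)\<close> almost surely. A block of length \<open>a n\<close> after \<open>n\<close> is the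
difference of two partial sums, and the norming at \<open>n + a n\<close> is at most a constant multiple
of the norming at \<open>n\<close>.

Lower bound (\<open>block_lower\<close>). The series at level \<open>K \<theta> k\<close> diverges for every \<open>K\<close>, so infinitely
many single summands \<open>X k\<close> exceed \<open>K \<theta> k\<close>. The block that starts at \<open>k\<close> contains \<open>X k\<close>, and
the sum of its other members could cancel \<open>X k\<close>. The random lengths may depend on each
other and, jointly, on the summands; but each single length is independent of them, hence
the probability that \<open>X k\<close> and the rest of the block are both large is at most the product
of the two probabilities, of order \<open>1 / (\<tau>(k) ln k) * 1 / ln k\<close>. This is summable, so
cancellation occurs only finitely often. The statement on the power \<open>1 / ln ln n\<close> follows
from the two bounds by taking logarithms.
\<close>

section \<open>Kronecker's lemma and logarithmic series\<close>

text \<open>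
Summation by parts turns the weighted partial sums into an average of the tails of the series
against the increments of \<open>b\<close>; the tails tend to zero and finitely many of them are negligible
against \<open>b n\<close>.
\<close>

lemma kronecker_lemma:
  fixes x b :: "nat \<Rightarrow> real"
  assumes x: "summable x" and b: "mono b" and b_pos: "\<And>n. 0 < b n"
    and b_inf: "filterlim b at_top sequentially"
  shows "(\<lambda>n. (\<Sum>k\<le>n. b k * x k) / b n) \<longlonglongrightarrow> 0"
proof -
  define r where "r n = (\<Sum>k. x (k + n))" for n
  have r_lim: "r \<longlonglongrightarrow> 0"
    unfolding r_def by (rule suminf_exist_split2[OF x])
  have x_r: "x k = r k - r (Suc k)" for k
    unfolding r_def using suminf_split_head[of "\<lambda>i. x (i + k)"] x
    by (simp add: summable_iff_shift)
  have abel: "(\<Sum>k\<le>n. b k * x k) = b 0 * r 0 + (\<Sum>k<n. (b (Suc k) - b k) * r (Suc k)) - b n * r (Suc n)" for n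
    by (induction n) (simp_all add: x_r algebra_simps)
  show ?thesis
  proof (rule LIMSEQ_I)
    fix e :: real assume "0 < e"
    then obtain m where m: "\<And>n. m \<le> n \<Longrightarrow> \<bar>r n\<bar> < e / 4"
      using LIMSEQ_D[OF r_lim, of "e/4"] by auto
    define D where "D = \<bar>b 0 * r 0\<bar> + (\<Sum>k<m. \<bar>(b (Suc k) - b k) * r (Suc k)\<bar>)"
    have bnd: "\<bar>\<Sum>k\<le>n. b k * x k\<bar> \<le> D + e / 2 * b n" if "m \<le> n" for n
    proof -
      have db: "0 \<le> b (Suc k) - b k" for k using b by (simp add: monoD)
      have "\<bar>\<Sum>k<n. (b (Suc k) - b k) * r (Suc k)\<bar> \<le> (\<Sum>k<n. \<bar>(b (Suc k) - b k) * r (Suc k)\<bar>)"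
        by (rule sum_abs)
      also have "\<dots> = (\<Sum>k<m. \<bar>(b (Suc k) - b k) * r (Suc k)\<bar>) + (\<Sum>k=m..<n. \<bar>(b (Suc k) - b k) * r (Suc k)\<bar>)"
        using that by (simp add: atLeast0LessThan[symmetric] sum.atLeastLessThan_concat)
      also have "(\<Sum>k=m..<n. \<bar>(b (Suc k) - b k) * r (Suc k)\<bar>) \<le> (\<Sum>k=m..<n. (b (Suc k) - b k) * (e/4))"
      proof (rule sum_mono)
        fix k assume k: "k \<in> {m..<n}"
        have "\<bar>r (Suc k)\<bar> \<le> e / 4" using m[of "Suc k"] k by simp
        then show "\<bar>(b (Suc k) - b k) * r (Suc k)\<bar> \<le> (b (Suc k) - b k) * (e/4)"
          unfolding abs_mult using db by (intro mult_mono) auto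
      qed
      also have "\<dots> = (b n - b m) * (e/4)"
        using that by (subst sum_distrib_right[symmetric]) (simp add: sum_Suc_diff')
      also have "\<dots> \<le> b n * (e/4)"
        using \<open>0 < e\<close> b_pos[of m] by (intro mult_right_mono) auto
      finally have 1: "\<bar>\<Sum>k<n. (b (Suc k) - b k) * r (Suc k)\<bar>
          \<le> (\<Sum>k<m. \<bar>(b (Suc k) - b k) * r (Suc k)\<bar>) + b n * (e/4)" by simp
      have 2: "\<bar>b n * r (Suc n)\<bar> \<le> b n * (e/4)"
        using m[of "Suc n"] that b_pos[of n] by (auto simp: abs_mult intro!: mult_left_mono less_imp_le)
      have tri: "\<bar>p + s - q\<bar> \<le> \<bar>p\<bar> + \<bar>s\<bar> + \<bar>q\<bar>" for p s q :: real by linarith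
      have half: "e / 2 * b n = b n * (e/4) + b n * (e/4)" by simp
      show ?thesis unfolding abel D_def half
        by (rule order_trans[OF tri]) (use 1 2 in \<open>simp add: mult.commute\<close>)
    qed
    have "eventually (\<lambda>n. 4 * D / e < b n) sequentially"
      using b_inf by (auto simp: filterlim_at_top_dense)
    then obtain n0 where n0: "\<And>n. n0 \<le> n \<Longrightarrow> 4 * D / e < b n"
      by (auto simp: eventually_sequentially)
    show "\<exists>no. \<forall>n\<ge>no. norm ((\<Sum>k\<le>n. b k * x k) / b n - 0) < e"
    proof (intro exI allI impI)
      fix n assume n: "max m n0 \<le> n"
      then have "D < e / 4 * b n" using n0[of n] \<open>0 < e\<close> by (auto simp: field_simps)
      with bnd[of n] n \<open>0 < e\<close> b_pos[of n] have "\<bar>\<Sum>k\<le>n. b k * x k\<bar> < e * b n"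
        by (simp add: field_simps)
      then show "norm ((\<Sum>k\<le>n. b k * x k) / b n - 0) < e"
        using b_pos[of n] by (simp add: field_simps)
    qed
  qed
qed

text \<open>
Cauchy condensation turns this series into a multiple of the harmonic series. The terms at
\<open>m < 2\<close> are replaced by a constant, because there the logarithm vanishes and the sequence would
not be monotone.
\<close>

lemma not_summable_inverse_n_ln: "\<not> summable (\<lambda>m. 1 / (real m * ln (real m)))"
proof
  assume "summable (\<lambda>m. 1 / (real m * ln (real m)))"
  then have s: "summable (\<lambda>n. 1 / (real (n+2) * ln (real (n+2))))"
    by (subst summable_iff_shift)
  let ?f = "\<lambda>m. if m < 2 then 1 / (2 * ln 2) else 1 / (real m * ln (real m))"
  have "summable (\<lambda>n. ?f (n + 2))" using s by simp
  then have "summable ?f" by (subst (asm) summable_iff_shift)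
  then have "summable (\<lambda>n. 2^n * ?f (2^n))"
  proof (subst condensation_test[symmetric])
    fix m :: nat assume "0 < m"
    show "?f (Suc m) \<le> ?f m"
      using \<open>0 < m\<close> by (auto intro!: divide_left_mono mult_mono mult_pos_pos
        simp: not_less less_Suc_eq numeral_2_eq_2)
  qed auto
  then have "summable (\<lambda>n. 2^(n+1) * ?f (2^(n+1)))"
    by (subst summable_iff_shift)
  also have "(\<lambda>n. 2^(n+1) * ?f (2^(n+1))) = (\<lambda>n. inverse (ln 2) * inverse (real (Suc n)))"
  proof
    fix n :: nat
    have "ln (real (2^(n+1))) = real (Suc n) * ln 2" "\<not> (2::nat)^(n+1) < 2"
      by (simp_all add: ln_realpow del: power_Suc) simp
    then show "2^(n+1) * ?f (2^(n+1)) = inverse (ln 2) * inverse (real (Suc n))"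
      by (simp add: divide_simps del: power_Suc of_nat_Suc)
  qed
  finally have "summable (\<lambda>n. inverse (real (Suc n)))"
    by (subst (asm) summable_cmult_iff) auto
  then have "summable (\<lambda>n. inverse (real n))"
    by (subst (asm) summable_Suc_iff)
  then show False using not_summable_harmonic[where 'a=real] by simp
qed

lemma summable_inverse_n_ln_powr:
  assumes "1 < p"
  shows "summable (\<lambda>m. 1 / (real m * ln (real m) powr p))"
proof -
  let ?f = "\<lambda>m. if m < 2 then 1 / (2 * ln 2 powr p) else 1 / (real m * ln (real m) powr p)"
  have "summable (\<lambda>n. inverse (ln 2 powr p) * real n powr (-p))"
    using assms by (intro summable_mult) (auto simp: summable_real_powr_iff)
  then have "summable (\<lambda>n. inverse (ln 2 powr p) * real (Suc n) powr (-p))"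
    by (subst summable_Suc_iff)
  also have "(\<lambda>n. inverse (ln 2 powr p) * real (Suc n) powr (-p)) = (\<lambda>n. 2^(n+1) * ?f (2^(n+1)))"
  proof
    fix n :: nat
    have "ln (real (2^(n+1))) = real (Suc n) * ln 2" "\<not> (2::nat)^(n+1) < 2"
      by (simp_all add: ln_realpow del: power_Suc) simp
    then show "inverse (ln 2 powr p) * real (Suc n) powr (-p) = 2^(n+1) * ?f (2^(n+1))"
      by (simp add: divide_simps powr_minus powr_mult del: power_Suc of_nat_Suc)
  qed
  finally have "summable (\<lambda>n. 2^n * ?f (2^n))"
    by (subst (asm) summable_iff_shift)
  then have "summable ?f"
  proof (subst condensation_test)
    fix m :: nat assume "0 < m"
    show "?f (Suc m) \<le> ?f m"
      using \<open>0 < m\<close> assms by (auto intro!: divide_left_mono mult_mono mult_pos_pos powr_mono2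
        simp: not_less less_Suc_eq numeral_2_eq_2)
  qed auto
  then have "summable (\<lambda>n. ?f (n + 2))" by (subst summable_iff_shift)
  then have "summable (\<lambda>n. 1 / (real (n+2) * ln (real (n+2)) powr p))" by simp
  then show ?thesis by (subst (asm) summable_iff_shift)
qed

text \<open>
The counting function of \<open>K\<close> numbers the elements of \<open>K\<close> consecutively. Through it, a sum over
a class of indices of a function of the count becomes a sum over an initial segment of the
naturals.
\<close>

lemma card_initial_bij:
  fixes K :: "nat set"
  shows "bij_betw (\<lambda>k. card (K \<inter> {1..k})) (K \<inter> {1..n}) {1..card (K \<inter> {1..n})}"
proof (induction n)
  case (Suc n)
  show ?case
  proof (cases "Suc n \<in> K")
    case True
    then have eq: "K \<inter> {1..Suc n} = insert (Suc n) (K \<inter> {1..n})"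
      by (auto simp: atLeastAtMostSuc_conv)
    then have c: "card (K \<inter> {1..Suc n}) = Suc (card (K \<inter> {1..n}))" by simp
    have "bij_betw (\<lambda>k. card (K \<inter> {1..k})) (K \<inter> {1..n} \<union> {Suc n})
        ({1..card (K \<inter> {1..n})} \<union> {card (K \<inter> {1..Suc n})})"
      using Suc.IH by (intro notIn_Un_bij_betw) (auto simp: c[simplified])
    also have "K \<inter> {1..n} \<union> {Suc n} = K \<inter> {1..Suc n}" using eq by simp
    also have "{1..card (K \<inter> {1..n})} \<union> {card (K \<inter> {1..Suc n})} = {1..card (K \<inter> {1..Suc n})}"
      unfolding c by (simp add: atLeastAtMostSuc_conv)
    finally show ?thesis .
  next
    case False
    then have "K \<inter> {1..Suc n} = K \<inter> {1..n}" by (auto simp: atLeastAtMostSuc_conv)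
    then show ?thesis using Suc.IH by simp
  qed
qed (simp add: bij_betw_def)

lemma sum_over_class:
  fixes K :: "nat set" and f :: "nat \<Rightarrow> real"
  shows "(\<Sum>k\<in>K \<inter> {1..n}. f (card (K \<inter> {1..k}))) = (\<Sum>m=1..card (K \<inter> {1..n}). f m)"
  by (rule sum.reindex_bij_betw[OF card_initial_bij])

section \<open>Sums of independent random variables\<close>

context prob_space
begin

lemma indep_var_blocks:
  fixes Z :: "nat \<Rightarrow> 'a \<Rightarrow> real"
  assumes "indep_vars (\<lambda>_. borel) Z I" "A \<inter> B = {}" "A \<subseteq> I" "B \<subseteq> I"
    and "f \<in> borel_measurable (Pi\<^sub>M A (\<lambda>_. borel))" "g \<in> borel_measurable (Pi\<^sub>M B (\<lambda>_. borel))"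
  shows "indep_var borel (\<lambda>\<omega>. f (\<lambda>i\<in>A. Z i \<omega>)) borel (\<lambda>\<omega>. g (\<lambda>i\<in>B. Z i \<omega>))"
  using indep_var_compose[OF indep_var_restrict[OF assms(1-4)] assms(5,6)] by (simp add: comp_def)

text \<open>
Kolmogorov's maximal inequality. The event is split by the first index \<open>k\<close> at which the partial
sum \<open>W k\<close> reaches \<open>\<epsilon>\<close>. On that event \<open>W n\<^sup>2 \<ge> W k\<^sup>2 + 2 W k (W n - W k)\<close>, and the
cross term has mean zero, because \<open>W n - W k\<close> is centred and independent of the past up to \<open>k\<close>.
\<close>

lemma kolmogorov_maximal:
  fixes Z :: "nat \<Rightarrow> 'a \<Rightarrow> real"
  assumes ind: "indep_vars (\<lambda>_. borel) Z {m..<n}"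
    and sq: "\<And>i. i \<in> {m..<n} \<Longrightarrow> integrable M (\<lambda>\<omega>. (Z i \<omega>)\<^sup>2)"
    and mean: "\<And>i. i \<in> {m..<n} \<Longrightarrow> expectation (Z i) = 0"
    and \<epsilon>: "0 < \<epsilon>"
  shows "prob {\<omega>\<in>space M. \<exists>k\<in>{m..n}. \<epsilon> \<le> \<bar>\<Sum>i=m..<k. Z i \<omega>\<bar>}
    \<le> (\<Sum>i=m..<n. expectation (\<lambda>\<omega>. (Z i \<omega>)\<^sup>2)) / \<epsilon>\<^sup>2"
proof -
  define W where "W k \<omega> = (\<Sum>i=m..<k. Z i \<omega>)" for k \<omega>
  have Zm[measurable]: "Z i \<in> borel_measurable M" if "i \<in> {m..<n}" for i
    using ind that by (auto simp: indep_vars_def)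
  have Zi: "integrable M (Z i)" if "i \<in> {m..<n}" for i
    using sq[OF that] Zm[OF that] by (rule square_integrable_imp_integrable[rotated])
  have Wm: "W k \<in> borel_measurable M" if "k \<le> n" for k
    unfolding W_def using that by (intro borel_measurable_sum Zm) auto
  have Wi: "integrable M (W k)" if "k \<le> n" for k
    unfolding W_def using that by (intro Bochner_Integration.integrable_sum Zi) auto
  have W_sq: "integrable M (\<lambda>\<omega>. (W k \<omega>)\<^sup>2) \<and>
      expectation (\<lambda>\<omega>. (W k \<omega>)\<^sup>2) = (\<Sum>i=m..<k. expectation (\<lambda>\<omega>. (Z i \<omega>)\<^sup>2))" if "k \<le> n" for k
    using that
  proof (induction k)
    case 0 then show ?case by (simp add: W_def)
  next
    case (Suc k)
    show ?case
    proof (cases "m \<le> k")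
      case True
      then have k: "k \<in> {m..<n}" using Suc by auto
      have eq: "W (Suc k) \<omega> = W k \<omega> + Z k \<omega>" for \<omega> using True by (simp add: W_def)
      have "indep_var borel (\<lambda>\<omega>. \<Sum>i\<in>{m..<k}. (\<lambda>i\<in>{m..<k}. Z i \<omega>) i) borel (\<lambda>\<omega>. (\<lambda>i\<in>{k}. Z i \<omega>) k)"
        using k by (intro indep_var_blocks[OF ind]) (auto intro!: borel_measurable_sum)
      then have iv: "indep_var borel (W k) borel (Z k)" by (simp add: W_def[abs_def])
      have 1: "integrable M (\<lambda>\<omega>. W k \<omega> * Z k \<omega>)"
        using iv Wi[of k] Zi[OF k] k by (intro indep_var_integrable) auto
      have 2: "expectation (\<lambda>\<omega>. W k \<omega> * Z k \<omega>) = 0"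
        using iv Wi[of k] Zi[OF k] k mean[OF k] by (subst indep_var_lebesgue_integral) auto
      have eq2: "(\<lambda>\<omega>. (W (Suc k) \<omega>)\<^sup>2) = (\<lambda>\<omega>. (W k \<omega>)\<^sup>2 + (Z k \<omega>)\<^sup>2 + 2 * (W k \<omega> * Z k \<omega>))"
        by (simp add: fun_eq_iff eq power2_eq_square algebra_simps)
      show ?thesis unfolding eq2 using Suc 1 2 sq[OF k] True by (auto simp: add.commute)
    next
      case False then show ?thesis by (simp add: W_def)
    qed
  qed
  define A where "A k = {\<omega>\<in>space M. \<epsilon> \<le> \<bar>W k \<omega>\<bar> \<and> (\<forall>j\<in>{m..<k}. \<bar>W j \<omega>\<bar> < \<epsilon>)}" for k
  have A_sets: "A k \<in> sets M" if "k \<le> n" for k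
  proof -
    have "{\<omega>\<in>space M. \<epsilon> \<le> \<bar>W k \<omega>\<bar>} \<in> sets M" using Wm[OF that] by measurable
    moreover have "{\<omega>\<in>space M. \<forall>j\<in>{m..<k}. \<bar>W j \<omega>\<bar> < \<epsilon>} \<in> sets M"
      using that by (intro sets.sets_Collect_finite_All) (auto intro!: borel_measurable_less borel_measurable_abs Wm)
    moreover have "A k = {\<omega>\<in>space M. \<epsilon> \<le> \<bar>W k \<omega>\<bar>} \<inter> {\<omega>\<in>space M. \<forall>j\<in>{m..<k}. \<bar>W j \<omega>\<bar> < \<epsilon>}"
      by (auto simp: A_def)
    ultimately show ?thesis by auto
  qed
  have disj: "disjoint_family_on A {m..n}"
    unfolding disjoint_family_on_def A_def
  proof (safe, goal_cases)
    case (1 k k' \<omega>)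
    then show ?case by (cases k k' rule: linorder_cases) force+
  qed
  have union: "{\<omega>\<in>space M. \<exists>k\<in>{m..n}. \<epsilon> \<le> \<bar>W k \<omega>\<bar>} = (\<Union>k\<in>{m..n}. A k)"
  proof safe
    fix \<omega> k assume w: "\<omega> \<in> space M" "k \<in> {m..n}" "\<epsilon> \<le> \<bar>W k \<omega>\<bar>"
    define k0 where "k0 = (LEAST k. m \<le> k \<and> \<epsilon> \<le> \<bar>W k \<omega>\<bar>)"
    have "m \<le> k0 \<and> \<epsilon> \<le> \<bar>W k0 \<omega>\<bar>" unfolding k0_def by (rule LeastI[of _ k]) (use w in auto)
    moreover have "k0 \<le> k" unfolding k0_def by (rule Least_le) (use w in auto)
    moreover have "\<bar>W j \<omega>\<bar> < \<epsilon>" if "j \<in> {m..<k0}" for j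
      using not_less_Least[of j "\<lambda>k. m \<le> k \<and> \<epsilon> \<le> \<bar>W k \<omega>\<bar>"] that unfolding k0_def[symmetric] by auto
    ultimately show "\<omega> \<in> (\<Union>k\<in>{m..n}. A k)" using w by (auto simp: A_def intro!: bexI[of _ k0])
  qed (auto simp: A_def)
  have step: "\<epsilon>\<^sup>2 * prob (A k) \<le> expectation (\<lambda>\<omega>. (W n \<omega>)\<^sup>2 * indicator (A k) \<omega>)"
    if k: "k \<in> {m..n}" for k
  proof -
    have kn: "k \<le> n" using k by simp
    define F where "F f = (if \<epsilon> \<le> \<bar>\<Sum>i=m..<k. f i\<bar> \<and> (\<forall>j\<in>{m..<k}. \<bar>\<Sum>i=m..<j. f i\<bar> < \<epsilon>)
        then (\<Sum>i=m..<k. f i) else 0)" for f :: "nat \<Rightarrow> real"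
    have [measurable]: "(\<lambda>f. \<Sum>i=m..<j. f i) \<in> borel_measurable (Pi\<^sub>M {m..<k} (\<lambda>_. borel :: real measure))"
      if "j \<le> k" for j
      using that by (intro borel_measurable_sum measurable_component_singleton) auto
    have Fm: "F \<in> borel_measurable (Pi\<^sub>M {m..<k} (\<lambda>_. borel))"
      unfolding F_def[abs_def]
      by (intro measurable_If measurable_const pred_intros_logic pred_intros_finite) (auto; measurable)+
    \<comment> \<open>The product of \<open>W k\<close> with the indicator of \<open>A k\<close>, written as a function of the first variables so
        that independence of the later ones applies.\<close>
    define U where "U \<omega> = F (\<lambda>i\<in>{m..<k}. Z i \<omega>)" for \<omega>
    have "indep_var borel (\<lambda>\<omega>. F (\<lambda>i\<in>{m..<k}. Z i \<omega>)) borel (\<lambda>\<omega>. \<Sum>i\<in>{k..<n}. (\<lambda>i\<in>{k..<n}. Z i \<omega>) i)"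
      using k Fm by (intro indep_var_blocks[OF ind]) (auto intro!: borel_measurable_sum)
    then have iv: "indep_var borel U borel (\<lambda>\<omega>. \<Sum>i\<in>{k..<n}. Z i \<omega>)"
      by (simp add: U_def[abs_def])
    have U_eq: "U \<omega> = W k \<omega> * indicator (A k) \<omega>" if "\<omega> \<in> space M" for \<omega>
    proof -
      have "(\<Sum>i=m..<j. (\<lambda>i\<in>{m..<k}. Z i \<omega>) i) = W j \<omega>" if "j \<le> k" for j
        unfolding W_def using that by (intro sum.cong) auto
      then show ?thesis unfolding U_def F_def A_def using that by (auto simp: indicator_def)
    qed
    have d: "W n \<omega> = W k \<omega> + (\<Sum>i\<in>{k..<n}. Z i \<omega>)" for \<omega>
      using k by (simp add: W_def sum.atLeastLessThan_concat)
    have i1: "integrable M U"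
      using integrable_real_mult_indicator[OF A_sets[OF kn] Wi[OF kn]]
      by (subst Bochner_Integration.integrable_cong[OF refl U_eq]) auto
    have i2: "integrable M (\<lambda>\<omega>. \<Sum>i\<in>{k..<n}. Z i \<omega>)"
      using k by (intro Bochner_Integration.integrable_sum Zi) auto
    have m2: "expectation (\<lambda>\<omega>. \<Sum>i\<in>{k..<n}. Z i \<omega>) = 0"
      using k by (subst Bochner_Integration.integral_sum) (auto intro!: Zi sum.neutral mean)
    let ?C = "\<lambda>\<omega>. U \<omega> * (\<Sum>i\<in>{k..<n}. Z i \<omega>)"
    have ci: "integrable M ?C" by (rule indep_var_integrable[OF iv i1 i2])
    have c0: "expectation ?C = 0" using m2 by (simp add: indep_var_lebesgue_integral[OF iv i1 i2])
    have "\<epsilon>\<^sup>2 * prob (A k) = expectation (\<lambda>\<omega>. \<epsilon>\<^sup>2 * indicator (A k) \<omega>)"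
      using A_sets[OF kn] by simp
    also have "\<dots> = expectation (\<lambda>\<omega>. \<epsilon>\<^sup>2 * indicator (A k) \<omega> + 2 * ?C \<omega>)"
      using A_sets[OF kn] ci c0 by (subst Bochner_Integration.integral_add) (auto simp: emeasure_eq_measure)
    also have "\<dots> \<le> expectation (\<lambda>\<omega>. (W n \<omega>)\<^sup>2 * indicator (A k) \<omega>)"
    proof (rule integral_mono)
      show "integrable M (\<lambda>\<omega>. \<epsilon>\<^sup>2 * indicator (A k) \<omega> + 2 * ?C \<omega>)"
        using A_sets[OF kn] ci by (auto simp: emeasure_eq_measure)
      show "integrable M (\<lambda>\<omega>. (W n \<omega>)\<^sup>2 * indicator (A k) \<omega>)"
        using W_sq[of n] A_sets[OF kn] by (intro integrable_real_mult_indicator) auto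
      fix \<omega> assume w: "\<omega> \<in> space M"
      show "\<epsilon>\<^sup>2 * indicator (A k) \<omega> + 2 * ?C \<omega> \<le> (W n \<omega>)\<^sup>2 * indicator (A k) \<omega>"
      proof (cases "\<omega> \<in> A k")
        case True
        then have "\<epsilon>\<^sup>2 \<le> (W k \<omega>)\<^sup>2" using \<epsilon> by (auto simp: A_def power2_le_iff_abs_le abs_le_square_iff[symmetric])
        then show ?thesis using True d[of \<omega>] U_eq[OF w] by (simp add: power2_sum add_increasing2)
      qed (simp add: U_eq[OF w])
    qed
    finally show ?thesis .
  qed
  have "\<epsilon>\<^sup>2 * prob {\<omega>\<in>space M. \<exists>k\<in>{m..n}. \<epsilon> \<le> \<bar>W k \<omega>\<bar>} = (\<Sum>k=m..n. \<epsilon>\<^sup>2 * prob (A k))"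
    unfolding union using A_sets disj
    by (subst finite_measure_finite_Union) (auto simp: sum_distrib_left)
  also have "\<dots> \<le> (\<Sum>k=m..n. expectation (\<lambda>\<omega>. (W n \<omega>)\<^sup>2 * indicator (A k) \<omega>))"
    by (intro sum_mono step)
  also have "\<dots> = expectation (\<lambda>\<omega>. \<Sum>k=m..n. (W n \<omega>)\<^sup>2 * indicator (A k) \<omega>)"
    using W_sq[of n] A_sets
    by (subst Bochner_Integration.integral_sum) (auto intro!: integrable_real_mult_indicator)
  also have "\<dots> \<le> expectation (\<lambda>\<omega>. (W n \<omega>)\<^sup>2)"
  proof (rule integral_mono)
    show "integrable M (\<lambda>\<omega>. \<Sum>k=m..n. (W n \<omega>)\<^sup>2 * indicator (A k) \<omega>)"
      using W_sq[of n] A_sets by (intro Bochner_Integration.integrable_sum integrable_real_mult_indicator) auto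
    fix \<omega>
    have "(\<Sum>k=m..n. indicator (A k) \<omega>) \<le> (1::real)"
    proof -
      have "(\<Sum>k=m..n. indicator (A k) \<omega>) = (indicator (\<Union>k\<in>{m..n}. A k) \<omega> :: real)"
        using disj by (subst indicator_UN_disjoint) auto
      then show ?thesis by (simp add: indicator_def)
    qed
    then show "(\<Sum>k=m..n. (W n \<omega>)\<^sup>2 * indicator (A k) \<omega>) \<le> (W n \<omega>)\<^sup>2"
      unfolding sum_distrib_left[symmetric] by (intro mult_right_le_one_le sum_nonneg) auto
  qed (use W_sq[of n] in auto)
  also have "\<dots> = (\<Sum>i=m..<n. expectation (\<lambda>\<omega>. (Z i \<omega>)\<^sup>2))" using W_sq[of n] by simp
  finally show ?thesis using \<epsilon> by (simp add: W_def field_simps)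
qed

text \<open>
The one-series theorem: by the maximal inequality the fluctuation of the partial sums after \<open>m\<close>
exceeds \<open>\<epsilon>\<close> with a probability controlled by the remaining variances, hence the partial sums
are almost surely Cauchy.
\<close>

lemma AE_summable_indep:
  fixes Z :: "nat \<Rightarrow> 'a \<Rightarrow> real"
  assumes ind: "indep_vars (\<lambda>_. borel) Z {1..}"
    and sq: "\<And>i. 1 \<le> i \<Longrightarrow> integrable M (\<lambda>\<omega>. (Z i \<omega>)\<^sup>2)"
    and mean: "\<And>i. 1 \<le> i \<Longrightarrow> expectation (Z i) = 0"
    and sum: "summable (\<lambda>i. expectation (\<lambda>\<omega>. (Z i \<omega>)\<^sup>2))"
  shows "AE \<omega> in M. summable (\<lambda>i. Z i \<omega>)"
proof -
  define v where "v i = expectation (\<lambda>\<omega>. (Z i \<omega>)\<^sup>2)" for i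
  have v0: "0 \<le> v i" for i unfolding v_def by (rule Bochner_Integration.integral_nonneg) simp
  have Zm: "Z i \<in> borel_measurable M" if "1 \<le> i" for i using ind that by (auto simp: indep_vars_def)
  define C where "C \<epsilon> m n = {\<omega>\<in>space M. \<exists>k\<in>{m..n}. \<epsilon> \<le> \<bar>\<Sum>i=m..<k. Z i \<omega>\<bar>}" for \<epsilon> m and n :: nat
  have Cm: "C \<epsilon> m n \<in> sets M" if "1 \<le> m" for \<epsilon> m n
    unfolding C_def using that
    by (intro sets.sets_Collect_finite_Ex) (auto intro!: borel_measurable_le borel_measurable_abs borel_measurable_sum Zm)
  have C_le: "prob (C \<epsilon> m n) \<le> (\<Sum>k. v (k + m)) / \<epsilon>\<^sup>2" if "1 \<le> m" "0 < \<epsilon>" for \<epsilon> m n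
  proof -
    have "prob (C \<epsilon> m n) \<le> (\<Sum>i=m..<n. v i) / \<epsilon>\<^sup>2"
      unfolding C_def v_def using that
      by (intro kolmogorov_maximal sq mean indep_vars_subset[OF ind]) auto
    also have "(\<Sum>i=m..<n. v i) = (\<Sum>i<n-m. v (i + m))"
      by (cases "m \<le> n") (simp_all add: sum.shift_bounds_nat_ivl[of v 0 m, simplified, symmetric] atLeast0LessThan[symmetric])
    also have "\<dots> \<le> (\<Sum>k. v (k + m))"
      using summable_ignore_initial_segment[OF sum, of m] v0
      by (intro sum_le_suminf) (auto simp: v_def[abs_def])
    finally show ?thesis using that by (simp add: divide_right_mono)
  qed
  have null: "AE \<omega> in M. \<exists>m\<ge>1. \<forall>n. \<omega> \<notin> C \<epsilon> m n" if \<epsilon>: "0 < \<epsilon>" for \<epsilon>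
  proof -
    define D where "D m = (\<Union>n. C \<epsilon> m n)" for m
    have Dm: "D m \<in> sets M" if "1 \<le> m" for m unfolding D_def using Cm[OF that] by auto
    have D_le: "prob (D m) \<le> (\<Sum>k. v (k + m)) / \<epsilon>\<^sup>2" if m: "1 \<le> m" for m
    proof (rule LIMSEQ_le_const2)
      show "(\<lambda>n. prob (C \<epsilon> m n)) \<longlonglongrightarrow> prob (D m)"
        unfolding D_def using Cm[OF m]
        by (intro finite_Lim_measure_incseq) (auto simp: incseq_def C_def)
      show "\<exists>N. \<forall>n\<ge>N. prob (C \<epsilon> m n) \<le> (\<Sum>k. v (k + m)) / \<epsilon>\<^sup>2" using C_le[OF m \<epsilon>] by auto
    qed
    define E where "E = (\<Inter>m. D (Suc m))"
    have Em: "E \<in> sets M" unfolding E_def using Dm by auto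
    have E_sub: "E \<subseteq> D m" if "1 \<le> m" for m using that by (cases m) (auto simp: E_def)
    have "prob E \<le> 0"
    proof (rule LIMSEQ_le_const)
      have "(\<lambda>m. \<Sum>k. v (k + m)) \<longlonglongrightarrow> 0"
        using sum by (intro suminf_exist_split2) (simp add: v_def[abs_def])
      then show "(\<lambda>m. (\<Sum>k. v (k + m)) / \<epsilon>\<^sup>2) \<longlonglongrightarrow> 0"
        using tendsto_divide[OF _ tendsto_const, of _ 0 _ "\<epsilon>\<^sup>2"] \<epsilon> by auto
      show "\<exists>N. \<forall>m\<ge>N. prob E \<le> (\<Sum>k. v (k + m)) / \<epsilon>\<^sup>2"
        using D_le Dm by (intro exI[of _ 1] allI impI order_trans[OF finite_measure_mono D_le]) (auto intro: E_sub[THEN subsetD])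
    qed
    then have "prob E = 0" using measure_nonneg[of M E] by linarith
    then have "AE \<omega> in M. \<omega> \<notin> E" using Em by (simp add: prob_eq_0)
    then show ?thesis
    proof eventually_elim
      fix \<omega> assume "\<omega> \<notin> E"
      then obtain m where "\<omega> \<notin> D (Suc m)" by (auto simp: E_def)
      then show "\<exists>m\<ge>1. \<forall>n. \<omega> \<notin> C \<epsilon> m n" by (intro exI[of _ "Suc m"]) (auto simp: D_def)
    qed
  qed
  have "AE \<omega> in M. \<forall>q. \<exists>m\<ge>1. \<forall>n. \<omega> \<notin> C (1 / real (Suc q)) m n"
    by (subst AE_all_countable, intro allI null) simp
  with AE_space show ?thesis
  proof (eventually_elim)
    fix \<omega> assume w: "\<omega> \<in> space M" and C: "\<forall>q. \<exists>m\<ge>1. \<forall>n. \<omega> \<notin> C (1 / real (Suc q)) m n"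
    show "summable (\<lambda>i. Z i \<omega>)"
      unfolding summable_Cauchy
    proof (intro allI impI)
      fix e :: real assume "0 < e"
      then obtain q where q: "1 / real (Suc q) < e / 2"
        using reals_Archimedean[of "e/2"] by (auto simp: inverse_eq_divide)
      from C obtain m where m: "1 \<le> m" "\<And>n. \<omega> \<notin> C (1 / real (Suc q)) m n" by blast
      have bd: "\<bar>\<Sum>i=m..<k. Z i \<omega>\<bar> < e / 2" if "m \<le> k" for k
      proof -
        have "\<bar>\<Sum>i=m..<k. Z i \<omega>\<bar> < 1 / real (Suc q)"
          using m(2)[of k] w that unfolding C_def by (auto simp: not_le)
        then show ?thesis using q by (rule less_trans)
      qed
      show "\<exists>N. \<forall>m\<ge>N. \<forall>n. norm (\<Sum>i=m..<n. Z i \<omega>) < e"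
      proof (intro exI[of _ m] allI impI)
        fix k n assume k: "m \<le> k"
        show "norm (\<Sum>i=k..<n. Z i \<omega>) < e"
        proof (cases "k \<le> n")
          case True
          have "(\<Sum>i=k..<n. Z i \<omega>) = (\<Sum>i=m..<n. Z i \<omega>) - (\<Sum>i=m..<k. Z i \<omega>)"
            using sum.atLeastLessThan_concat[OF k True, of "\<lambda>i. Z i \<omega>"] by linarith
          then show ?thesis using bd[of k] bd[of n] k True by simp
        qed (use \<open>0 < e\<close> in simp)
      qed
    qed
  qed
qed

text \<open>
The second Borel-Cantelli lemma: the probability that none of the events occurs between \<open>m\<close> and
\<open>n\<close> is \<open>\<Prod> (1 - p k) \<le> exp (- \<Sum> p k)\<close>.
\<close>

lemma borel_cantelli_indep:
  fixes X :: "nat \<Rightarrow> 'a \<Rightarrow> real"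
  assumes ind: "indep_vars (\<lambda>_. borel) X I"
    and S: "\<And>k. k \<in> I \<Longrightarrow> S k \<in> sets borel"
    and div: "\<not> summable (\<lambda>k. if k \<in> I then prob {\<omega>\<in>space M. X k \<omega> \<in> S k} else 0)"
  shows "AE \<omega> in M. \<exists>\<^sub>\<infinity>k. k \<in> I \<and> X k \<omega> \<in> S k"
proof -
  define p where "p k = (if k \<in> I then prob {\<omega>\<in>space M. X k \<omega> \<in> S k} else 0)" for k
  have Xm[measurable]: "X k \<in> borel_measurable M" if "k \<in> I" for k using ind that by (auto simp: indep_vars_def)
  have p01: "0 \<le> p k" "p k \<le> 1" for k by (auto simp: p_def)
  define B where "B m n = {\<omega>\<in>space M. \<forall>k\<in>I \<inter> {m..<n}. X k \<omega> \<notin> S k}" for m n :: nat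
  have Xs: "{\<omega>\<in>space M. X k \<omega> \<notin> S k} \<in> sets M" "{\<omega>\<in>space M. X k \<omega> \<in> S k} \<in> sets M" if "k \<in> I" for k
    using Xm[OF that] S[OF that] by measurable
  have Bm: "B m n \<in> sets M" for m n
    unfolding B_def using Xs by (intro sets.sets_Collect_finite_All) auto
  have B_le: "prob (B m n) \<le> exp (- (\<Sum>k=m..<n. p k))" for m n
  proof (cases "I \<inter> {m..<n} = {}")
    case True
    then have "(\<Sum>k=m..<n. p k) = 0" by (intro sum.neutral) (auto simp: p_def)
    then show ?thesis by simp
  next
    case False
    have ie: "indep_events (\<lambda>k. {\<omega>\<in>space M. X k \<omega> \<notin> S k}) I"
      using S by (intro indep_eventsI_indep_vars[OF ind]) auto
    have "B m n = (\<Inter>k\<in>I \<inter> {m..<n}. {\<omega>\<in>space M. X k \<omega> \<notin> S k})" using False by (auto simp: B_def)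
    also have "prob \<dots> = (\<Prod>k\<in>I \<inter> {m..<n}. prob {\<omega>\<in>space M. X k \<omega> \<notin> S k})"
      using ie False unfolding indep_events_def by auto
    also have "\<dots> = (\<Prod>k\<in>I \<inter> {m..<n}. 1 - p k)"
    proof (intro prod.cong refl)
      fix k assume "k \<in> I \<inter> {m..<n}"
      then show "prob {\<omega>\<in>space M. X k \<omega> \<notin> S k} = 1 - p k"
        using prob_neg[OF Xs(2)[of k]] by (simp add: p_def)
    qed
    also have "\<dots> \<le> (\<Prod>k\<in>I \<inter> {m..<n}. exp (- p k))"
      using p01 by (intro prod_mono) (auto intro: order_trans[OF _ exp_ge_add_one_self])
    also have "\<dots> = exp (- (\<Sum>k\<in>I \<inter> {m..<n}. p k))"
      by (simp add: exp_sum sum_negf[symmetric])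
    also have "(\<Sum>k\<in>I \<inter> {m..<n}. p k) = (\<Sum>k=m..<n. p k)"
      by (intro sum.mono_neutral_left) (auto simp: p_def)
    finally show ?thesis .
  qed
  have "AE \<omega> in M. \<exists>n. \<omega> \<notin> B m n" for m
  proof -
    have Em: "(\<Inter>n. B m n) \<in> sets M" using Bm by auto
    have "prob (\<Inter>n. B m n) \<le> 0 + e" if "0 < e" for e :: real
    proof (rule ccontr)
      assume a: "\<not> prob (\<Inter>n. B m n) \<le> 0 + e"
      have "summable p"
      proof (rule summableI_nonneg_bounded[OF p01(1)])
        fix n
        have "e < exp (- (\<Sum>k=m..<n. p k))"
          using a B_le[of m n] finite_measure_mono[OF INT_lower[OF UNIV_I, of "B m" n] Bm[of m n]] by linarith
        then have "ln e \<le> - (\<Sum>k=m..<n. p k)" using that by (metis less_imp_le ln_exp ln_mono exp_gt_zero)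
        moreover have "(\<Sum>k<n. p k) \<le> (\<Sum>k<m. p k) + (\<Sum>k=m..<n. p k)"
        proof -
          have "(\<Sum>k<n. p k) \<le> (\<Sum>k\<in>{..<m} \<union> {m..<n}. p k)"
            using p01 by (intro sum_mono2) auto
          also have "\<dots> = (\<Sum>k<m. p k) + (\<Sum>k=m..<n. p k)" by (rule sum.union_disjoint) auto
          finally show ?thesis .
        qed
        ultimately show "(\<Sum>k<n. p k) \<le> (\<Sum>k<m. p k) - ln e" by linarith
      qed
      with div show False by (simp add: p_def[abs_def])
    qed
    then have "prob (\<Inter>n. B m n) \<le> 0" by (rule field_le_epsilon)
    then have "prob (\<Inter>n. B m n) = 0" using measure_nonneg[of M] by (metis order_antisym)
    then have "AE \<omega> in M. \<omega> \<notin> (\<Inter>n. B m n)" using Em by (subst prob_eq_0[symmetric])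
    then show ?thesis by eventually_elim auto
  qed
  then have "AE \<omega> in M. \<forall>m. \<exists>n. \<omega> \<notin> B m n" by (subst AE_all_countable) auto
  with AE_space show ?thesis
  proof eventually_elim
    fix \<omega> assume "\<omega> \<in> space M" "\<forall>m. \<exists>n. \<omega> \<notin> B m n"
    then show "\<exists>\<^sub>\<infinity>k. k \<in> I \<and> X k \<omega> \<in> S k"
      unfolding INFM_nat_le B_def by fastforce
  qed
qed

end

section \<open>Truncated moments from tail bounds\<close>

context prob_space
begin

text \<open>
Moments from tails. By Tonelli, the mean of \<open>H \<circ> Y\<close> with \<open>H\<close> the primitive of \<open>h\<close> is the integral
of \<open>h u P(Y \<ge> u)\<close>. Every moment estimate below is obtained by choosing \<open>Y\<close>, \<open>h\<close> and a majorant
\<open>k\<close> of the integrand with known integral.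
\<close>

lemma layer_cake_bound:
  fixes Y g :: "'a \<Rightarrow> real" and h k H :: "real \<Rightarrow> real"
  assumes Y[measurable]: "Y \<in> borel_measurable M" and g[measurable]: "g \<in> borel_measurable M"
    and h[measurable]: "h \<in> borel_measurable borel" and h0: "\<And>u. 0 \<le> u \<Longrightarrow> 0 \<le> h u"
    and Y0: "\<And>\<omega>. \<omega> \<in> space M \<Longrightarrow> 0 \<le> Y \<omega>"
    and H: "\<And>y. 0 \<le> y \<Longrightarrow> (h has_integral H y) {0..y}"
    and g_le: "\<And>\<omega>. \<omega> \<in> space M \<Longrightarrow> \<bar>g \<omega>\<bar> \<le> H (Y \<omega>)"
    and k: "(k has_integral I) {0..}" and k0: "\<And>u. 0 \<le> u \<Longrightarrow> 0 \<le> k u"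
    and hk: "\<And>u. 0 < u \<Longrightarrow> h u * prob {\<omega>\<in>space M. u \<le> Y \<omega>} \<le> k u"
  shows "integrable M g \<and> expectation (\<lambda>\<omega>. \<bar>g \<omega>\<bar>) \<le> I"
proof -
  interpret pair_sigma_finite M lborel ..
  have "(\<integral>\<^sup>+\<omega>. ennreal \<bar>g \<omega>\<bar> \<partial>M) \<le> (\<integral>\<^sup>+\<omega>. ennreal (H (Y \<omega>)) \<partial>M)"
    using g_le by (intro nn_integral_mono ennreal_leI) auto
  also have "\<dots> = (\<integral>\<^sup>+\<omega>. (\<integral>\<^sup>+u. ennreal (h u) * indicator {0..Y \<omega>} u \<partial>lborel) \<partial>M)"
    using H h0 Y0 by (intro nn_integral_cong nn_integral_has_integral_lebesgue'[symmetric]) auto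
  also have "\<dots> = (\<integral>\<^sup>+\<omega>. (\<integral>\<^sup>+u. (if 0 \<le> u \<and> u \<le> Y \<omega> then ennreal (h u) else 0) \<partial>lborel) \<partial>M)"
    by (intro nn_integral_cong) (auto simp: indicator_def)
  also have "\<dots> = (\<integral>\<^sup>+u. (\<integral>\<^sup>+\<omega>. (if 0 \<le> u \<and> u \<le> Y \<omega> then ennreal (h u) else 0) \<partial>M) \<partial>lborel)"
    by (rule Fubini'[symmetric]) measurable
  also have "\<dots> \<le> (\<integral>\<^sup>+u. ennreal (k u) * indicator {0..} u \<partial>lborel)"
  proof (rule nn_integral_mono_AE)
    have "AE u in lborel. u \<noteq> (0::real)" by (rule AE_lborel_singleton)
    then show "AE u in lborel. (\<integral>\<^sup>+\<omega>. (if 0 \<le> u \<and> u \<le> Y \<omega> then ennreal (h u) else 0) \<partial>M)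
        \<le> ennreal (k u) * indicator {0..} u"
    proof eventually_elim
      fix u :: real assume "u \<noteq> 0"
      show "(\<integral>\<^sup>+\<omega>. (if 0 \<le> u \<and> u \<le> Y \<omega> then ennreal (h u) else 0) \<partial>M) \<le> ennreal (k u) * indicator {0..} u"
      proof (cases "0 < u")
        case True
        have "(\<integral>\<^sup>+\<omega>. (if 0 \<le> u \<and> u \<le> Y \<omega> then ennreal (h u) else 0) \<partial>M)
          = (\<integral>\<^sup>+\<omega>. ennreal (h u) * indicator {\<omega>\<in>space M. u \<le> Y \<omega>} \<omega> \<partial>M)"
          using True by (intro nn_integral_cong) (auto simp: indicator_def)
        also have "\<dots> = ennreal (h u) * emeasure M {\<omega>\<in>space M. u \<le> Y \<omega>}"
          by (subst nn_integral_cmult_indicator) auto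
        also have "\<dots> = ennreal (h u * prob {\<omega>\<in>space M. u \<le> Y \<omega>})"
          using h0[of u] True by (simp add: emeasure_eq_measure ennreal_mult)
        also have "\<dots> \<le> ennreal (k u)" by (intro ennreal_leI hk True)
        finally show ?thesis using True by simp
      qed (use \<open>u \<noteq> 0\<close> in auto)
    qed
  qed
  also have "\<dots> = ennreal I"
    using k k0 by (intro nn_integral_has_integral_lebesgue') auto
  finally have *: "(\<integral>\<^sup>+\<omega>. ennreal \<bar>g \<omega>\<bar> \<partial>M) \<le> ennreal I" .
  have gi: "integrable M g"
    by (rule integrableI_bounded) (use * in \<open>auto simp: top_unique intro: le_less_trans\<close>)
  have "0 \<le> I" using k k0 by (intro has_integral_nonneg[OF k]) auto
  moreover have "ennreal (expectation (\<lambda>\<omega>. \<bar>g \<omega>\<bar>)) \<le> ennreal I"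
    using * gi by (subst nn_integral_eq_integral[symmetric]) auto
  ultimately show ?thesis using gi by (simp add: ennreal_le_iff)
qed

text \<open>
The truncated variable \<open>min |Y| x\<close> has no tail beyond \<open>x\<close>, so the integral of
\<open>p u powr (p - 1) * C u powr (- a)\<close> only extends over \<open>{0..x}\<close>; it converges at \<open>0\<close> as \<open>a < p\<close>.
\<close>

lemma truncated_power_moment:
  fixes Y :: "'a \<Rightarrow> real"
  assumes Y[measurable]: "Y \<in> borel_measurable M"
    and tail: "\<And>u. 0 < u \<Longrightarrow> prob {\<omega>\<in>space M. u \<le> \<bar>Y \<omega>\<bar>} \<le> C * u powr (- a)"
    and p: "0 < p" "a < p" and x: "0 < x" and C: "0 \<le> C"
  shows "expectation (\<lambda>\<omega>. \<bar>Y \<omega>\<bar> powr p * indicator {- x..x} (Y \<omega>)) \<le> C * p / (p - a) * x powr (p - a)"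
proof -
  define g where "g \<omega> = \<bar>Y \<omega>\<bar> powr p * indicator {- x..x} (Y \<omega>)" for \<omega>
  define k where "k u = (if u \<in> {0..x} then C * p * u powr (p - a - 1) else 0)" for u
  have "integrable M g \<and> expectation (\<lambda>\<omega>. \<bar>g \<omega>\<bar>) \<le> C * p * (x powr (p - a) / (p - a))"
  proof (rule layer_cake_bound[where Y = "\<lambda>\<omega>. min \<bar>Y \<omega>\<bar> x" and h = "\<lambda>u. p * u powr (p - 1)"
        and H = "\<lambda>y. y powr p" and k = k])
    show "((\<lambda>u. p * u powr (p - 1)) has_integral y powr p) {0..y}" if "0 \<le> y" for y
      using has_integral_mult_right[OF has_integral_powr_from_0[of "p - 1" y], of p] that p by simp
    show "\<bar>g \<omega>\<bar> \<le> (min \<bar>Y \<omega>\<bar> x) powr p" for \<omega>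
      using p x by (auto simp: g_def indicator_def abs_mult min_def)
    have "((\<lambda>u. C * p * u powr (p - a - 1)) has_integral (C * p * (x powr (p - a) / (p - a)))) {0..x}"
      using has_integral_mult_right[OF has_integral_powr_from_0[of "p - a - 1" x], of "C * p"] x p by simp
    then show "(k has_integral C * p * (x powr (p - a) / (p - a))) {0..}"
      unfolding k_def by (subst has_integral_restrict) auto
    fix u :: real assume u: "0 < u"
    show "p * u powr (p - 1) * prob {\<omega>\<in>space M. u \<le> min \<bar>Y \<omega>\<bar> x} \<le> k u"
    proof (cases "u \<le> x")
      case True
      then have "prob {\<omega>\<in>space M. u \<le> min \<bar>Y \<omega>\<bar> x} \<le> C * u powr (- a)" using tail[OF u] by simp
      then have "p * u powr (p - 1) * prob {\<omega>\<in>space M. u \<le> min \<bar>Y \<omega>\<bar> x} \<le> p * u powr (p - 1) * (C * u powr (- a))"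
        using p by (intro mult_left_mono) auto
      also have "\<dots> = C * p * u powr (p - a - 1)" using u by (simp add: powr_add[symmetric] algebra_simps)
      finally show ?thesis using True u by (simp add: k_def)
    next
      case False
      then have "{\<omega>\<in>space M. u \<le> min \<bar>Y \<omega>\<bar> x} = {}" by auto
      then show ?thesis using False by (simp add: k_def)
    qed
  qed (use p x C in \<open>auto simp: k_def g_def[abs_def]\<close>)
  moreover have "\<bar>g \<omega>\<bar> = g \<omega>" for \<omega> by (auto simp: g_def)
  ultimately show ?thesis by (simp add: g_def[abs_def])
qed

lemma truncated_second_moment:
  fixes Y :: "'a \<Rightarrow> real"
  assumes Y[measurable]: "Y \<in> borel_measurable M"
    and tail: "\<And>u. 0 < u \<Longrightarrow> prob {\<omega>\<in>space M. u \<le> \<bar>Y \<omega>\<bar>} \<le> C * u powr (- a)"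
    and a: "a < 2" and x: "0 < x" and C: "0 \<le> C"
  shows "expectation (\<lambda>\<omega>. (Y \<omega>)\<^sup>2 * indicator {- x..x} (Y \<omega>)) \<le> C * 2 / (2 - a) * x powr (2 - a)"
proof -
  have "(Y \<omega>)\<^sup>2 = \<bar>Y \<omega>\<bar> powr 2" for \<omega> by (cases "Y \<omega> = 0") simp_all
  then show ?thesis using truncated_power_moment[OF Y tail, of 2 x] a x C by simp
qed

text \<open>
For \<open>a = 1\<close> the integral of the tail diverges at \<open>0\<close> as well as at infinity. The probability is
bounded by \<open>1\<close> up to \<open>u = 1\<close>; the rest contributes the logarithm.
\<close>

lemma truncated_mean_critical:
  fixes Y :: "'a \<Rightarrow> real"
  assumes Y[measurable]: "Y \<in> borel_measurable M"
    and tail: "\<And>u. 0 < u \<Longrightarrow> prob {\<omega>\<in>space M. u \<le> \<bar>Y \<omega>\<bar>} \<le> C * u powr (- 1)"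
    and x: "1 \<le> x" and C: "0 \<le> C"
  shows "expectation (\<lambda>\<omega>. \<bar>Y \<omega>\<bar> * indicator {- x..x} (Y \<omega>)) \<le> 1 + C * ln x"
proof -
  define g where "g \<omega> = \<bar>Y \<omega>\<bar> * indicator {- x..x} (Y \<omega>)" for \<omega>
  define k where "k u = (if u \<in> {0..x} then (if u \<le> 1 then 1 else C * inverse u) else 0)" for u :: real
  have "integrable M g \<and> expectation (\<lambda>\<omega>. \<bar>g \<omega>\<bar>) \<le> 1 + C * ln x"
  proof (rule layer_cake_bound[where Y = "\<lambda>\<omega>. min \<bar>Y \<omega>\<bar> x" and h = "\<lambda>u. 1" and H = "\<lambda>y. y" and k = k])
    show "((\<lambda>u. 1) has_integral y) {0..y}" if "0 \<le> y" for y :: real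
      using has_integral_const_real[of "1::real" 0 y] that by simp
    show "\<bar>g \<omega>\<bar> \<le> min \<bar>Y \<omega>\<bar> x" for \<omega>
      using x by (auto simp: g_def indicator_def abs_mult min_def)
    have 1: "((\<lambda>u. if u \<le> 1 then 1 else C * inverse u) has_integral 1) {0..1::real}"
      by (rule has_integral_eq[OF _ has_integral_const_real[of "1::real" 0 1, simplified]]) auto
    have "((\<lambda>u. C * inverse u) has_integral (C * ln x - C * ln 1)) {1..x}" (is "(?f has_integral ?i) _")
      using x by (intro fundamental_theorem_of_calculus)
        (auto intro!: derivative_eq_intros simp: has_real_derivative_iff_has_vector_derivative[symmetric] divide_inverse)
    then have ln: "(?f has_integral (C * ln x)) {1..x}" by simp
    have 2: "((\<lambda>u. if u \<le> 1 then 1 else C * inverse u) has_integral (C * ln x)) {1..x}"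
      by (rule has_integral_spike_finite[of "{1}", OF _ _ ln]) auto
    have "((\<lambda>u. if u \<le> 1 then 1 else C * inverse u) has_integral (1 + C * ln x)) {0..x}"
      by (rule has_integral_combine[OF _ _ 1 2]) (use x in auto)
    then show "(k has_integral 1 + C * ln x) {0..}"
      unfolding k_def by (subst has_integral_restrict) auto
    fix u :: real assume u: "0 < u"
    show "1 * prob {\<omega>\<in>space M. u \<le> min \<bar>Y \<omega>\<bar> x} \<le> k u"
    proof (cases "u \<le> x")
      case True
      then show ?thesis using tail[OF u] u by (auto simp: k_def powr_minus)
    next
      case False
      then have "{\<omega>\<in>space M. u \<le> min \<bar>Y \<omega>\<bar> x} = {}" by auto
      then show ?thesis using False by (simp add: k_def)
    qed
  qed (use x C in \<open>auto simp: k_def g_def[abs_def]\<close>)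
  moreover have "\<bar>g \<omega>\<bar> = g \<omega>" for \<omega> by (auto simp: g_def)
  ultimately show ?thesis by (simp add: g_def[abs_def])
qed

text \<open>
The tail of \<open>|Y|\<close> restricted to \<open>|Y| > x\<close> is constant up to \<open>x\<close> and bounded by the power beyond;
these two pieces give the summands \<open>1\<close> and \<open>1 / (a - 1)\<close>.
\<close>

lemma upper_mean:
  fixes Y :: "'a \<Rightarrow> real"
  assumes Y[measurable]: "Y \<in> borel_measurable M"
    and tail: "\<And>u. 0 < u \<Longrightarrow> prob {\<omega>\<in>space M. u \<le> \<bar>Y \<omega>\<bar>} \<le> C * u powr (- a)"
    and a: "1 < a" and x: "0 < x" and C: "0 \<le> C"
  shows "integrable M (\<lambda>\<omega>. Y \<omega> * indicator (- {- x..x}) (Y \<omega>)) \<and>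
    expectation (\<lambda>\<omega>. \<bar>Y \<omega> * indicator (- {- x..x}) (Y \<omega>)\<bar>) \<le> C * (1 + 1 / (a - 1)) * x powr (1 - a)"
proof -
  define g where "g \<omega> = Y \<omega> * indicator (- {- x..x}) (Y \<omega>)" for \<omega>
  define k where "k u = (if u \<le> x then C * x powr (-a) else C * u powr (-a))" for u :: real
  have "integrable M g \<and> expectation (\<lambda>\<omega>. \<bar>g \<omega>\<bar>) \<le> C * (1 + 1 / (a - 1)) * x powr (1 - a)"
  proof (rule layer_cake_bound[where Y = "\<lambda>\<omega>. \<bar>g \<omega>\<bar>" and h = "\<lambda>u. 1" and H = "\<lambda>y. y" and k = k])
    show "((\<lambda>u. 1) has_integral y) {0..y}" if "0 \<le> y" for y :: real
      using has_integral_const_real[of "1::real" 0 y] that by simp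
    have "x powr (1 - a) = x * x powr (- a)" using x by (simp add: powr_diff powr_minus field_simps)
    then have "((\<lambda>u. C * x powr (-a)) has_integral (C * x powr (1-a))) {0..x}"
      using has_integral_const_real[of "C * x powr (-a)" 0 x] x by (simp add: mult.left_commute)
    then have 1: "(k has_integral (C * x powr (1-a))) {0..x}"
      by (rule has_integral_eq[rotated]) (auto simp: k_def)
    have pw: "((\<lambda>u. C * u powr (-a)) has_integral (C * (- (x powr (- a + 1)) / (- a + 1)))) {x..}"
      using a x by (intro has_integral_mult_right has_integral_powr_to_inf) auto
    have 2: "(k has_integral (C * (- (x powr (- a + 1)) / (- a + 1)))) {x..}"
      by (rule has_integral_spike_finite[of "{x}", OF _ _ pw]) (auto simp: k_def)
    have "(k has_integral (C * x powr (1-a)) + (C * (- (x powr (- a + 1)) / (- a + 1)))) ({0..x} \<union> {x..})"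
      by (rule has_integral_Un[OF 1 2], rule negligible_subset[of "{x}"]) auto
    also have "{0..x} \<union> {x..} = {0..}" using x by auto
    also have "(C * x powr (1-a)) + (C * (- (x powr (- a + 1)) / (- a + 1))) = C * (1 + 1 / (a - 1)) * x powr (1 - a)"
      using a by (simp add: field_simps)
    finally show "(k has_integral C * (1 + 1 / (a - 1)) * x powr (1 - a)) {0..}" .
    fix u :: real assume u: "0 < u"
    have "prob {\<omega>\<in>space M. u \<le> \<bar>g \<omega>\<bar>} \<le> prob {\<omega>\<in>space M. max u x \<le> \<bar>Y \<omega>\<bar>}"
      using u by (intro finite_measure_mono) (auto simp: g_def indicator_def split: if_splits)
    also have "\<dots> \<le> C * (max u x) powr (-a)" using u by (intro tail) auto
    also have "\<dots> = k u" by (auto simp: k_def max_def)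
    finally show "1 * prob {\<omega>\<in>space M. u \<le> \<bar>g \<omega>\<bar>} \<le> k u" by simp
  qed (use x C in \<open>auto simp: k_def g_def[abs_def]\<close>)
  then show ?thesis by (simp add: g_def[abs_def])
qed

lemma integrable_truncated:
  fixes Y :: "'a \<Rightarrow> real"
  assumes [measurable]: "Y \<in> borel_measurable M"
  shows "integrable M (\<lambda>\<omega>. Y \<omega> * indicator {- x..x} (Y \<omega>))"
    and "integrable M (\<lambda>\<omega>. (Y \<omega> * indicator {- x..x} (Y \<omega>))\<^sup>2)"
proof -
  have *: "\<bar>Y \<omega> * indicator {- x..x} (Y \<omega>)\<bar> \<le> \<bar>x\<bar>" for \<omega>
    by (auto simp: indicator_def)
  show "integrable M (\<lambda>\<omega>. Y \<omega> * indicator {- x..x} (Y \<omega>))"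
    by (rule integrable_const_bound[of _ "\<bar>x\<bar>"]) (use * in auto)
  show "integrable M (\<lambda>\<omega>. (Y \<omega> * indicator {- x..x} (Y \<omega>))\<^sup>2)"
  proof (rule integrable_const_bound[of _ "x\<^sup>2"])
    show "AE \<omega> in M. norm ((Y \<omega> * indicator {- x..x} (Y \<omega>))\<^sup>2) \<le> x\<^sup>2"
      using * by (auto simp: abs_le_square_iff[symmetric])
  qed measurable
qed

text \<open>
The three cases have different reasons. For \<open>a < 1\<close> the first moment is carried by the largest
admissible values; for \<open>a = 1\<close> all scales contribute equally; for \<open>a > 1\<close> the mean is zero, and
the truncated mean is the negative of the mean of the part that was cut off.
\<close>

lemma truncated_mean:
  fixes Y :: "'a \<Rightarrow> real"
  assumes Y[measurable]: "Y \<in> borel_measurable M" and C: "0 \<le> C"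
    and tail: "\<And>u. 0 < u \<Longrightarrow> prob {\<omega>\<in>space M. u \<le> \<bar>Y \<omega>\<bar>} \<le> C * u powr (- a)"
    and mean: "1 < a \<Longrightarrow> integrable M Y \<Longrightarrow> expectation Y = 0"
    and x: "1 \<le> x"
  shows "\<bar>expectation (\<lambda>\<omega>. Y \<omega> * indicator {- x..x} (Y \<omega>))\<bar>
    \<le> (1 + C + C / \<bar>a - 1\<bar>) * x powr (1 - a) * (if a = 1 then 1 + ln x else 1)"
proof -
  have abs_le: "\<bar>expectation (\<lambda>\<omega>. Y \<omega> * indicator {- x..x} (Y \<omega>))\<bar>
    \<le> expectation (\<lambda>\<omega>. \<bar>Y \<omega>\<bar> * indicator {- x..x} (Y \<omega>))"
    using integral_abs_bound[of M "\<lambda>\<omega>. Y \<omega> * indicator {- x..x} (Y \<omega>)"] by (simp add: abs_mult)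
  consider "a < 1" | "a = 1" | "1 < a" by linarith
  then show ?thesis
  proof cases
    case 1
    have "expectation (\<lambda>\<omega>. \<bar>Y \<omega>\<bar> * indicator {- x..x} (Y \<omega>)) \<le> C / \<bar>a - 1\<bar> * x powr (1 - a)"
      using truncated_power_moment[OF Y tail, of 1 x] 1 x C by simp
    also have "\<dots> \<le> (1 + C + C / \<bar>a - 1\<bar>) * x powr (1 - a)" using C by (intro mult_right_mono) auto
    finally show ?thesis using abs_le 1 by simp
  next
    case 2
    have "expectation (\<lambda>\<omega>. \<bar>Y \<omega>\<bar> * indicator {- x..x} (Y \<omega>)) \<le> 1 + C * ln x"
      using tail 2 by (intro truncated_mean_critical[OF Y _ x C]) simp
    also have "\<dots> \<le> (1 + C) * (1 + ln x)" using C x by (simp add: algebra_simps)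
    finally show ?thesis using abs_le 2 x by simp
  next
    case 3
    note um = upper_mean[OF Y tail 3 _ C, of x]
    have split: "(\<lambda>\<omega>. Y \<omega>) = (\<lambda>\<omega>. Y \<omega> * indicator {- x..x} (Y \<omega>) + Y \<omega> * indicator (- {- x..x}) (Y \<omega>))"
      by (auto simp: indicator_def fun_eq_iff)
    have Yi: "integrable M Y"
      by (subst split) (intro Bochner_Integration.integrable_add integrable_truncated(1)[OF Y], use um x in auto)
    have "expectation Y = expectation (\<lambda>\<omega>. Y \<omega> * indicator {- x..x} (Y \<omega>) + Y \<omega> * indicator (- {- x..x}) (Y \<omega>))"
      by (rule arg_cong[OF split])
    also have "\<dots> = expectation (\<lambda>\<omega>. Y \<omega> * indicator {- x..x} (Y \<omega>)) + expectation (\<lambda>\<omega>. Y \<omega> * indicator (- {- x..x}) (Y \<omega>))"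
      using um x by (intro Bochner_Integration.integral_add integrable_truncated(1)[OF Y]) auto
    finally have "0 = expectation (\<lambda>\<omega>. Y \<omega> * indicator {- x..x} (Y \<omega>)) + expectation (\<lambda>\<omega>. Y \<omega> * indicator (- {- x..x}) (Y \<omega>))"
      using mean[OF 3 Yi] by simp
    then have "\<bar>expectation (\<lambda>\<omega>. Y \<omega> * indicator {- x..x} (Y \<omega>))\<bar> \<le> expectation (\<lambda>\<omega>. \<bar>Y \<omega> * indicator (- {- x..x}) (Y \<omega>)\<bar>)"
      using integral_abs_bound[of M "\<lambda>\<omega>. Y \<omega> * indicator (- {- x..x}) (Y \<omega>)"] by linarith
    also have "\<dots> \<le> C * (1 + 1 / (a - 1)) * x powr (1 - a)" using um x by auto
    also have "\<dots> \<le> (1 + C + C / \<bar>a - 1\<bar>) * x powr (1 - a)"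
      using C 3 by (intro mult_right_mono) (auto simp: algebra_simps)
    finally show ?thesis using 3 by simp
  qed
qed

end

section \<open>Laws attracted to a symmetric stable law\<close>

lemma char_normalized_sum:
  assumes "real_distribution G"
  shows "char (distr (Pi\<^sub>M {..<n} (\<lambda>_. G)) borel (\<lambda>x. ((\<Sum>i<n. x i) - e) / b)) t
    = iexp (- (t * e / b)) * char G (t / b) ^ n"
proof -
  interpret real_distribution G by fact
  interpret P: product_prob_space "\<lambda>_. G" "{..<n}" ..
  have [measurable]: "(\<lambda>x. ((\<Sum>i<n. x i) - e) / b) \<in> borel_measurable (Pi\<^sub>M {..<n} (\<lambda>_. G))"
    by (intro borel_measurable_divide borel_measurable_diff borel_measurable_sum borel_measurable_const)
       (rule measurable_compose[OF measurable_component_singleton measurable_ident_sets], auto)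
  have "char (distr (Pi\<^sub>M {..<n} (\<lambda>_. G)) borel (\<lambda>x. ((\<Sum>i<n. x i) - e) / b)) t
      = (CLINT x|Pi\<^sub>M {..<n} (\<lambda>_. G). iexp (t * (((\<Sum>i<n. x i) - e) / b)))"
    unfolding char_def by (subst integral_distr) auto
  also have "\<dots> = (CLINT x|Pi\<^sub>M {..<n} (\<lambda>_. G). iexp (- (t * e / b)) * (\<Prod>i<n. iexp (t / b * x i)))"
  proof (intro Bochner_Integration.integral_cong refl)
    fix x :: "nat \<Rightarrow> real"
    have "t * (((\<Sum>i<n. x i) - e) / b) = - (t * e / b) + (\<Sum>i<n. t / b * x i)"
      by (simp add: sum_distrib_left sum_divide_distrib diff_divide_distrib right_diff_distrib)
    then show "iexp (t * (((\<Sum>i<n. x i) - e) / b)) = iexp (- (t * e / b)) * (\<Prod>i<n. iexp (t / b * x i))"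
      by (simp only: of_real_add distrib_left exp_add of_real_sum sum_distrib_left exp_sum[OF finite_lessThan])
  qed
  also have "\<dots> = iexp (- (t * e / b)) * (CLINT x|Pi\<^sub>M {..<n} (\<lambda>_. G). (\<Prod>i<n. iexp (t / b * x i)))"
    by (rule integral_mult_right_zero)
  also have "(CLINT x|Pi\<^sub>M {..<n} (\<lambda>_. G). (\<Prod>i<n. iexp (t / b * x i))) = char G (t / b) ^ n"
  proof (subst P.product_integral_prod)
    show "integrable G (\<lambda>x. iexp (t / b * x))" by (intro integrable_iexp) auto
  qed (simp_all add: char_def del: of_real_mult of_real_divide)
  finally show ?thesis .
qed

lemma cmod_iexp_minus_1_le: "cmod (1 - iexp x) \<le> 2 * min 1 \<bar>x\<bar>"
proof -
  have "cmod (1 - iexp x) \<le> \<bar>x\<bar>"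
    using iexp_approx1[of x 0] by (simp add: norm_minus_commute)
  moreover have "cmod (1 - iexp x) \<le> 2"
    using norm_triangle_ineq4[of 1 "iexp x"] by simp
  ultimately show ?thesis by auto
qed

text \<open>
Uniformity in \<open>n\<close> comes from testing the weak convergence against the single bounded continuous
function \<open>min 1 |t0 x|\<close>, which dominates \<open>|1 - iexp (t x)|\<close> up to a factor for all \<open>|t| \<le> t0\<close> at once.
\<close>

lemma weak_conv_char_near_one:
  assumes \<mu>: "\<And>n. real_distribution (\<mu> n)" and L: "real_distribution L" and "weak_conv_m \<mu> L"
  obtains t0 n0 where "0 < t0" "\<And>n t. n0 \<le> n \<Longrightarrow> \<bar>t\<bar> \<le> t0 \<Longrightarrow> cmod (1 - char (\<mu> n) t) \<le> 1/4"
proof -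
  interpret L: real_distribution L by fact
  define f where "f s x = min 1 (\<bar>s * x\<bar>)" for s x :: real
  have f_cont: "isCont (f s) x" for s x unfolding f_def[abs_def] by (intro continuous_intros)
  have fm[measurable]: "f s \<in> borel_measurable borel" for s
    using f_cont by (auto intro!: borel_measurable_continuous_onI continuous_at_imp_continuous_on)
  have fb: "0 \<le> f s x" "norm (f s x) \<le> 1" for s x by (auto simp: f_def)
  have "(\<lambda>k. integral\<^sup>L L (f (inverse (real (Suc k))))) \<longlonglongrightarrow> integral\<^sup>L L (\<lambda>_. 0)"
  proof (rule integral_dominated_convergence[where w = "\<lambda>_. 1"])
    show "AE x in L. (\<lambda>k. f (inverse (real (Suc k))) x) \<longlonglongrightarrow> 0"
    proof (intro AE_I2)
      fix x
      have "(\<lambda>k. min 1 \<bar>inverse (real (Suc k)) * x\<bar>) \<longlonglongrightarrow> min 1 \<bar>0 * x\<bar>"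
        by (intro tendsto_intros LIMSEQ_inverse_real_of_nat)
      then show "(\<lambda>k. f (inverse (real (Suc k))) x) \<longlonglongrightarrow> 0" by (simp add: f_def)
    qed
  qed (use fb in auto)
  then have "eventually (\<lambda>k. integral\<^sup>L L (f (inverse (real (Suc k)))) < 1/16) sequentially"
    by (intro order_tendstoD) auto
  then obtain k where k: "integral\<^sup>L L (f (inverse (real (Suc k)))) < 1/16"
    by (auto simp: eventually_sequentially)
  define t0 where "t0 = inverse (real (Suc k))"
  have "(\<lambda>n. integral\<^sup>L (\<mu> n) (f t0)) \<longlonglongrightarrow> integral\<^sup>L L (f t0)"
    using \<mu> L assms(3) f_cont fb(2) by (rule weak_conv_imp_integral_bdd_continuous_conv)
  then have "eventually (\<lambda>n. integral\<^sup>L (\<mu> n) (f t0) < 1/8) sequentially"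
    using k by (intro order_tendstoD) (auto simp: t0_def)
  then obtain n0 where n0: "\<And>n. n0 \<le> n \<Longrightarrow> integral\<^sup>L (\<mu> n) (f t0) < 1/8"
    by (auto simp: eventually_sequentially)
  have "cmod (1 - char (\<mu> n) t) \<le> 1/4" if n: "n0 \<le> n" and t: "\<bar>t\<bar> \<le> t0" for n t
  proof -
    interpret \<mu>: real_distribution "\<mu> n" by (rule \<mu>)
    have "1 - char (\<mu> n) t = (CLINT x|\<mu> n. 1 - iexp (t * x))"
      unfolding char_def by (subst Bochner_Integration.integral_diff) (auto intro!: \<mu>.integrable_iexp simp: \<mu>.prob_space[simplified])
    also have "cmod \<dots> \<le> (\<integral>x. cmod (1 - iexp (t * x)) \<partial>\<mu> n)" by (rule integral_norm_bound)
    also have "\<dots> \<le> (\<integral>x. 2 * f t0 x \<partial>\<mu> n)"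
    proof (rule integral_mono)
      show "integrable (\<mu> n) (\<lambda>x. cmod (1 - iexp (t * x)))"
        by (intro integrable_norm Bochner_Integration.integrable_diff \<mu>.integrable_iexp) auto
      show "integrable (\<mu> n) (\<lambda>x. 2 * f t0 x)"
        by (intro \<mu>.integrable_const_bound[of _ 2]) (use fb in \<open>auto simp: f_def\<close>)
      fix x
      have "\<bar>t * x\<bar> \<le> \<bar>t0 * x\<bar>" using t by (auto simp: abs_mult intro!: mult_right_mono)
      then show "cmod (1 - iexp (t * x)) \<le> 2 * f t0 x"
        using cmod_iexp_minus_1_le[of "t * x"] by (simp add: f_def)
    qed
    also have "\<dots> \<le> 1/4" using n0[OF n] by simp
    finally show ?thesis .
  qed
  then show thesis using that[of t0 n0] by (simp add: t0_def)
qed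

text \<open>
The best choice is \<open>n = \<lfloor>(t0 / s) powr \<alpha>\<rfloor>\<close>, for which \<open>1 / n\<close> is comparable to \<open>s powr \<alpha>\<close>.
If this \<open>n\<close> is too small, \<open>s\<close> is bounded below and the trivial bound \<open>D'\<close> suffices.
\<close>

lemma power_bound_from_grid:
  fixes f :: "real \<Rightarrow> real"
  assumes \<alpha>: "0 < \<alpha>" and t0: "0 < t0" and D: "0 \<le> D" "0 \<le> D'"
    and grid: "\<And>n s. n0 \<le> n \<Longrightarrow> 0 < n \<Longrightarrow> 0 < s \<Longrightarrow> s * real n powr (1/\<alpha>) \<le> t0 \<Longrightarrow> f s \<le> D / real n"
    and bnd: "\<And>s. 0 < s \<Longrightarrow> f s \<le> D'"
  obtains C where "0 \<le> C" "\<And>s. 0 < s \<Longrightarrow> f s \<le> C * s powr \<alpha>"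
proof -
  \<comment> \<open>The first summand covers small \<open>s\<close>, the second one those \<open>s\<close> for which the best \<open>n\<close> is below \<open>n0\<close>.\<close>
  define C where "C = 2 * D / t0 powr \<alpha> + D' * (real n0 + 1) / t0 powr \<alpha>"
  have "f s \<le> C * s powr \<alpha>" if s: "0 < s" for s
  proof -
    define z where "z = (t0 / s) powr \<alpha>"
    have zpos: "0 < z" using s t0 by (simp add: z_def)
    have s\<alpha>: "s powr \<alpha> = t0 powr \<alpha> / z" using s t0 by (simp add: z_def powr_divide)
    show ?thesis
    proof (cases "real n0 + 1 \<le> z")
      case True
      define n where "n = nat \<lfloor>z\<rfloor>"
      have n: "real n \<le> z" "z < real n + 1" using zpos by (auto simp: n_def)
      have n1: "n0 \<le> n" "0 < n" using True n by linarith+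
      have "real n powr (1/\<alpha>) \<le> z powr (1/\<alpha>)" using n \<alpha> by (intro powr_mono2) auto
      also have "\<dots> = t0 / s" using s t0 \<alpha> by (simp add: z_def powr_powr)
      finally have "s * real n powr (1/\<alpha>) \<le> t0" using s by (simp add: field_simps)
      then have "f s \<le> D / real n" by (intro grid n1 s)
      also have "\<dots> \<le> D / (z / 2)" using D n n1 zpos by (intro divide_left_mono mult_pos_pos) auto
      also have "\<dots> = 2 * D / t0 powr \<alpha> * s powr \<alpha>" using t0 zpos by (simp add: s\<alpha>)
      also have "\<dots> \<le> C * s powr \<alpha>" unfolding C_def using D t0 by (intro mult_right_mono) auto
      finally show ?thesis .
    next
      case False
      have "f s \<le> D'" by (rule bnd[OF s])
      also have "\<dots> \<le> D' * ((real n0 + 1) / z)"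
        using False zpos D by (intro mult_right_le_one_le[THEN ord_le_eq_trans, OF _ _ _ refl] mult_le_cancel_left1[THEN iffD2]) (auto simp: field_simps)
      also have "\<dots> = D' * (real n0 + 1) / t0 powr \<alpha> * s powr \<alpha>" using t0 zpos by (simp add: s\<alpha>)
      also have "\<dots> \<le> C * s powr \<alpha>" unfolding C_def using D t0 by (intro mult_right_mono) auto
      finally show ?thesis .
    qed
  qed
  moreover have "0 \<le> C" using D t0 by (simp add: C_def)
  ultimately show thesis using that by blast
qed

text \<open>
On the shell \<open>r \<le> |Z| \<le> 2 r\<close> the function \<open>1 - cos (Z / r)\<close> is bounded below by \<open>1 - cos 1\<close>.
This controls the probability of each dyadic shell, and the shells sum up geometrically.
\<close>

lemma (in prob_space) tail_from_cosine:
  fixes Z :: "'a \<Rightarrow> real"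
  assumes Z[measurable]: "Z \<in> borel_measurable M" and \<alpha>: "0 < \<alpha>" and C: "0 \<le> C"
    and cos: "\<And>s. 0 < s \<Longrightarrow> expectation (\<lambda>\<omega>. 1 - cos (s * Z \<omega>)) \<le> C * s powr \<alpha>"
  obtains C' where "0 \<le> C'" "\<And>r. 0 < r \<Longrightarrow> prob {\<omega>\<in>space M. r \<le> \<bar>Z \<omega>\<bar>} \<le> C' * r powr (- \<alpha>)"
proof -
  define \<kappa> where "\<kappa> = 1 - cos (1::real)"
  have \<kappa>: "0 < \<kappa>" using cos_monotone_0_pi[of 0 1] pi_ge_two by (simp add: \<kappa>_def)
  have shell: "prob {\<omega>\<in>space M. r \<le> \<bar>Z \<omega>\<bar> \<and> \<bar>Z \<omega>\<bar> \<le> 2 * r} \<le> C / \<kappa> * r powr (- \<alpha>)" if r: "0 < r" for r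
  proof -
    let ?A = "{\<omega>\<in>space M. r \<le> \<bar>Z \<omega>\<bar> \<and> \<bar>Z \<omega>\<bar> \<le> 2 * r}"
    have "\<kappa> * prob ?A = expectation (\<lambda>\<omega>. \<kappa> * indicator ?A \<omega>)" by simp
    also have "\<dots> \<le> expectation (\<lambda>\<omega>. 1 - cos (inverse r * Z \<omega>))"
    proof (rule integral_mono)
      show "integrable M (\<lambda>\<omega>. \<kappa> * indicator ?A \<omega>)" by (simp add: emeasure_eq_measure)
      show "integrable M (\<lambda>\<omega>. 1 - cos (inverse r * Z \<omega>))"
        by (intro integrable_const_bound[of _ 2]) (auto intro!: AE_I2 simp: abs_le_iff intro: order_trans[OF cos_le_one] order_trans[OF _ cos_ge_minus_one])
      fix \<omega>
      show "\<kappa> * indicator ?A \<omega> \<le> 1 - cos (inverse r * Z \<omega>)"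
      proof (cases "\<omega> \<in> ?A")
        case True
        then have u: "1 \<le> \<bar>inverse r * Z \<omega>\<bar>" "\<bar>inverse r * Z \<omega>\<bar> \<le> pi"
          using r pi_ge_two by (auto simp: abs_mult field_simps intro: order_trans[of _ "2 * r"])
        have "cos \<bar>inverse r * Z \<omega>\<bar> \<le> cos 1" using u by (intro cos_monotone_0_pi_le) auto
        then show ?thesis using True by (simp add: \<kappa>_def)
      qed auto
    qed
    also have "\<dots> \<le> C * (inverse r) powr \<alpha>" using r by (intro cos) auto
    also have "\<dots> = C * r powr (- \<alpha>)" using r by (simp add: powr_minus inverse_powr)
    finally show ?thesis using \<kappa> by (simp add: field_simps)
  qed
  define \<rho> where "\<rho> = (2::real) powr (- \<alpha>)"
  have \<rho>: "0 < \<rho>" "\<rho> < 1" using \<alpha> by (auto simp: \<rho>_def powr_less_one)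
  show thesis
  proof
    show "0 \<le> C / \<kappa> / (1 - \<rho>)" using C \<kappa> \<rho> by simp
    fix r :: real assume r: "0 < r"
    define A where "A k = {\<omega>\<in>space M. 2 ^ k * r \<le> \<bar>Z \<omega>\<bar> \<and> \<bar>Z \<omega>\<bar> \<le> 2 * (2 ^ k * r)}" for k :: nat
    have A_le: "prob (A k) \<le> C / \<kappa> * r powr (- \<alpha>) * \<rho> ^ k" for k
    proof -
      have "prob (A k) \<le> C / \<kappa> * (2 ^ k * r) powr (- \<alpha>)" unfolding A_def using r by (intro shell) auto
      also have "(2 ^ k * r) powr (- \<alpha>) = r powr (- \<alpha>) * \<rho> ^ k"
        using r by (simp add: powr_mult \<rho>_def powr_powr powr_realpow[symmetric] mult.commute)
      finally show ?thesis by simp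
    qed
    have gs: "summable (\<lambda>k. C / \<kappa> * r powr (- \<alpha>) * \<rho> ^ k)" using \<rho> by (intro summable_mult summable_geometric) auto
    have As: "summable (\<lambda>k. prob (A k))"
      by (rule summable_comparison_test'[OF gs, of 0]) (use A_le in auto)
    have Am: "range A \<subseteq> sets M" unfolding A_def by auto
    have "{\<omega>\<in>space M. r \<le> \<bar>Z \<omega>\<bar>} \<subseteq> (\<Union>k. A k)"
    proof safe
      fix \<omega> assume w: "\<omega> \<in> space M" "r \<le> \<bar>Z \<omega>\<bar>"
      obtain m where m: "\<bar>Z \<omega>\<bar> / r < 2 ^ m" using real_arch_pow[of 2 "\<bar>Z \<omega>\<bar> / r"] by auto
      define m0 where "m0 = (LEAST m. \<bar>Z \<omega>\<bar> / r < 2 ^ m)"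
      have m0: "\<bar>Z \<omega>\<bar> / r < 2 ^ m0" unfolding m0_def by (rule LeastI[of _ m]) fact
      have "m0 \<noteq> 0"
      proof
        assume "m0 = 0"
        then show False using m0 w r by (simp add: field_simps)
      qed
      then obtain k where k: "m0 = Suc k" by (cases m0) auto
      have "\<not> \<bar>Z \<omega>\<bar> / r < 2 ^ k" using not_less_Least[of k "\<lambda>m. \<bar>Z \<omega>\<bar> / r < 2 ^ m"] k by (simp add: m0_def)
      then have "\<omega> \<in> A k" using m0 k w r by (auto simp: A_def field_simps)
      then show "\<omega> \<in> (\<Union>k. A k)" by auto
    qed
    then have "prob {\<omega>\<in>space M. r \<le> \<bar>Z \<omega>\<bar>} \<le> prob (\<Union>k. A k)" using Am by (intro finite_measure_mono) auto
    also have "\<dots> \<le> (\<Sum>k. prob (A k))" by (rule finite_measure_subadditive_countably[OF Am As])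
    also have "\<dots> \<le> (\<Sum>k. C / \<kappa> * r powr (- \<alpha>) * \<rho> ^ k)" by (rule suminf_le[OF A_le As gs])
    also have "\<dots> = C / \<kappa> * r powr (- \<alpha>) * (1 / (1 - \<rho>))" using \<rho> by (subst suminf_mult) (auto simp: suminf_geometric)
    finally show "prob {\<omega>\<in>space M. r \<le> \<bar>Z \<omega>\<bar>} \<le> C / \<kappa> / (1 - \<rho>) * r powr (- \<alpha>)" by simp
  qed
qed

lemma one_minus_cos_le_square: "1 - cos (u::real) \<le> u\<^sup>2 / 2"
proof -
  have "1 - cos u = 2 * (sin (u/2))\<^sup>2" using cos_double_sin[of "u/2"] by simp
  also have "\<dots> \<le> 2 * (u/2)\<^sup>2"
    using abs_sin_x_le_abs_x[of "u/2"] by (simp add: abs_le_square_iff[symmetric] del: power_divide)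
  finally show ?thesis by (simp add: power_divide)
qed

text \<open>
Values of \<open>|Z|\<close> below \<open>\<epsilon> R\<close> contribute to \<open>E (1 - cos (Z / R))\<close> at most their truncated second
moment divided by \<open>2 R\<^sup>2\<close>, that is a multiple of \<open>\<epsilon> powr (2 - \<alpha>) R powr (- \<alpha>)\<close>. As \<open>\<alpha> < 2\<close>, this is
at most half of the whole for small \<open>\<epsilon>\<close>; the other half must come from larger values.
\<close>

lemma (in prob_space) tail_lower_from_cosine:
  fixes Z :: "'a \<Rightarrow> real"
  assumes Z[measurable]: "Z \<in> borel_measurable M" and \<alpha>: "\<alpha> < 2" and C: "0 \<le> C"
    and tail: "\<And>r. 0 < r \<Longrightarrow> prob {\<omega>\<in>space M. r \<le> \<bar>Z \<omega>\<bar>} \<le> C * r powr (- \<alpha>)"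
    and q: "0 < q"
  obtains \<epsilon> where "0 < \<epsilon>" "\<And>R. 0 < R \<Longrightarrow> q * R powr (-\<alpha>) \<le> expectation (\<lambda>\<omega>. 1 - cos (Z \<omega> / R)) \<Longrightarrow>
     q / 4 * R powr (- \<alpha>) \<le> prob {\<omega>\<in>space M. \<epsilon> * R < \<bar>Z \<omega>\<bar>}"
proof -
  define C2 where "C2 = C * 2 / (2 - \<alpha>)"
  have C2: "0 \<le> C2" using C \<alpha> by (simp add: C2_def)
  \<comment> \<open>Chosen such that \<open>C2 * \<epsilon> powr (2 - \<alpha>) \<le> q\<close>.\<close>
  define \<epsilon> where "\<epsilon> = (q / (C2 + 1)) powr (1 / (2 - \<alpha>))"
  have \<epsilon>: "0 < \<epsilon>" using q C2 by (simp add: \<epsilon>_def)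
  have \<epsilon>p: "\<epsilon> powr (2 - \<alpha>) = q / (C2 + 1)" using \<alpha> q C2 by (simp add: \<epsilon>_def powr_powr)
  show thesis
  proof (rule that[OF \<epsilon>])
    fix R :: real assume R: "0 < R" and lower: "q * R powr (-\<alpha>) \<le> expectation (\<lambda>\<omega>. 1 - cos (Z \<omega> / R))"
    let ?x = "\<epsilon> * R"
    have x: "0 < ?x" using \<epsilon> R by simp
    let ?A = "{\<omega>\<in>space M. ?x < \<bar>Z \<omega>\<bar>}"
    let ?T = "\<lambda>\<omega>. (Z \<omega>)\<^sup>2 * indicator {- ?x..?x} (Z \<omega>)"
    have Ti: "integrable M ?T"
    proof -
      have "(\<lambda>\<omega>. (Z \<omega> * indicator {- ?x..?x} (Z \<omega>))\<^sup>2) = ?T" by (auto simp: fun_eq_iff indicator_def)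
      then show ?thesis using integrable_truncated(2)[OF Z, of ?x] by simp
    qed
    have "q * R powr (-\<alpha>) \<le> expectation (\<lambda>\<omega>. 1 - cos (Z \<omega> / R))" by fact
    also have "\<dots> \<le> expectation (\<lambda>\<omega>. ?T \<omega> / (2 * R\<^sup>2) + 2 * indicator ?A \<omega>)"
    proof (rule integral_mono)
      show "integrable M (\<lambda>\<omega>. 1 - cos (Z \<omega> / R))"
        by (intro integrable_const_bound[of _ 2]) (auto intro!: AE_I2 simp: abs_le_iff intro: order_trans[OF cos_le_one] order_trans[OF _ cos_ge_minus_one])
      show "integrable M (\<lambda>\<omega>. ?T \<omega> / (2 * R\<^sup>2) + 2 * indicator ?A \<omega>)"
        using Ti by (intro Bochner_Integration.integrable_add integrable_divide) (auto simp: emeasure_eq_measure)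
      fix \<omega> assume "\<omega> \<in> space M"
      then show "1 - cos (Z \<omega> / R) \<le> ?T \<omega> / (2 * R\<^sup>2) + 2 * indicator ?A \<omega>"
      proof (cases "\<omega> \<in> ?A")
        case True
        have "0 \<le> ?T \<omega> / (2 * R\<^sup>2)" by simp
        moreover have "indicator ?A \<omega> = (1::real)" using True by simp
        ultimately show ?thesis using cos_ge_minus_one[of "Z \<omega> / R"] by linarith
      next
        case False
        then have "Z \<omega> \<in> {- ?x..?x}" using \<open>\<omega> \<in> space M\<close> by auto
        then show ?thesis using False one_minus_cos_le_square[of "Z \<omega> / R"] by (simp add: power_divide)
      qed
    qed
    also have "\<dots> = expectation ?T / (2 * R\<^sup>2) + 2 * prob ?A"
      using Ti by (subst Bochner_Integration.integral_add) (auto simp: emeasure_eq_measure)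
    also have "expectation ?T \<le> C2 * ?x powr (2 - \<alpha>)"
      unfolding C2_def by (rule truncated_second_moment[OF Z tail \<alpha> x C])
    also have "C2 * ?x powr (2 - \<alpha>) / (2 * R\<^sup>2) \<le> q / 2 * R powr (- \<alpha>)"
    proof -
      have "?x powr (2 - \<alpha>) = q / (C2 + 1) * R powr (- \<alpha>) * R\<^sup>2"
      proof -
        have "R powr (2 - \<alpha>) = R powr (- \<alpha>) * R\<^sup>2"
          using R by (simp add: powr_diff powr_minus powr_numeral field_simps)
        then show ?thesis using \<epsilon> R by (simp only: powr_mult \<epsilon>p mult.assoc)
      qed
      then have "C2 * ?x powr (2 - \<alpha>) / (2 * R\<^sup>2) = C2 / (C2 + 1) * (q / 2 * R powr (- \<alpha>))"
      proof -
        have "C2 * (q / a * w * r) / (2 * r) = C2 / a * (q / 2 * w)" if "r \<noteq> 0" for a w r :: real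
          using that by simp
        then show ?thesis unfolding \<open>?x powr (2 - \<alpha>) = _\<close> using R by simp
      qed
      also have "\<dots> \<le> 1 * (q / 2 * R powr (- \<alpha>))" using C2 q by (intro mult_right_mono) auto
      finally show ?thesis by simp
    qed
    finally show "q / 4 * R powr (- \<alpha>) \<le> prob ?A"
      by (simp add: divide_right_mono) 
  qed
qed

text \<open>
The characteristic function of the normalised sum has modulus \<open>|\<phi>(s)| ^ n\<close>, the centering
being a rotation. If this is near \<open>1\<close>, then \<open>n (1 - |\<phi>(s)|\<^sup>2)\<close> is bounded, by \<open>y \<le> exp (y - 1)\<close>; if
it stays away from \<open>1\<close>, then \<open>n (1 - |\<phi>(s)|\<^sup>2)\<close> stays away from \<open>0\<close>, by Bernoulli's
inequality.
\<close>

lemma attracted_char_estimates: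
  assumes na: "normally_attracted G \<alpha> c d" and \<alpha>: "0 < \<alpha>" and c: "0 < c"
  obtains t0 n0 q n1 where "0 < t0" "0 < q"
    "\<And>n s. n0 \<le> n \<Longrightarrow> 0 < n \<Longrightarrow> 0 < s \<Longrightarrow> s * real n powr (1/\<alpha>) \<le> t0 \<Longrightarrow> 1 - (cmod (char G s))\<^sup>2 \<le> 1 / real n"
    "\<And>n. n1 \<le> n \<Longrightarrow> 0 < n \<Longrightarrow> q / real n \<le> 1 - (cmod (char G (1 / real n powr (1/\<alpha>))))\<^sup>2"
    "\<And>n s. (\<And>n. d n = 0) \<Longrightarrow> n0 \<le> n \<Longrightarrow> 0 < n \<Longrightarrow> 0 < s \<Longrightarrow> s * real n powr (1/\<alpha>) \<le> t0 \<Longrightarrow>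
       cmod (1 - char G s ^ n) \<le> 1/4"
proof -
  define \<mu> where "\<mu> n = distr (Pi\<^sub>M {..<n} (\<lambda>_. G)) borel (\<lambda>x. ((\<Sum>i<n. x i) - d n) / real n powr (1 / \<alpha>))" for n
  from na obtain L where G: "real_distribution G" and L: "symmetric_stable \<alpha> c L" and wc: "weak_conv_m \<mu> L"
    unfolding normally_attracted_def \<mu>_def[abs_def] by blast
  interpret real_distribution G by fact
  interpret P: product_prob_space "\<lambda>_. G" UNIV ..
  have \<mu>_rd: "real_distribution (\<mu> n)" for n
  proof -
    interpret Pn: prob_space "Pi\<^sub>M {..<n} (\<lambda>_. G)" by (intro prob_space_PiM prob_space_axioms)
    show ?thesis unfolding \<mu>_def
      by (intro Pn.real_distribution_distr borel_measurable_divide borel_measurable_diff borel_measurable_sum borel_measurable_const)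
        (rule measurable_compose[OF measurable_component_singleton measurable_ident_sets], auto)
  qed
  have L_rd: "real_distribution L" using L by (simp add: symmetric_stable_def)
  have char_\<mu>: "char (\<mu> n) t = iexp (- (t * d n / real n powr (1/\<alpha>))) * char G (t / real n powr (1/\<alpha>)) ^ n" for n t
    unfolding \<mu>_def by (rule char_normalized_sum[OF G])
  have cmod_\<mu>: "cmod (char (\<mu> n) t) = cmod (char G (t / real n powr (1/\<alpha>))) ^ n" for n t
    unfolding char_\<mu> by (simp only: norm_mult norm_power norm_exp_i_times mult_1)
  obtain t0 n0 where t0: "0 < t0" and near: "\<And>n t. n0 \<le> n \<Longrightarrow> \<bar>t\<bar> \<le> t0 \<Longrightarrow> cmod (1 - char (\<mu> n) t) \<le> 1/4"
    using weak_conv_char_near_one[OF \<mu>_rd L_rd wc] by blast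
  have upper: "1 - (cmod (char G s))\<^sup>2 \<le> 1 / real n"
    if n: "n0 \<le> n" "0 < n" and s: "0 < s" "s * real n powr (1/\<alpha>) \<le> t0" for n s
  proof (rule ccontr)
    assume a: "\<not> 1 - (cmod (char G s))\<^sup>2 \<le> 1 / real n"
    define y where "y = (cmod (char G s))\<^sup>2"
    have "cmod (1 - char (\<mu> n) (s * real n powr (1/\<alpha>))) \<le> 1/4" using s n by (intro near) auto
    then have "3/4 \<le> cmod (char (\<mu> n) (s * real n powr (1/\<alpha>)))"
      using norm_triangle_ineq2[of 1 "1 - (1 - char (\<mu> n) (s * real n powr (1/\<alpha>)))"]
        norm_triangle_ineq2[of 1 "1 - char (\<mu> n) (s * real n powr (1/\<alpha>))"] by simp
    then have "3/4 \<le> cmod (char G s) ^ n" unfolding cmod_\<mu> using n by simp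
    then have "(3/4)\<^sup>2 \<le> (cmod (char G s) ^ n)\<^sup>2" by (intro power_mono) auto
    then have 1: "9/16 \<le> y ^ n" unfolding y_def by (simp add: power_mult_distrib power2_eq_square)
    have "y \<le> exp (- (1 - y))" using exp_ge_add_one_self[of "- (1 - y)"] by simp
    then have "y ^ n \<le> exp (- (1 - y)) ^ n" by (intro power_mono) (auto simp: y_def)
    also have "\<dots> = exp (- (real n * (1 - y)))" by (simp add: exp_of_nat_mult[symmetric] algebra_simps)
    also have "\<dots> \<le> exp (- 1)"
    proof -
      have "1 \<le> real n * (1 - y)" using a n by (simp add: y_def not_le field_simps)
      then show ?thesis by simp
    qed
    also have "exp (- 1) \<le> 1 / (2::real)" using exp_ge_add_one_self[of 1] by (simp add: exp_minus field_simps)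
    finally show False using 1 by simp
  qed
  define q where "q = (1 - exp (- 2 * c)) / 2"
  have q: "0 < q" using c by (simp add: q_def)
  have "(\<lambda>n. char (\<mu> n) 1) \<longlonglongrightarrow> char L 1" by (rule levy_continuity1[OF \<mu>_rd L_rd wc])
  then have "(\<lambda>n. (cmod (char (\<mu> n) 1))\<^sup>2) \<longlonglongrightarrow> (cmod (char L 1))\<^sup>2" by (intro tendsto_intros)
  moreover have "cmod (char L 1) = exp (- c)" using L by (simp add: symmetric_stable_def)
  moreover have "(exp (- c))\<^sup>2 < 1 - q"
  proof -
    have "(exp (- c))\<^sup>2 = exp (- 2 * c)" by (simp add: exp_double[symmetric])
    moreover have "exp (- 2 * c) < 1" using c by simp
    ultimately show ?thesis unfolding q_def by (simp add: field_simps)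
  qed
  ultimately have "eventually (\<lambda>n. (cmod (char (\<mu> n) 1))\<^sup>2 < 1 - q) sequentially"
    by (intro order_tendstoD) auto
  then obtain n1 where n1: "\<And>n. n1 \<le> n \<Longrightarrow> (cmod (char (\<mu> n) 1))\<^sup>2 < 1 - q"
    by (auto simp: eventually_sequentially)
  have lower: "q / real n \<le> 1 - (cmod (char G (1 / real n powr (1/\<alpha>))))\<^sup>2" if n: "n1 \<le> n" "0 < n" for n
  proof -
    define y where "y = (cmod (char G (1 / real n powr (1/\<alpha>))))\<^sup>2"
    have "y ^ n < 1 - q" using n1[OF n(1)] unfolding cmod_\<mu> y_def by (simp add: power_mult[symmetric] mult.commute)
    moreover have "1 + real n * (y - 1) \<le> (1 + (y - 1)) ^ n"
      by (rule Bernoulli_inequality) (simp add: y_def)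
    ultimately show ?thesis using n unfolding y_def[symmetric] by (simp add: field_simps)
  qed
  have direct: "cmod (1 - char G s ^ n) \<le> 1/4"
    if d0: "\<And>n. d n = 0" and n: "n0 \<le> n" "0 < n" and s: "0 < s" "s * real n powr (1/\<alpha>) \<le> t0" for n s
    using near[OF n(1), of "s * real n powr (1/\<alpha>)"] s n unfolding char_\<mu> d0 by simp
  show thesis using that[OF t0 q upper lower direct] by blast
qed

lemma (in prob_space) bounded_absolute_level:
  fixes Y :: "'a \<Rightarrow> real"
  assumes [measurable]: "Y \<in> borel_measurable M"
  obtains A where "0 < A" "1/2 \<le> prob {\<omega>\<in>space M. \<bar>Y \<omega>\<bar> \<le> A}"
proof -
  have "(\<lambda>n. prob {\<omega>\<in>space M. \<bar>Y \<omega>\<bar> \<le> real n}) \<longlonglongrightarrow> prob (\<Union>n. {\<omega>\<in>space M. \<bar>Y \<omega>\<bar> \<le> real n})"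
    by (intro finite_Lim_measure_incseq) (auto simp: incseq_def)
  also have "(\<Union>n. {\<omega>\<in>space M. \<bar>Y \<omega>\<bar> \<le> real n}) = space M" by (auto intro: real_arch_simple)
  finally have "eventually (\<lambda>n. 1/2 < prob {\<omega>\<in>space M. \<bar>Y \<omega>\<bar> \<le> real n}) sequentially"
    by (intro order_tendstoD) (auto simp: prob_space)
  then have "eventually (\<lambda>n. 1/2 < prob {\<omega>\<in>space M. \<bar>Y \<omega>\<bar> \<le> real n} \<and> 0 < n) sequentially"
    using eventually_gt_at_top by (rule eventually_conj)
  then obtain n where "1/2 < prob {\<omega>\<in>space M. \<bar>Y \<omega>\<bar> \<le> real n}" "0 < n"
    by (auto simp: eventually_sequentially)
  then show thesis using that[of "real n"] by simp
qed

text \<open>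
Two independent copies \<open>x\<close>, \<open>y\<close> are taken on the product \<open>G \<Otimes>\<^sub>M G\<close>, and \<open>Z = x - y\<close> has characteristic
function \<open>|\<phi>|\<^sup>2\<close>. Tails of \<open>Z\<close> and of \<open>G\<close> are comparable: if \<open>|y| \<le> A\<close>, which has probability
at least \<open>1/2\<close>, then \<open>|x| \<ge> v > 2 A\<close> forces \<open>|Z| \<ge> v / 2\<close>; conversely \<open>|Z| > v\<close> forces one of
\<open>|x|\<close>, \<open>|y|\<close> to exceed \<open>v / 2\<close>.
\<close>

lemma attracted_two_sided_tails:
  assumes na: "normally_attracted G \<alpha> c d" and \<alpha>: "0 < \<alpha>" "\<alpha> < 2" and c: "0 < c"
  shows "\<exists>C\<ge>0. \<forall>u>0. measure G {y. u \<le> \<bar>y\<bar>} \<le> C * u powr (- \<alpha>)"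
    and "\<exists>\<kappa>>0. \<exists>x0>0. \<forall>u\<ge>x0. \<kappa> * u powr (- \<alpha>) \<le> measure G {y. u < \<bar>y\<bar>}"
proof -
  obtain t0 n0 q n1 where t0: "0 < t0" and q: "0 < q"
    and up: "\<And>n s. n0 \<le> n \<Longrightarrow> 0 < n \<Longrightarrow> 0 < s \<Longrightarrow> s * real n powr (1/\<alpha>) \<le> t0 \<Longrightarrow> 1 - (cmod (char G s))\<^sup>2 \<le> 1 / real n"
    and lo: "\<And>n. n1 \<le> n \<Longrightarrow> 0 < n \<Longrightarrow> q / real n \<le> 1 - (cmod (char G (1 / real n powr (1/\<alpha>))))\<^sup>2"
    by (rule attracted_char_estimates[OF na \<alpha>(1) c]) blast
  interpret real_distribution G using na by (simp add: normally_attracted_def)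
  interpret Q: pair_prob_space G G ..
  define Z :: "real \<times> real \<Rightarrow> real" where "Z z = fst z - snd z" for z
  have Zm[measurable]: "Z \<in> borel_measurable (G \<Otimes>\<^sub>M G)" unfolding Z_def[abs_def] by measurable
  have spQ: "space (G \<Otimes>\<^sub>M G) = UNIV" by (simp add: space_pair_measure)
  have cosZ: "Q.expectation (\<lambda>z. 1 - cos (s * Z z)) = 1 - (cmod (char G s))\<^sup>2" for s
  proof -
    have i1: "integrable (G \<Otimes>\<^sub>M G) (\<lambda>z. iexp (s * Z z))" by (intro Q.integrable_iexp) auto
    have "(CLINT z|G \<Otimes>\<^sub>M G. iexp (s * Z z)) = (CLINT x|G. CLINT y|G. iexp (s * Z (x, y)))"
      by (rule Q.integral_fst'[OF i1, symmetric])
    also have "\<dots> = (CLINT x|G. CLINT y|G. iexp (s * x) * cnj (iexp (s * y)))"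
      by (intro Bochner_Integration.integral_cong refl) (simp add: Z_def exp_cnj exp_add[symmetric] algebra_simps)
    also have "\<dots> = char G s * cnj (char G s)" unfolding char_def by (simp add: integral_cnj)
    also have "\<dots> = of_real ((cmod (char G s))\<^sup>2)" by (simp add: complex_norm_square[symmetric])
    finally have "Re (CLINT z|G \<Otimes>\<^sub>M G. iexp (s * Z z)) = (cmod (char G s))\<^sup>2" by simp
    then have "Q.expectation (\<lambda>z. Re (iexp (s * Z z))) = (cmod (char G s))\<^sup>2" using i1 by (simp add: integral_Re)
    then have "Q.expectation (\<lambda>z. cos (s * Z z)) = (cmod (char G s))\<^sup>2" by (simp add: Re_exp)
    moreover have "integrable (G \<Otimes>\<^sub>M G) (\<lambda>z. cos (s * Z z))"
      by (intro Q.integrable_const_bound[of _ 1]) auto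
    ultimately show ?thesis by (simp add: Q.prob_space)
  qed
  have bnd: "1 - (cmod (char G s))\<^sup>2 \<le> 1" for s by simp
  obtain C0 where C0: "0 \<le> C0" "\<And>s. 0 < s \<Longrightarrow> 1 - (cmod (char G s))\<^sup>2 \<le> C0 * s powr \<alpha>"
    by (rule power_bound_from_grid[where f = "\<lambda>s. 1 - (cmod (char G s))\<^sup>2", OF \<alpha>(1) t0 zero_le_one zero_le_one up bnd]; blast)
  obtain C where C: "0 \<le> C" and tailQ: "\<And>r. 0 < r \<Longrightarrow> Q.prob {z\<in>space (G \<Otimes>\<^sub>M G). r \<le> \<bar>Z z\<bar>} \<le> C * r powr (- \<alpha>)"
  proof (rule Q.tail_from_cosine[OF Zm \<alpha>(1) C0(1)])
    show "Q.expectation (\<lambda>z. 1 - cos (s * Z z)) \<le> C0 * s powr \<alpha>" if "0 < s" for s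
      unfolding cosZ by (rule C0(2)[OF that])
  qed blast
  obtain A where A: "0 < A" "1/2 \<le> prob {y. \<bar>y\<bar> \<le> A}"
    using bounded_absolute_level[of "\<lambda>y. y"] by auto
  have rect: "measure (G \<Otimes>\<^sub>M G) (S \<times> T) = prob S * prob T" if "S \<in> sets borel" "T \<in> sets borel" for S T
    using that by (simp add: measure_def emeasure_pair_measure_Times enn2real_mult)
  show "\<exists>C\<ge>0. \<forall>u>0. measure G {y. u \<le> \<bar>y\<bar>} \<le> C * u powr (- \<alpha>)"
  proof (intro exI conjI allI impI)
    let ?C = "2 * C * 2 powr \<alpha> + (2 * A) powr \<alpha>"
    show "0 \<le> ?C" using C by simp
    fix v :: real assume v: "0 < v"
    show "prob {y. v \<le> \<bar>y\<bar>} \<le> ?C * v powr (- \<alpha>)"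
    proof (cases "v \<le> 2 * A")
      case True
      have "prob {y. v \<le> \<bar>y\<bar>} \<le> 1" by simp
      also have "1 \<le> ((2 * A) / v) powr \<alpha>" using True v \<alpha> by (intro ge_one_powr_ge_zero) auto
      also have "\<dots> = (2 * A) powr \<alpha> * v powr (- \<alpha>)" using v A by (simp add: powr_divide powr_minus field_simps)
      also have "\<dots> \<le> ?C * v powr (- \<alpha>)" using C by (intro mult_right_mono) auto
      finally show ?thesis .
    next
      case False
      have "{y. v \<le> \<bar>y\<bar>} \<times> {y. \<bar>y\<bar> \<le> A} \<subseteq> {z\<in>space (G \<Otimes>\<^sub>M G). v / 2 \<le> \<bar>Z z\<bar>}"
      proof safe
        fix x y :: real assume "v \<le> \<bar>x\<bar>" "\<bar>y\<bar> \<le> A"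
        then have "v / 2 \<le> \<bar>x - y\<bar>" using False abs_triangle_ineq[of "x - y" y] by simp
        then show "v / 2 \<le> \<bar>Z (x, y)\<bar>" by (simp add: Z_def)
      qed (simp add: spQ)
      moreover have "{z\<in>space (G \<Otimes>\<^sub>M G). v / 2 \<le> \<bar>Z z\<bar>} \<in> sets (G \<Otimes>\<^sub>M G)" by measurable
      ultimately have "measure (G \<Otimes>\<^sub>M G) ({y. v \<le> \<bar>y\<bar>} \<times> {y. \<bar>y\<bar> \<le> A}) \<le> Q.prob {z\<in>space (G \<Otimes>\<^sub>M G). v / 2 \<le> \<bar>Z z\<bar>}"
        by (rule Q.finite_measure_mono)
      also have "\<dots> \<le> C * (v / 2) powr (- \<alpha>)" using v by (intro tailQ) auto
      finally have "prob {y. v \<le> \<bar>y\<bar>} * prob {y. \<bar>y\<bar> \<le> A} \<le> C * (v / 2) powr (- \<alpha>)" by (subst (asm) rect) auto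
      moreover have "prob {y. v \<le> \<bar>y\<bar>} * (1/2) \<le> prob {y. v \<le> \<bar>y\<bar>} * prob {y. \<bar>y\<bar> \<le> A}"
        using A by (intro mult_left_mono) auto
      ultimately have "prob {y. v \<le> \<bar>y\<bar>} \<le> 2 * (C * (v / 2) powr (- \<alpha>))" by linarith
      also have "\<dots> = 2 * C * 2 powr \<alpha> * v powr (- \<alpha>)" using v by (simp add: powr_divide powr_minus field_simps)
      also have "\<dots> \<le> ?C * v powr (- \<alpha>)" by (intro mult_right_mono) auto
      finally show ?thesis .
    qed
  qed
  obtain \<epsilon> where \<epsilon>: "0 < \<epsilon>" and lower: "\<And>R. 0 < R \<Longrightarrow> q * R powr (-\<alpha>) \<le> Q.expectation (\<lambda>z. 1 - cos (Z z / R)) \<Longrightarrow>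
     q / 4 * R powr (- \<alpha>) \<le> Q.prob {z\<in>space (G \<Otimes>\<^sub>M G). \<epsilon> * R < \<bar>Z z\<bar>}"
    by (rule Q.tail_lower_from_cosine[OF Zm \<alpha>(2) C tailQ q]; blast)
  have grid: "q / (8 * real n) \<le> prob {y. \<epsilon> * real n powr (1/\<alpha>) / 2 < \<bar>y\<bar>}" if n: "n1 \<le> n" "0 < n" for n
  proof -
    define R where "R = real n powr (1/\<alpha>)"
    have R: "0 < R" "R powr (- \<alpha>) = 1 / real n" using n \<alpha> by (auto simp: R_def powr_powr powr_minus inverse_eq_divide)
    have "q / real n \<le> Q.expectation (\<lambda>z. 1 - cos (Z z / R))"
      using lo[OF n] cosZ[of "1 / R"] by (simp add: R_def)
    then have "q / 4 * R powr (- \<alpha>) \<le> Q.prob {z\<in>space (G \<Otimes>\<^sub>M G). \<epsilon> * R < \<bar>Z z\<bar>}"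
      using R by (intro lower) auto
    also have "\<dots> \<le> Q.prob ({y. \<epsilon> * R / 2 < \<bar>y\<bar>} \<times> UNIV \<union> UNIV \<times> {y. \<epsilon> * R / 2 < \<bar>y\<bar>})"
      by (intro Q.finite_measure_mono) (auto simp: Z_def)
    also have "\<dots> \<le> Q.prob ({y. \<epsilon> * R / 2 < \<bar>y\<bar>} \<times> UNIV) + Q.prob (UNIV \<times> {y. \<epsilon> * R / 2 < \<bar>y\<bar>})"
      by (intro measure_Un_le) auto
    also have "\<dots> = 2 * prob {y. \<epsilon> * R / 2 < \<bar>y\<bar>}"
      using prob_space by (simp add: rect)
    finally show ?thesis using R(2) by (simp add: R_def)
  qed
  show "\<exists>\<kappa>>0. \<exists>x0>0. \<forall>u\<ge>x0. \<kappa> * u powr (- \<alpha>) \<le> measure G {y. u < \<bar>y\<bar>}"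
  proof (intro exI conjI allI impI)
    let ?\<kappa> = "q / 16 * (\<epsilon> / 2) powr \<alpha>" and ?x0 = "\<epsilon> / 2 * (real n1 + 1) powr (1/\<alpha>)"
    show "0 < ?\<kappa>" using q \<epsilon> by simp
    show "0 < ?x0" using \<epsilon> by simp
    fix u assume u: "?x0 \<le> u"
    define z where "z = (u / (\<epsilon> / 2)) powr \<alpha>"
    have u0: "0 < u" using u \<open>0 < ?x0\<close> by linarith
    have "real n1 + 1 = ((real n1 + 1) powr (1/\<alpha>)) powr \<alpha>" using \<alpha> by (simp add: powr_powr)
    also have "\<dots> \<le> z" unfolding z_def using u \<epsilon> \<alpha> by (intro powr_mono2) (auto simp: field_simps)
    finally have z1: "real n1 + 1 \<le> z" .
    define n where "n = nat \<lceil>z\<rceil>"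
    have n: "z \<le> real n" "real n < z + 1" using z1 by (auto simp: n_def) linarith
    have n1': "n1 \<le> n" "0 < n" using n z1 by linarith+
    have "u / (\<epsilon> / 2) = z powr (1/\<alpha>)" using u0 \<epsilon> \<alpha> by (simp add: z_def powr_powr)
    also have "\<dots> \<le> real n powr (1/\<alpha>)" using n z1 \<alpha> by (intro powr_mono2) auto
    finally have un: "u \<le> \<epsilon> * real n powr (1/\<alpha>) / 2" using \<epsilon> by (simp add: field_simps)
    have "?\<kappa> * u powr (- \<alpha>) = q / 16 * (1 / z)"
      using u0 \<epsilon> by (simp add: z_def powr_divide powr_mult powr_minus field_simps)
    also have "\<dots> \<le> q / (8 * real n)"
    proof -
      have "real n \<le> 2 * z" using n z1 by linarith
      then show ?thesis using q n1' z1 by (simp add: field_simps)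
    qed
    also have "\<dots> \<le> prob {y. \<epsilon> * real n powr (1/\<alpha>) / 2 < \<bar>y\<bar>}" by (rule grid[OF n1'])
    also have "\<dots> \<le> prob {y. u < \<bar>y\<bar>}" using un by (intro finite_measure_mono) auto
    finally show "?\<kappa> * u powr (- \<alpha>) \<le> prob {y. u < \<bar>y\<bar>}" .
  qed
qed

text \<open>
Without centering, all powers \<open>\<phi>(s) ^ k\<close> with \<open>n0 < k \<le> n\<close> are near \<open>1\<close> when \<open>s\<close> is at most of
order \<open>n powr (- 1 / \<alpha>)\<close>. Then the geometric sum \<open>\<Sum> \<phi>(s) ^ k\<close> has modulus at least \<open>n / 2\<close>,
and \<open>|1 - \<phi>(s) ^ n| = |1 - \<phi>(s)| |\<Sum> \<phi>(s) ^ k|\<close> bounds \<open>|1 - \<phi>(s)|\<close> by \<open>1 / n\<close>. Hence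
\<open>1 - \<phi>(s) = O(s powr \<alpha>)\<close> with \<open>\<alpha> > 1\<close>. The imaginary part of \<open>\<phi>(1 / r)\<close>, multiplied by \<open>r\<close>,
therefore tends to \<open>0\<close>; it also tends to the mean, by dominated convergence.
\<close>

lemma attracted_mean_zero:
  assumes na: "normally_attracted G \<alpha> c d" and \<alpha>: "1 < \<alpha>" and c: "0 < c" and d0: "\<And>n. d n = 0"
    and int: "integrable G (\<lambda>y. y)"
  shows "integral\<^sup>L G (\<lambda>y. y) = 0"
proof -
  have \<alpha>0: "0 < \<alpha>" using \<alpha> by simp
  obtain t0 n0 where t0: "0 < t0"
    and near: "\<And>n s. n0 \<le> n \<Longrightarrow> 0 < n \<Longrightarrow> 0 < s \<Longrightarrow> s * real n powr (1/\<alpha>) \<le> t0 \<Longrightarrow> cmod (1 - char G s ^ n) \<le> 1/4"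
    by (rule attracted_char_estimates[OF na \<alpha>0 c]) (use d0 in blast)
  interpret real_distribution G using na by (simp add: normally_attracted_def)
  have grid: "cmod (1 - char G s) \<le> 1 / real n"
    if n: "7 * (n0 + 1) \<le> n" "0 < n" and s: "0 < s" "s * real n powr (1/\<alpha>) \<le> t0" for n s
  proof -
    \<comment> \<open>A lower bound of \<open>Re (\<phi>(s) ^ k)\<close>, trivial for the few small \<open>k\<close>; its sum up to \<open>n\<close> is at least
        \<open>n / 2\<close> once \<open>n \<ge> 7 (n0 + 1)\<close>.\<close>
    define g :: "nat \<Rightarrow> real" where "g k = (if k < n0 + 1 then - 1 else 3/4)" for k
    have g_le: "g k \<le> Re (char G s ^ k)" if k: "k < n" for k
    proof (cases "k < n0 + 1")
      case True
      have "\<bar>Re (char G s ^ k)\<bar> \<le> cmod (char G s ^ k)" by (rule abs_Re_le_cmod)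
      also have "\<dots> \<le> 1" by (simp add: norm_power power_le_one cmod_char_le_1)
      finally show ?thesis using True by (simp add: g_def)
    next
      case False
      have "s * real k powr (1/\<alpha>) \<le> s * real n powr (1/\<alpha>)" using k s \<alpha> by (intro mult_left_mono powr_mono2) auto
      then have "s * real k powr (1/\<alpha>) \<le> t0" using s(2) by (rule order_trans)
      then have "cmod (1 - char G s ^ k) \<le> 1/4" using False s by (intro near) auto
      then show ?thesis using False abs_Re_le_cmod[of "1 - char G s ^ k"] by (simp add: g_def)
    qed
    have g_sum: "(\<Sum>k<N. g k) = 3/4 * real N - 7/4 * real (min N (n0 + 1))" for N
      by (induction N) (auto simp: g_def min_def field_simps split: if_splits)
    have "real n / 2 \<le> (\<Sum>k<n. g k)" using n of_nat_mono[OF n(1), where 'a = real]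
      unfolding g_sum by (simp add: min_def field_simps)
    also have "\<dots> \<le> Re (\<Sum>k<n. char G s ^ k)" unfolding Re_sum by (intro sum_mono g_le) auto
    also have "\<dots> \<le> cmod (\<Sum>k<n. char G s ^ k)" by (rule complex_Re_le_cmod)
    finally have geo: "real n / 2 \<le> cmod (\<Sum>k<n. char G s ^ k)" .
    have "cmod (1 - char G s) * (real n / 2) \<le> cmod (1 - char G s) * cmod (\<Sum>k<n. char G s ^ k)"
      by (intro mult_left_mono geo) auto
    also have "\<dots> = cmod (1 - char G s ^ n)"
      unfolding norm_mult[symmetric] by (simp add: one_diff_power_eq)
    also have "\<dots> \<le> 1/4" using n s by (intro near) auto
    finally show ?thesis using n by (simp add: field_simps)
  qed
  have bnd: "cmod (1 - char G s) \<le> 2" for s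
    using norm_triangle_ineq4[of 1 "char G s"] cmod_char_le_1[of s] by simp
  obtain C where C: "0 \<le> C" "\<And>s. 0 < s \<Longrightarrow> cmod (1 - char G s) \<le> C * s powr \<alpha>"
    by (rule power_bound_from_grid[where f = "\<lambda>s. cmod (1 - char G s)", OF \<alpha>0 t0 zero_le_one zero_le_numeral grid bnd]; blast)
  define r where "r m = real (Suc m)" for m
  have r: "0 < r m" for m by (simp add: r_def)
  have r_lim: "(\<lambda>m. inverse (r m)) \<longlonglongrightarrow> 0" unfolding r_def by (rule LIMSEQ_inverse_real_of_nat)
  have "(\<lambda>m. \<integral>y. r m * sin (y / r m) \<partial>G) \<longlonglongrightarrow> (\<integral>y. y \<partial>G)"
  proof (rule integral_dominated_convergence[where w = "\<lambda>y. \<bar>y\<bar>"])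
    show "AE y in G. (\<lambda>m. r m * sin (y / r m)) \<longlonglongrightarrow> y"
    proof (intro AE_I2)
      fix y :: real
      have "((\<lambda>x. sin (y * x) / x) \<longlongrightarrow> y) (at 0)"
      proof -
        have "DERIV (\<lambda>x. sin (y * x)) 0 :> y" by (auto intro!: derivative_eq_intros)
        from DERIV_D[OF this] show ?thesis by simp
      qed
      moreover have "filterlim (\<lambda>m. inverse (r m)) (at 0) sequentially"
        using r_lim r by (auto simp: filterlim_at less_imp_neq[symmetric])
      ultimately have "(\<lambda>m. sin (y * inverse (r m)) / inverse (r m)) \<longlonglongrightarrow> y"
        by (rule filterlim_compose)
      then show "(\<lambda>m. r m * sin (y / r m)) \<longlonglongrightarrow> y" by (simp add: divide_inverse mult.commute)
    qed
    show "AE y in G. norm (r m * sin (y / r m)) \<le> \<bar>y\<bar>" for m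
    proof (intro AE_I2)
      fix y
      have "\<bar>r m * sin (y / r m)\<bar> \<le> r m * \<bar>y / r m\<bar>"
        unfolding abs_mult using r[of m] by (intro mult_mono abs_sin_x_le_abs_x) auto
      then show "norm (r m * sin (y / r m)) \<le> \<bar>y\<bar>" using r[of m] by simp
    qed
    show "(\<lambda>y. r m * sin (y / r m)) \<in> borel_measurable G" for m by simp
    show "integrable G (\<lambda>y. \<bar>y\<bar>)" using int by (rule integrable_abs)
  qed simp
  moreover have "(\<lambda>m. \<integral>y. r m * sin (y / r m) \<partial>G) \<longlonglongrightarrow> 0"
  proof (rule Lim_null_comparison)
    show "eventually (\<lambda>m. norm (\<integral>y. r m * sin (y / r m) \<partial>G) \<le> C * r m powr (1 - \<alpha>)) sequentially"
    proof (intro always_eventually allI)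
      fix m
      have "(\<integral>y. sin (y / r m) \<partial>G) = Im (char G (1 / r m))"
      proof -
        have "integrable G (\<lambda>y. iexp (1 / r m * y))" by (intro integrable_iexp) auto
        from integral_Im[OF this] show ?thesis by (simp add: char_def Im_exp)
      qed
      then have "\<bar>\<integral>y. sin (y / r m) \<partial>G\<bar> \<le> cmod (1 - char G (1 / r m))"
        using abs_Im_le_cmod[of "1 - char G (1 / r m)"] by simp
      also have "\<dots> \<le> C * (1 / r m) powr \<alpha>" using r by (intro C) auto
      finally have "r m * \<bar>\<integral>y. sin (y / r m) \<partial>G\<bar> \<le> r m * (C * (1 / r m) powr \<alpha>)"
        using r[of m] by (intro mult_left_mono) auto
      also have "\<dots> = C * r m powr (1 - \<alpha>)" using r[of m] by (simp add: powr_divide powr_diff)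
      finally show "norm (\<integral>y. r m * sin (y / r m) \<partial>G) \<le> C * r m powr (1 - \<alpha>)"
        using r[of m] by (simp add: abs_mult)
    qed
    show "(\<lambda>m. C * r m powr (1 - \<alpha>)) \<longlonglongrightarrow> 0"
      unfolding r_def using \<alpha> by real_asymp
  qed
  ultimately show ?thesis by (rule LIMSEQ_unique)
qed

section \<open>Sums of independent variables with power tails\<close>

text \<open>
Independent variables, the \<open>k\<close>-th of which has tails of order at most \<open>u powr (- e k)\<close>. The moment
bounds that follow from the tails are part of the locale, with one constant for all of them; the
logarithm in the bound of the means belongs to the critical exponent \<open>1\<close>.
\<close>

locale power_tailed = prob_space M for M :: "'a measure" +
  fixes X :: "nat \<Rightarrow> 'a \<Rightarrow> real" and e :: "nat \<Rightarrow> real" and A :: real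
  assumes indep: "indep_vars (\<lambda>_. borel) X {1..}"
    and A_nonneg: "0 \<le> A"
    and tail: "\<And>k u. 1 \<le> k \<Longrightarrow> 0 < u \<Longrightarrow> prob {\<omega>\<in>space M. u \<le> \<bar>X k \<omega>\<bar>} \<le> A * u powr (- e k)"
    and second: "\<And>k x. 1 \<le> k \<Longrightarrow> 0 < x \<Longrightarrow>
      expectation (\<lambda>\<omega>. (X k \<omega> * indicator {- x..x} (X k \<omega>))\<^sup>2) \<le> A * x powr (2 - e k)"
    and mean: "\<And>k x. 1 \<le> k \<Longrightarrow> 1 \<le> x \<Longrightarrow>
      \<bar>expectation (\<lambda>\<omega>. X k \<omega> * indicator {- x..x} (X k \<omega>))\<bar>
        \<le> A * x powr (1 - e k) * (if e k = 1 then 1 + ln x else 1)"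
begin

lemma X_measurable[measurable]: "1 \<le> k \<Longrightarrow> X k \<in> borel_measurable M"
  using indep by (auto simp: indep_vars_def)

definition trunc :: "real \<Rightarrow> nat \<Rightarrow> 'a \<Rightarrow> real" where
  "trunc x k \<omega> = X k \<omega> * indicator {- x..x} (X k \<omega>)"

lemma trunc_measurable[measurable]: "1 \<le> k \<Longrightarrow> trunc x k \<in> borel_measurable M"
  unfolding trunc_def[abs_def] by measurable

lemma trunc_integrable: "1 \<le> k \<Longrightarrow> integrable M (trunc x k)" "1 \<le> k \<Longrightarrow> integrable M (\<lambda>\<omega>. (trunc x k \<omega>)\<^sup>2)"
  unfolding trunc_def[abs_def] by (intro integrable_truncated X_measurable; assumption)+

lemma trunc_centered:
  assumes k: "1 \<le> k" and x: "0 < x"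
  shows "expectation (\<lambda>\<omega>. trunc x k \<omega> - expectation (trunc x k)) = 0"
    and "integrable M (\<lambda>\<omega>. (trunc x k \<omega> - expectation (trunc x k))\<^sup>2)"
    and "expectation (\<lambda>\<omega>. (trunc x k \<omega> - expectation (trunc x k))\<^sup>2) \<le> A * x powr (2 - e k)"
proof -
  note i = trunc_integrable[OF k, of x]
  show "expectation (\<lambda>\<omega>. trunc x k \<omega> - expectation (trunc x k)) = 0"
    using i by (simp add: prob_space)
  show "integrable M (\<lambda>\<omega>. (trunc x k \<omega> - expectation (trunc x k))\<^sup>2)"
    using i by (simp add: power2_diff)
  have "expectation (\<lambda>\<omega>. (trunc x k \<omega> - expectation (trunc x k))\<^sup>2)
      = expectation (\<lambda>\<omega>. (trunc x k \<omega>)\<^sup>2) - (expectation (trunc x k))\<^sup>2"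
    using variance_eq[OF i] .
  also have "\<dots> \<le> expectation (\<lambda>\<omega>. (trunc x k \<omega>)\<^sup>2)" by simp
  also have "\<dots> \<le> A * x powr (2 - e k)" unfolding trunc_def using k x by (rule second)
  finally show "expectation (\<lambda>\<omega>. (trunc x k \<omega> - expectation (trunc x k))\<^sup>2) \<le> A * x powr (2 - e k)" .
qed

text \<open>
Each summand is truncated at the norming level \<open>b k\<close>. Almost surely only finitely many are changed,
by the first Borel-Cantelli lemma. The centred truncated variables divided by \<open>b k\<close> have summable
variances, so Kronecker's lemma applies to their sum. It also disposes of the truncated means,
which are of order \<open>b k * b k powr (- e k)\<close>, except for those with exponent \<open>1\<close>: they carry an
additional logarithm and are estimated directly by the last hypothesis.
\<close>

theorem strong_law:
  assumes b: "mono b" and b1: "\<And>n. 1 \<le> b n" and b_inf: "filterlim b at_top sequentially"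
    and sum: "summable (\<lambda>k. b k powr (- e k))"
    and lim: "(\<lambda>n. (1 + ln (b n)) * (\<Sum>k=1..n. b n powr (- e k))) \<longlonglongrightarrow> 0"
  shows "AE \<omega> in M. (\<lambda>n. partial_sum X n \<omega> / b n) \<longlonglongrightarrow> 0"
proof -
  have b0: "0 < b n" for n using b1[of n] by simp
  define m where "m k = expectation (trunc (b k) k)" for k
  define Z where "Z k \<omega> = (trunc (b k) k \<omega> - m k) / b k" for k \<omega>
  have b_inf': "filterlim b at_infinity sequentially" using b_inf by (rule filterlim_at_top_imp_at_infinity)
  have Z: "integrable M (\<lambda>\<omega>. (Z k \<omega>)\<^sup>2) \<and> expectation (Z k) = 0 \<and>
      expectation (\<lambda>\<omega>. (Z k \<omega>)\<^sup>2) \<le> A * b k powr (- e k)" if k: "1 \<le> k" for k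
  proof -
    note c = trunc_centered[OF k b0[of k]]
    have "expectation (\<lambda>\<omega>. (Z k \<omega>)\<^sup>2) \<le> A * b k powr (2 - e k) / (b k)\<^sup>2"
      using c(3) b0[of k] by (simp add: Z_def power_divide m_def divide_right_mono)
    also have "\<dots> = A * b k powr (- e k)"
      using b0[of k] by (simp add: powr_diff powr_minus powr_numeral field_simps)
    finally show ?thesis using c by (simp add: Z_def[abs_def] power_divide m_def)
  qed
  have m_lim: "(\<lambda>n. (\<Sum>k=1..n. m k) / b n) \<longlonglongrightarrow> 0"
  proof (rule Lim_null_comparison)
    define W where "W n = (\<Sum>k=1..n. b n powr (- e k))" for n
    show "eventually (\<lambda>n. norm ((\<Sum>k=1..n. m k) / b n)
        \<le> A * ((\<Sum>k\<le>n. b k * b k powr (- e k)) / b n) + A * ((1 + ln (b n)) * W n)) sequentially"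
    proof (intro always_eventually allI)
      fix n
      have "\<bar>m k\<bar> \<le> A * (b k * b k powr (- e k)) + A * ((1 + ln (b n)) * (b n * b n powr (- e k)))"
        if k: "k \<in> {1..n}" for k
      proof -
        have bkn: "b k \<le> b n" using k b by (auto intro: monoD)
        have ln0: "0 \<le> ln (b k)" "ln (b k) \<le> ln (b n)" using b1[of k] b0[of k] bkn by auto
        have eq: "x powr (1 - e k) = x * x powr (- e k)" if "0 < x" for x
          using that by (simp add: powr_diff powr_minus field_simps)
        have "\<bar>m k\<bar> \<le> A * (b k * b k powr (- e k)) * (if e k = 1 then 1 + ln (b k) else 1)"
          using mean[of k "b k"] k b1[of k] b0[of k] unfolding m_def trunc_def[abs_def] by (simp add: eq)
        also have "\<dots> \<le> A * (b k * b k powr (- e k)) + A * ((1 + ln (b n)) * (b n * b n powr (- e k)))"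
        proof (cases "e k = 1")
          case True
          have "A * (1 + ln (b k)) \<le> A * (1 + ln (b n))" using ln0 A_nonneg by (intro mult_left_mono) auto
          then show ?thesis using True b0[of k] b0[of n] A_nonneg by (simp add: powr_minus)
        next
          case False
          have "0 \<le> A * ((1 + ln (b n)) * (b n * b n powr (- e k)))"
            using A_nonneg ln0 b0[of n] by (intro mult_nonneg_nonneg) auto
          then show ?thesis using False by simp
        qed
        finally show ?thesis .
      qed
      then have "\<bar>\<Sum>k=1..n. m k\<bar> \<le> (\<Sum>k=1..n. A * (b k * b k powr (- e k)) + A * ((1 + ln (b n)) * (b n * b n powr (- e k))))"
        by (intro order_trans[OF sum_abs] sum_mono) auto
      also have "\<dots> = A * (\<Sum>k=1..n. b k * b k powr (- e k)) + b n * (A * ((1 + ln (b n)) * W n))"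
        by (simp add: sum.distrib W_def sum_distrib_left algebra_simps)
      also have "(\<Sum>k=1..n. b k * b k powr (- e k)) \<le> (\<Sum>k\<le>n. b k * b k powr (- e k))"
        using less_imp_le[OF b0] by (intro sum_mono2) auto
      finally have "\<bar>\<Sum>k=1..n. m k\<bar> \<le> A * (\<Sum>k\<le>n. b k * b k powr (- e k)) + b n * (A * ((1 + ln (b n)) * W n))"
        using A_nonneg by (simp add: mult_left_mono)
      then have "\<bar>\<Sum>k=1..n. m k\<bar> / b n \<le> (A * (\<Sum>k\<le>n. b k * b k powr (- e k)) + b n * (A * ((1 + ln (b n)) * W n))) / b n"
        using b0[of n] by (intro divide_right_mono) auto
      also have "\<dots> = A * ((\<Sum>k\<le>n. b k * b k powr (- e k)) / b n) + A * ((1 + ln (b n)) * W n)"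
        using b0[of n] by (simp add: add_divide_distrib)
      finally show "norm ((\<Sum>k=1..n. m k) / b n) \<le> A * ((\<Sum>k\<le>n. b k * b k powr (- e k)) / b n) + A * ((1 + ln (b n)) * W n)"
        using b0[of n] by simp
    qed
    have "(\<lambda>n. A * ((\<Sum>k\<le>n. b k * b k powr (- e k)) / b n) + A * ((1 + ln (b n)) * W n)) \<longlonglongrightarrow> A * 0 + A * 0"
      unfolding W_def by (intro tendsto_intros kronecker_lemma sum b b0 b_inf lim)
    then show "(\<lambda>n. A * ((\<Sum>k\<le>n. b k * b k powr (- e k)) / b n) + A * ((1 + ln (b n)) * W n)) \<longlonglongrightarrow> 0" by simp
  qed
  have "AE \<omega> in M. summable (\<lambda>i. Z i \<omega>)"
  proof (rule AE_summable_indep)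
    show "indep_vars (\<lambda>_. borel) Z {1..}"
      unfolding Z_def[abs_def] trunc_def
      by (rule indep_vars_compose2[OF indep, where Y = "\<lambda>k x. (x * indicator {- b k..b k} x - m k) / b k"]) measurable
    show "summable (\<lambda>i. expectation (\<lambda>\<omega>. (Z i \<omega>)\<^sup>2))"
      by (rule summable_comparison_test'[OF summable_mult[OF sum, of A], of 1]) (use Z in auto)
  qed (use Z in auto)
  moreover have "AE \<omega> in M. eventually (\<lambda>k. \<omega> \<in> space M - {\<omega>\<in>space M. 1 \<le> k \<and> b k \<le> \<bar>X k \<omega>\<bar>}) sequentially"
  proof (rule borel_cantelli_AE1)
    fix k show "{\<omega>\<in>space M. 1 \<le> k \<and> b k \<le> \<bar>X k \<omega>\<bar>} \<in> sets M"
      by (cases "1 \<le> k") (auto simp: X_measurable)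
  next
    show "summable (\<lambda>k. prob {\<omega>\<in>space M. 1 \<le> k \<and> b k \<le> \<bar>X k \<omega>\<bar>})"
      by (rule summable_comparison_test'[OF summable_mult[OF sum, of A], of 1]) (use tail b0 in auto)
  qed (simp add: emeasure_eq_measure)
  ultimately show ?thesis
  proof eventually_elim
    fix \<omega> assume Zs: "summable (\<lambda>i. Z i \<omega>)"
      and ev: "eventually (\<lambda>k. \<omega> \<in> space M - {\<omega>\<in>space M. 1 \<le> k \<and> b k \<le> \<bar>X k \<omega>\<bar>}) sequentially"
    from ev obtain n0 where n0: "\<And>k. n0 \<le> k \<Longrightarrow> 1 \<le> k \<Longrightarrow> \<bar>X k \<omega>\<bar> < b k"
      by (auto simp: eventually_sequentially not_le)
    define R where "R k = X k \<omega> - trunc (b k) k \<omega>" for k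
    have R0: "R k = 0" if "n0 \<le> k" "1 \<le> k" for k
      using n0[OF that] by (auto simp: R_def trunc_def indicator_def)
    have R_sum: "(\<Sum>k=1..n. R k) = (\<Sum>k\<in>{1..n0}. R k)" if "n0 \<le> n" for n
      using that R0 by (intro sum.mono_neutral_right) auto
    have "(\<lambda>n. (\<Sum>k=1..n0. R k) / b n) \<longlonglongrightarrow> 0"
      by (intro tendsto_divide_0[OF tendsto_const] b_inf')
    moreover have "\<forall>\<^sub>F n in sequentially. (\<Sum>k=1..n0. R k) / b n = (\<Sum>k=1..n. R k) / b n"
      using eventually_ge_at_top[of n0]
    proof eventually_elim
      case (elim n)
      from R_sum[OF this] show ?case by simp
    qed
    ultimately have R_lim: "(\<lambda>n. (\<Sum>k=1..n. R k) / b n) \<longlonglongrightarrow> 0"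
      by (rule Lim_transform_eventually)
    have K: "(\<lambda>n. (\<Sum>k\<le>n. b k * Z k \<omega>) / b n) \<longlonglongrightarrow> 0"
      by (rule kronecker_lemma[OF Zs b b0 b_inf])
    have "(\<lambda>n. b 0 * Z 0 \<omega> / b n) \<longlonglongrightarrow> 0"
      by (intro tendsto_divide_0[OF tendsto_const] b_inf')
    from tendsto_diff[OF K this] have Z_lim: "(\<lambda>n. (\<Sum>k=1..n. b k * Z k \<omega>) / b n) \<longlonglongrightarrow> 0"
      by (simp add: diff_divide_distrib[symmetric] atMost_atLeast0 sum.atLeast_Suc_atMost)
    have "partial_sum X n \<omega> / b n = (\<Sum>k=1..n. R k) / b n + (\<Sum>k=1..n. b k * Z k \<omega>) / b n + (\<Sum>k=1..n. m k) / b n" for n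
    proof -
      have "partial_sum X n \<omega> = (\<Sum>k=1..n. R k + b k * Z k \<omega> + m k)"
        unfolding partial_sum_def
      proof (intro sum.cong refl)
        fix k show "X k \<omega> = R k + b k * Z k \<omega> + m k" using b0[of k] by (simp add: R_def Z_def)
      qed
      then show ?thesis by (simp add: sum.distrib add_divide_distrib)
    qed
    moreover have "(\<lambda>n. (\<Sum>k=1..n. R k) / b n + (\<Sum>k=1..n. b k * Z k \<omega>) / b n + (\<Sum>k=1..n. m k) / b n) \<longlonglongrightarrow> 0 + 0 + 0"
      by (intro tendsto_add R_lim Z_lim m_lim)
    ultimately show "(\<lambda>n. partial_sum X n \<omega> / b n) \<longlonglongrightarrow> 0" by simp
  qed
qed

text \<open>
Truncation at the level \<open>t\<close> at which the sum is tested: the probability that some variable of the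
block exceeds \<open>t\<close> and the variance of the truncated sum divided by \<open>t\<^sup>2\<close> are both controlled by
\<open>w = \<Sum> t powr (- e i)\<close>, and \<open>A w (1 + ln t) \<le> 1\<close> keeps the truncated means below \<open>t\<close>.
\<close>

lemma block_tail:
  assumes m: "1 \<le> m" and t: "1 \<le> t" and w: "A * (\<Sum>i=m..<n. t powr (- e i)) * (1 + ln t) \<le> 1"
  shows "prob {\<omega>\<in>space M. 2 * t < \<bar>\<Sum>i=m..<n. X i \<omega>\<bar>} \<le> 2 * A * (\<Sum>i=m..<n. t powr (- e i))"
proof -
  have t0: "0 < t" using t by simp
  define \<mu> where "\<mu> i = expectation (trunc t i)" for i
  define Y where "Y i \<omega> = trunc t i \<omega> - \<mu> i" for i \<omega>
  have mu: "\<bar>\<Sum>i=m..<n. \<mu> i\<bar> \<le> t"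
  proof -
    have "\<bar>\<mu> i\<bar> \<le> t * (A * t powr (- e i) * (1 + ln t))" if i: "i \<in> {m..<n}" for i
    proof -
      have "\<bar>\<mu> i\<bar> \<le> A * t powr (1 - e i) * (if e i = 1 then 1 + ln t else 1)"
        using mean[of i t] i m t unfolding \<mu>_def trunc_def[abs_def] by simp
      also have "\<dots> \<le> A * t powr (1 - e i) * (1 + ln t)"
        using A_nonneg t by (intro mult_left_mono) auto
      also have "t powr (1 - e i) = t * t powr (- e i)" using t0 by (simp add: powr_diff powr_minus field_simps)
      finally show ?thesis by (simp add: mult_ac)
    qed
    then have "\<bar>\<Sum>i=m..<n. \<mu> i\<bar> \<le> (\<Sum>i=m..<n. t * (A * t powr (- e i) * (1 + ln t)))"
      by (intro order_trans[OF sum_abs] sum_mono) auto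
    also have "\<dots> = t * (A * (\<Sum>i=m..<n. t powr (- e i)) * (1 + ln t))"
      by (simp add: sum_distrib_left sum_distrib_right mult_ac)
    also have "\<dots> \<le> t" using w t0 mult_left_mono[OF w, of t] by simp
    finally show ?thesis .
  qed
  let ?B = "{\<omega>\<in>space M. \<exists>k\<in>{m..n}. t \<le> \<bar>\<Sum>i=m..<k. Y i \<omega>\<bar>}"
  let ?C = "\<lambda>i. {\<omega>\<in>space M. t \<le> \<bar>X i \<omega>\<bar>}"
  have Ym: "Y i \<in> borel_measurable M" if "m \<le> i" for i
    unfolding Y_def[abs_def]
    by (intro borel_measurable_diff trunc_measurable[OF le_trans[OF m that]] borel_measurable_const)
  have Bm: "?B \<in> sets M"
    by (intro sets.sets_Collect_finite_Ex) (auto intro!: borel_measurable_le borel_measurable_abs borel_measurable_sum Ym)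
  have Cm: "?C i \<in> sets M" if "m \<le> i" for i
    using X_measurable[OF le_trans[OF m that]] by measurable
  have "{\<omega>\<in>space M. 2 * t < \<bar>\<Sum>i=m..<n. X i \<omega>\<bar>} \<subseteq> ?B \<union> (\<Union>i\<in>{m..<n}. ?C i)"
  proof safe
    fix \<omega> assume w: "\<omega> \<in> space M" "2 * t < \<bar>\<Sum>i=m..<n. X i \<omega>\<bar>" "\<omega> \<notin> (\<Union>i\<in>{m..<n}. ?C i)"
    have "X i \<omega> = Y i \<omega> + \<mu> i" if "i \<in> {m..<n}" for i
    proof -
      have "\<bar>X i \<omega>\<bar> < t" using w(1,3) that by force
      then show ?thesis by (simp add: Y_def trunc_def indicator_def abs_less_iff)
    qed
    then have "(\<Sum>i=m..<n. X i \<omega>) = (\<Sum>i=m..<n. Y i \<omega>) + (\<Sum>i=m..<n. \<mu> i)"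
      by (simp add: sum.distrib)
    with w(2) mu have "t \<le> \<bar>\<Sum>i=m..<n. Y i \<omega>\<bar>" by linarith
    moreover have "m \<le> n" using w(2) t0 by (cases "m \<le> n") auto
    ultimately show "\<exists>k\<in>{m..n}. t \<le> \<bar>\<Sum>i=m..<k. Y i \<omega>\<bar>" by auto
  qed
  then have "prob {\<omega>\<in>space M. 2 * t < \<bar>\<Sum>i=m..<n. X i \<omega>\<bar>} \<le> prob (?B \<union> (\<Union>i\<in>{m..<n}. ?C i))"
    using Bm Cm by (intro finite_measure_mono) auto
  also have "\<dots> \<le> prob ?B + prob (\<Union>i\<in>{m..<n}. ?C i)"
    using Bm Cm by (intro measure_Un_le) auto
  also have "prob (\<Union>i\<in>{m..<n}. ?C i) \<le> (\<Sum>i=m..<n. prob (?C i))"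
    using Cm by (intro measure_UNION_le) auto
  also have "(\<Sum>i=m..<n. prob (?C i)) \<le> (\<Sum>i=m..<n. A * t powr (- e i))"
    using m t0 by (intro sum_mono tail) auto
  also have "prob ?B \<le> (\<Sum>i=m..<n. expectation (\<lambda>\<omega>. (Y i \<omega>)\<^sup>2)) / t\<^sup>2"
  proof (rule kolmogorov_maximal)
    show "indep_vars (\<lambda>_. borel) Y {m..<n}"
      unfolding Y_def[abs_def] trunc_def using m
      by (intro indep_vars_compose2[OF indep_vars_subset[OF indep], where Y = "\<lambda>k x. x * indicator {- t..t} x - \<mu> k"]) auto
  qed (use trunc_centered[OF _ t0] m t0 in \<open>auto simp: Y_def \<mu>_def\<close>)
  also have "(\<Sum>i=m..<n. expectation (\<lambda>\<omega>. (Y i \<omega>)\<^sup>2)) / t\<^sup>2 \<le> (\<Sum>i=m..<n. A * t powr (2 - e i)) / t\<^sup>2"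
    using trunc_centered(3)[OF _ t0] m by (intro divide_right_mono sum_mono) (auto simp: Y_def \<mu>_def)
  also have "\<dots> = (\<Sum>i=m..<n. A * t powr (- e i))"
    unfolding sum_divide_distrib using t0
    by (intro sum.cong refl) (simp add: powr_diff powr_minus powr_numeral field_simps)
  finally show ?thesis by (simp add: sum_distrib_left mult_ac)
qed

end

section \<open>Block sums on the scale of the norming\<close>

text \<open>
Two exponents occur, and \<open>\<theta> n\<close> is the scale at which the number of indices up to \<open>n\<close> with exponent
\<open>v\<close>, multiplied by \<open>ln n\<close>, is dominated by \<open>\<theta> n powr v\<close>. Thus the expected number of summands up
to \<open>n\<close> exceeding \<open>\<theta> n\<close> is of order at most \<open>1 / ln n\<close>. The constant \<open>C\<close> serves all bounds.
\<close>

locale normed_walk = power_tailed M X e A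
  for M :: "'a measure" and X :: "nat \<Rightarrow> 'a \<Rightarrow> real" and e :: "nat \<Rightarrow> real" and A :: real +
  fixes \<alpha>1 \<alpha>2 :: real and \<theta> :: "nat \<Rightarrow> real" and C :: real
  assumes exponents: "0 < \<alpha>1" "\<alpha>1 < \<alpha>2" "\<And>k. 1 \<le> k \<Longrightarrow> e k \<in> {\<alpha>1, \<alpha>2}"
    and \<theta>_nonneg: "\<And>n. 0 \<le> \<theta> n" and \<theta>_mono: "mono \<theta>"
    and \<theta>_top: "filterlim \<theta> at_top sequentially"
    and C_pos: "0 < C"
    and \<theta>_dominates: "\<And>v. v \<in> {\<alpha>1, \<alpha>2} \<Longrightarrow>
      \<forall>\<^sub>F n in sequentially. real (card {i \<in> {1..n}. e i = v}) * ln (real n) \<le> C * \<theta> n powr v"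
    and ln_\<theta>: "\<forall>\<^sub>F n in sequentially. ln (\<theta> n) \<le> C * ln (real n)"
begin

lemma \<theta>_ge: "\<forall>\<^sub>F n in sequentially. z \<le> \<theta> n"
  using \<theta>_top by (auto simp: filterlim_at_top)

lemma ln_ge: "\<forall>\<^sub>F n in sequentially. z \<le> ln (real n)"
  using filterlim_compose[OF ln_at_top filterlim_real_sequentially] by (auto simp: filterlim_at_top)

lemma exponent_cases: "Suc 0 \<le> k \<Longrightarrow> e k = \<alpha>1 \<or> e k = \<alpha>2"
  using exponents(3) by auto

lemma sum_exponents:
  fixes f :: "real \<Rightarrow> real"
  shows "(\<Sum>i=1..n. f (e i))
    = real (card {i \<in> {1..n}. e i = \<alpha>1}) * f \<alpha>1 + real (card {i \<in> {1..n}. e i = \<alpha>2}) * f \<alpha>2"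
proof -
  have "(\<Sum>i=1..n. f (e i)) = (\<Sum>i\<in>{i \<in> {1..n}. e i = \<alpha>1} \<union> {i \<in> {1..n}. e i = \<alpha>2}. f (e i))"
    by (intro sum.cong) (auto dest: exponent_cases)
  also have "\<dots> = (\<Sum>i\<in>{i \<in> {1..n}. e i = \<alpha>1}. f (e i)) + (\<Sum>i\<in>{i \<in> {1..n}. e i = \<alpha>2}. f (e i))"
    using exponents(2) by (intro sum.union_disjoint) auto
  also have "\<dots> = (\<Sum>i\<in>{i \<in> {1..n}. e i = \<alpha>1}. f \<alpha>1) + (\<Sum>i\<in>{i \<in> {1..n}. e i = \<alpha>2}. f \<alpha>2)"
    by (intro arg_cong2[where f = "(+)"] sum.cong) auto
  finally show ?thesis by simp
qed

text \<open>
The total weight of the indices up to \<open>m\<close> at the level \<open>s \<theta> m\<close>. The gain \<open>s powr (- \<alpha>1)\<close> comes from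
the smaller exponent, which gives the weaker decay for \<open>s \<ge> 1\<close>.
\<close>

lemma weights_le:
  "\<forall>\<^sub>F m in sequentially. \<forall>s\<ge>1. ln (real m) * (\<Sum>i=1..m. (s * \<theta> m) powr (- e i)) \<le> 2 * C * s powr (- \<alpha>1)"
proof -
  have "\<forall>\<^sub>F n in sequentially. real (card {i \<in> {1..n}. e i = \<alpha>1}) * ln (real n) \<le> C * \<theta> n powr \<alpha>1"
    "\<forall>\<^sub>F n in sequentially. real (card {i \<in> {1..n}. e i = \<alpha>2}) * ln (real n) \<le> C * \<theta> n powr \<alpha>2"
    by (rule \<theta>_dominates, simp)+
  then show ?thesis using \<theta>_ge[of 1]
  proof eventually_elim
    fix n assume 1: "real (card {i \<in> {1..n}. e i = \<alpha>1}) * ln (real n) \<le> C * \<theta> n powr \<alpha>1"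
      and 2: "real (card {i \<in> {1..n}. e i = \<alpha>2}) * ln (real n) \<le> C * \<theta> n powr \<alpha>2" and \<theta>: "1 \<le> \<theta> n"
    show "\<forall>s\<ge>1. ln (real n) * (\<Sum>i=1..n. (s * \<theta> n) powr (- e i)) \<le> 2 * C * s powr (- \<alpha>1)"
    proof (intro allI impI)
      fix s :: real assume s: "1 \<le> s"
      have *: "c * ln (real n) * (s * \<theta> n) powr (- v) \<le> C * s powr (- \<alpha>1)"
        if c: "c * ln (real n) \<le> C * \<theta> n powr v" and v: "\<alpha>1 \<le> v" for c v
      proof -
        have "c * ln (real n) * (s * \<theta> n) powr (- v) \<le> C * \<theta> n powr v * (s * \<theta> n) powr (- v)"
          using c by (intro mult_right_mono) auto
        also have "\<dots> = C * s powr (- v)" using s \<theta> by (simp add: powr_mult powr_minus field_simps)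
        also have "\<dots> \<le> C * s powr (- \<alpha>1)" using C_pos s v by (intro mult_left_mono powr_mono) auto
        finally show ?thesis .
      qed
      show "ln (real n) * (\<Sum>i=1..n. (s * \<theta> n) powr (- e i)) \<le> 2 * C * s powr (- \<alpha>1)"
        using *[OF 1] *[OF 2] exponents(2)
        unfolding sum_exponents[of "\<lambda>v. (s * \<theta> n) powr (- v)"] by (simp add: algebra_simps)
    qed
  qed
qed

definition class_rank :: "nat \<Rightarrow> nat" where "class_rank k = card {i \<in> {1..k}. e i = e k}"

lemma class_rank_pos: "1 \<le> k \<Longrightarrow> 1 \<le> class_rank k"
  unfolding class_rank_def by (simp add: Suc_le_eq card_gt_0_iff) (auto intro!: exI[of _ k])

lemma class_rank_le: "class_rank k \<le> k"
proof -
  have "class_rank k \<le> card {1..k}" unfolding class_rank_def by (rule card_mono) auto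
  then show ?thesis by simp
qed

text \<open>
Within each of the two classes the rank runs through the positive integers without repetition, so
the series is dominated by two copies of a convergent one. The maximum with \<open>1\<close> avoids the
vanishing logarithm at rank \<open>1\<close>, which would turn the quotient into \<open>0\<close>.
\<close>

lemma summable_class_rank:
  assumes p: "1 < p"
  shows "summable (\<lambda>k. if 1 \<le> k then 1 / (real (class_rank k) * max 1 (ln (real (class_rank k))) powr p) else 0)"
proof -
  define h where "h m = 1 / (real m * max 1 (ln (real m)) powr p)" for m :: nat
  have h0: "0 \<le> h m" for m by (simp add: h_def)
  have hs: "summable h"
  proof (rule summable_cong[THEN iffD2])
    show "eventually (\<lambda>m. h m = 1 / (real m * ln (real m) powr p)) sequentially"
      using ln_ge[of 1] by eventually_elim (simp add: h_def)
  qed (rule summable_inverse_n_ln_powr[OF p])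
  have "summable (\<lambda>k. if 1 \<le> k then h (class_rank k) else 0)"
  proof (rule summableI_nonneg_bounded)
    fix n
    have cls: "(\<Sum>k\<in>{k\<in>{1..n}. e k = v}. h (class_rank k)) \<le> suminf h" for v
    proof -
      have "(\<Sum>k\<in>{k\<in>{1..n}. e k = v}. h (class_rank k)) = (\<Sum>k\<in>{k. e k = v} \<inter> {1..n}. h (card ({k. e k = v} \<inter> {1..k})))"
        by (intro sum.cong) (auto simp: class_rank_def intro!: arg_cong[of _ _ h] arg_cong[of _ _ card])
      also have "\<dots> \<le> suminf h"
        unfolding sum_over_class using hs h0 by (intro sum_le_suminf) auto
      finally show ?thesis .
    qed
    have "(\<Sum>k<n. if 1 \<le> k then h (class_rank k) else 0) \<le> (\<Sum>k\<in>{1..n}. h (class_rank k))"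
    proof -
      have "(\<Sum>k<n. if 1 \<le> k then h (class_rank k) else 0) = (\<Sum>k\<in>{k\<in>{..<n}. 1 \<le> k}. h (class_rank k))"
        by (rule sum.inter_filter[symmetric]) simp
      also have "\<dots> \<le> (\<Sum>k\<in>{1..n}. h (class_rank k))" using h0 by (intro sum_mono2) auto
      finally show ?thesis .
    qed
    also have "\<dots> = (\<Sum>k\<in>{k\<in>{1..n}. e k = \<alpha>1} \<union> {k\<in>{1..n}. e k = \<alpha>2}. h (class_rank k))"
      by (intro sum.cong) (auto dest: exponent_cases)
    also have "\<dots> = (\<Sum>k\<in>{k\<in>{1..n}. e k = \<alpha>1}. h (class_rank k)) + (\<Sum>k\<in>{k\<in>{1..n}. e k = \<alpha>2}. h (class_rank k))"
      using exponents(2) by (intro sum.union_disjoint) auto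
    also have "\<dots> \<le> suminf h + suminf h" by (intro add_mono cls)
    finally show "(\<Sum>k<n. if 1 \<le> k then h (class_rank k) else 0) \<le> suminf h + suminf h" .
  qed (use h0 in auto)
  then show ?thesis unfolding h_def .
qed

lemma own_weight_le:
  "\<forall>\<^sub>F k in sequentially. 0 < ln (real k) \<and> \<theta> k powr (- e k) \<le> C / (real (class_rank k) * ln (real k))"
proof -
  have "\<forall>\<^sub>F n in sequentially. real (card {i \<in> {1..n}. e i = \<alpha>1}) * ln (real n) \<le> C * \<theta> n powr \<alpha>1"
    "\<forall>\<^sub>F n in sequentially. real (card {i \<in> {1..n}. e i = \<alpha>2}) * ln (real n) \<le> C * \<theta> n powr \<alpha>2"
    by (rule \<theta>_dominates, simp)+
  then show ?thesis using \<theta>_ge[of 1] ln_ge[of 1] eventually_ge_at_top[of 1]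
  proof eventually_elim
    case (elim k)
    then have "real (class_rank k) * ln (real k) \<le> C * \<theta> k powr e k" using exponents(3)[of k] by (auto simp: class_rank_def)
    moreover have lnk: "0 < ln (real k)" using elim by linarith
    moreover have "0 < real (class_rank k) * ln (real k)" using class_rank_pos[of k] elim lnk by (intro mult_pos_pos) linarith+
    moreover have "0 < \<theta> k powr e k" using elim by simp
    ultimately have "\<theta> k powr (- e k) \<le> C / (real (class_rank k) * ln (real k))"
      by (simp add: powr_minus divide_simps mult.commute)
    with lnk show ?case by blast
  qed
qed

lemma class_rank_summand_le:
  assumes p: "0 \<le> p"
  shows "\<forall>\<^sub>F k in sequentially. 1 / (real (class_rank k) * ln (real k) powr p) \<le> 1 / (real (class_rank k) * max 1 (ln (real (class_rank k))) powr p)"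
  using ln_ge[of 1] eventually_ge_at_top[of 1]
proof eventually_elim
  case (elim k)
  have r: "1 \<le> class_rank k" "class_rank k \<le> k" using class_rank_pos class_rank_le elim by auto
  then have "ln (real (class_rank k)) \<le> ln (real k)" by simp
  then have "max 1 (ln (real (class_rank k))) powr p \<le> ln (real k) powr p"
    using elim p by (intro powr_mono2) auto
  then show ?case using r by (intro divide_left_mono mult_left_mono mult_pos_pos) auto
qed

text \<open>
The strong law with norming \<open>b n = \<theta> n (ln n) powr \<delta>\<close>: the additional power of the logarithm makes
the weights \<open>b k powr (- e k)\<close> summable, by comparison with
\<open>1 / (m (ln m) powr (1 + \<delta> \<alpha>1))\<close> along each class.
\<close>

lemma partial_sum_limit:
  assumes \<delta>: "0 < \<delta>"
  shows "AE \<omega> in M. (\<lambda>n. partial_sum X n \<omega> / (\<theta> n * ln (real n) powr \<delta>)) \<longlonglongrightarrow> 0"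
proof -
  define b where "b n = max 1 (\<theta> n * ln (real n) powr \<delta>)" for n
  have ln_mono': "ln (real m) \<le> ln (real n)" if "m \<le> n" for m n using that by (cases "m = 0"; cases "n = 0") auto
  have ln_nn: "0 \<le> ln (real n)" for n by (cases "n = 0") auto
  have b_eq: "\<forall>\<^sub>F n in sequentially. b n = \<theta> n * ln (real n) powr \<delta> \<and> \<theta> n \<le> b n"
    using \<theta>_ge[of 1] ln_ge[of 1]
  proof eventually_elim
    case (elim n)
    have "1 \<le> ln (real n) powr \<delta>" using elim \<delta> by (intro ge_one_powr_ge_zero) auto
    then have "\<theta> n * 1 \<le> \<theta> n * ln (real n) powr \<delta>" using elim by (intro mult_left_mono) auto
    then have "\<theta> n \<le> \<theta> n * ln (real n) powr \<delta>" "1 \<le> \<theta> n * ln (real n) powr \<delta>" using elim by linarith+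
    then show ?case by (simp add: b_def)
  qed
  have "AE \<omega> in M. (\<lambda>n. partial_sum X n \<omega> / b n) \<longlonglongrightarrow> 0"
  proof (rule strong_law)
    show "mono b"
    proof (rule monoI)
      fix m n :: nat assume "m \<le> n"
      then have "\<theta> m * ln (real m) powr \<delta> \<le> \<theta> n * ln (real n) powr \<delta>"
        using \<theta>_mono \<theta>_nonneg ln_mono'[of m n] ln_nn[of m] \<delta>
        by (intro mult_mono powr_mono2) (auto dest: monoD)
      then show "b m \<le> b n" by (auto simp: b_def)
    qed
    show "1 \<le> b n" for n by (simp add: b_def)
    show "filterlim b at_top sequentially"
      by (rule filterlim_at_top_mono[OF \<theta>_top]) (use b_eq in \<open>auto elim: eventually_mono\<close>)
    show "summable (\<lambda>k. b k powr (- e k))"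
    proof (rule summable_comparison_test_ev)
      have p: "0 \<le> 1 + \<delta> * \<alpha>1" "1 < 1 + \<delta> * \<alpha>1" using \<delta> exponents by auto
      show "summable (\<lambda>k. C * (if 1 \<le> k then 1 / (real (class_rank k) * max 1 (ln (real (class_rank k))) powr (1 + \<delta> * \<alpha>1)) else 0))"
        by (intro summable_mult summable_class_rank p)
      show "\<forall>\<^sub>F k in sequentially. norm (b k powr (- e k))
          \<le> C * (if 1 \<le> k then 1 / (real (class_rank k) * max 1 (ln (real (class_rank k))) powr (1 + \<delta> * \<alpha>1)) else 0)"
        using b_eq own_weight_le class_rank_summand_le[OF p(1)] ln_ge[of 1] eventually_ge_at_top[of 1] \<theta>_ge[of 1]
      proof eventually_elim
        case (elim k)
        have ek: "\<alpha>1 \<le> e k" using exponents(2) exponents(3)[of k] elim by auto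
        have c0: "0 \<le> C / (real (class_rank k) * ln (real k))" using C_pos elim by simp
        have "b k powr (- e k) = \<theta> k powr (- e k) * (ln (real k) powr \<delta>) powr (- e k)"
          using elim by (simp add: powr_mult)
        also have "(ln (real k) powr \<delta>) powr (- e k) = ln (real k) powr (- (\<delta> * e k))" by (simp add: powr_powr)
        also have "\<theta> k powr (- e k) * ln (real k) powr (- (\<delta> * e k))
            \<le> C / (real (class_rank k) * ln (real k)) * ln (real k) powr (- (\<delta> * \<alpha>1))"
          using elim ek \<delta> c0 by (intro mult_mono powr_mono) auto
        also have "\<dots> = C * (1 / (real (class_rank k) * ln (real k) powr (1 + \<delta> * \<alpha>1)))"
          using elim by (simp add: powr_add powr_minus field_simps)
        also have "\<dots> \<le> C * (1 / (real (class_rank k) * max 1 (ln (real (class_rank k))) powr (1 + \<delta> * \<alpha>1)))"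
          using elim C_pos by (intro mult_left_mono) auto
        finally show ?case using elim by simp
      qed
    qed
    show "(\<lambda>n. (1 + ln (b n)) * (\<Sum>k=1..n. b n powr (- e k))) \<longlonglongrightarrow> 0"
    proof (rule Lim_null_comparison)
      show "\<forall>\<^sub>F n in sequentially. norm ((1 + ln (b n)) * (\<Sum>k=1..n. b n powr (- e k)))
          \<le> (1 + C + \<delta>) * (2 * C) * ln (real n) powr (- (\<delta> * \<alpha>1))"
        using b_eq weights_le ln_\<theta> ln_ge[of 1] \<theta>_ge[of 1] eventually_ge_at_top[of 1]
      proof eventually_elim
        case (elim n)
        define l where "l = ln (real n)"
        define W where "W = (\<Sum>k=1..n. b n powr (- e k))"
        have l: "1 \<le> l" using elim by (simp add: l_def)
        have "1 \<le> l powr \<delta>" using l \<delta> by (intro ge_one_powr_ge_zero) auto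
        then have "ln (real n) * (\<Sum>i=1..n. (l powr \<delta> * \<theta> n) powr (- e i)) \<le> 2 * C * (l powr \<delta>) powr (- \<alpha>1)"
          using elim by blast
        then have W: "l * W \<le> 2 * C * l powr (- (\<delta> * \<alpha>1))" using elim by (simp add: l_def W_def powr_powr mult.commute)
        have W0: "0 \<le> W" by (auto simp: W_def intro: sum_nonneg)
        have "ln (b n) = ln (\<theta> n) + \<delta> * ln l"
        proof -
          have "b n = \<theta> n * l powr \<delta>" using elim by (simp add: l_def)
          moreover have "ln (\<theta> n * l powr \<delta>) = ln (\<theta> n) + ln (l powr \<delta>)"
            using elim l by (intro ln_mult_pos) auto
          ultimately show ?thesis by (simp add: ln_powr)
        qed
        also have "\<dots> \<le> C * l + \<delta> * l"
        proof -
          have "ln l \<le> l" using ln_le_minus_one[of l] l by linarith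
          then show ?thesis using elim \<delta> by (intro add_mono mult_left_mono) (auto simp: l_def)
        qed
        finally have "1 + ln (b n) \<le> (1 + C + \<delta>) * l" using l by (simp add: algebra_simps)
        moreover have "0 \<le> ln (b n)" by (simp add: b_def)
        ultimately have "norm ((1 + ln (b n)) * W) \<le> (1 + C + \<delta>) * l * W" using W0 by (simp add: mult_right_mono)
        also have "\<dots> = (1 + C + \<delta>) * (l * W)" by simp
        also have "\<dots> \<le> (1 + C + \<delta>) * (2 * C * l powr (- (\<delta> * \<alpha>1)))" using C_pos \<delta> W by (intro mult_left_mono) auto
        finally show ?case by (simp add: W_def l_def)
      qed
      have "0 < \<delta> * \<alpha>1" using \<delta> exponents by simp
      then show "(\<lambda>n. (1 + C + \<delta>) * (2 * C) * ln (real n) powr (- (\<delta> * \<alpha>1))) \<longlonglongrightarrow> 0"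
        by real_asymp
    qed
  qed
  then show ?thesis
  proof eventually_elim
    fix \<omega> assume "(\<lambda>n. partial_sum X n \<omega> / b n) \<longlonglongrightarrow> 0"
    then show "(\<lambda>n. partial_sum X n \<omega> / (\<theta> n * ln (real n) powr \<delta>)) \<longlonglongrightarrow> 0"
      by (rule Lim_transform_eventually) (use b_eq in \<open>auto elim: eventually_mono\<close>)
  qed
qed

text \<open>
\<open>L n\<close> is the admissible order of the random lengths. A block is the difference of two partial sums,
and by regularity the norming at its end is comparable to the norming at its beginning.
\<close>

theorem block_upper:
  assumes \<delta>: "0 < \<delta>" and L: "\<And>n. L n \<le> real n"
    and regular: "\<And>N::nat. \<exists>C'\<ge>1. \<forall>\<^sub>F n in sequentially. \<forall>m. real m \<le> real n + real N * L n \<longrightarrow> \<theta> m \<le> C' * \<theta> n"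
    and a: "AE \<omega> in M. \<exists>N::nat. \<forall>\<^sub>F n in sequentially. real (a n \<omega>) \<le> real N * L n"
  shows "AE \<omega> in M. (\<lambda>n. random_block_sum X a n \<omega> / (\<theta> n * ln (real n) powr \<delta>)) \<longlonglongrightarrow> 0"
  using partial_sum_limit[OF \<delta>] a
proof eventually_elim
  fix \<omega> assume lim: "(\<lambda>n. partial_sum X n \<omega> / (\<theta> n * ln (real n) powr \<delta>)) \<longlonglongrightarrow> 0"
    and "\<exists>N::nat. \<forall>\<^sub>F n in sequentially. real (a n \<omega>) \<le> real N * L n"
  then obtain N :: nat where N: "\<forall>\<^sub>F n in sequentially. real (a n \<omega>) \<le> real N * L n" by blast
  obtain C' where C': "1 \<le> C'" and reg: "\<forall>\<^sub>F n in sequentially. \<forall>m. real m \<le> real n + real N * L n \<longrightarrow> \<theta> m \<le> C' * \<theta> n"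
    using regular by blast
  show "(\<lambda>n. random_block_sum X a n \<omega> / (\<theta> n * ln (real n) powr \<delta>)) \<longlonglongrightarrow> 0"
  proof (rule LIMSEQ_I)
    fix r :: real assume r: "0 < r"
    define c where "c = C' * 2 powr \<delta> + 1"
    define \<epsilon> where "\<epsilon> = r / (2 * c)"
    have c: "0 < c" using C' by (simp add: c_def add_pos_pos)
    have \<epsilon>: "0 < \<epsilon>" using r c by (simp add: \<epsilon>_def)
    obtain n0 where n0: "\<And>n. n0 \<le> n \<Longrightarrow> \<bar>partial_sum X n \<omega> / (\<theta> n * ln (real n) powr \<delta>)\<bar> < \<epsilon>"
      using LIMSEQ_D[OF lim \<epsilon>] by auto
    obtain n1 where n1: "\<And>n. n1 \<le> n \<Longrightarrow> 1 \<le> \<theta> n \<and> 1 \<le> ln (real n)"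
      using eventually_conj[OF \<theta>_ge[of 1] ln_ge[of 1]] by (auto simp: eventually_sequentially)
    have S: "\<bar>partial_sum X n \<omega>\<bar> \<le> \<epsilon> * (\<theta> n * ln (real n) powr \<delta>)" if "max n0 n1 \<le> n" for n
    proof -
      have "0 < \<theta> n * ln (real n) powr \<delta>" using n1[of n] that by auto
      then show ?thesis using n0[of n] that by (simp add: field_simps)
    qed
    have "\<forall>\<^sub>F n in sequentially. norm (random_block_sum X a n \<omega> / (\<theta> n * ln (real n) powr \<delta>) - 0) < r"
      using N reg eventually_ge_at_top[of "max n0 n1"] eventually_ge_at_top[of "N + 1"]
    proof eventually_elim
      case (elim n)
      let ?\<beta> = "\<theta> n * ln (real n) powr \<delta>"
      define m where "m = n + a n \<omega>"
      have nn: "1 \<le> \<theta> n" "1 \<le> ln (real n)" using n1[of n] elim by auto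
      have n0': "0 < real n" using elim by simp
      have mn: "real m \<le> real n + real N * L n" using elim by (simp add: m_def)
      have "real m \<le> real n + real N * real n" using mn mult_left_mono[OF L[of n], of "real N"] by linarith
      also have "\<dots> = real (N + 1) * real n" by (simp add: algebra_simps)
      also have "\<dots> \<le> real n * real n" using elim by (intro mult_right_mono) auto
      finally have "ln (real m) \<le> ln (real n * real n)" using n0' by (subst ln_le_cancel_iff) (auto simp: m_def)
      then have lnm: "ln (real m) \<le> 2 * ln (real n)" using n0' by (simp add: ln_mult)
      have lnm0: "0 \<le> ln (real m)" using n0' by (simp add: m_def)
      have "\<theta> m * ln (real m) powr \<delta> \<le> C' * \<theta> n * (2 * ln (real n)) powr \<delta>"
        using elim mn lnm lnm0 \<delta> \<theta>_nonneg C' by (intro mult_mono powr_mono2) auto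
      also have "\<dots> = C' * 2 powr \<delta> * ?\<beta>" using nn by (simp add: powr_mult)
      finally have bm: "\<theta> m * ln (real m) powr \<delta> \<le> C' * 2 powr \<delta> * ?\<beta>" .
      have "\<bar>random_block_sum X a n \<omega>\<bar> \<le> \<bar>partial_sum X m \<omega>\<bar> + \<bar>partial_sum X n \<omega>\<bar>"
        by (simp add: random_block_sum_def m_def)
      also have "\<dots> \<le> \<epsilon> * (\<theta> m * ln (real m) powr \<delta>) + \<epsilon> * ?\<beta>"
        using elim by (intro add_mono S) (auto simp: m_def)
      also have "\<dots> \<le> \<epsilon> * (C' * 2 powr \<delta> * ?\<beta>) + \<epsilon> * ?\<beta>"
        using bm \<epsilon> \<theta>_nonneg[of n] by (intro add_mono mult_left_mono) auto
      also have "\<dots> = \<epsilon> * c * ?\<beta>" by (simp add: c_def algebra_simps)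
      also have "\<epsilon> * c = r / 2" using c by (simp add: \<epsilon>_def)
      finally have T: "\<bar>random_block_sum X a n \<omega>\<bar> \<le> r / 2 * ?\<beta>" .
      have \<beta>: "0 < ?\<beta>" using nn by auto
      have "r / 2 * ?\<beta> < r * ?\<beta>" using r \<beta> by simp
      with T have "\<bar>random_block_sum X a n \<omega>\<bar> < r * ?\<beta>" by linarith
      then show ?case using \<beta> nn by (simp add: pos_divide_less_eq abs_mult)
    qed
    then show "\<exists>no. \<forall>n\<ge>no. norm (random_block_sum X a n \<omega> / (\<theta> n * ln (real n) powr \<delta>) - 0) < r"
      by (simp add: eventually_sequentially)
  qed
qed

end

lemma (in prob_space) indep_of_sequence_prob:
  assumes ind: "indep_of_sequence M N X" and Q: "Q \<in> sets (Pi\<^sub>M {1..} (\<lambda>_. borel))"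
    and X: "\<And>k. 1 \<le> k \<Longrightarrow> X k \<in> borel_measurable M"
  shows "prob {\<omega>\<in>space M. N \<omega> = j \<and> (\<lambda>k\<in>{1..}. X k \<omega>) \<in> Q}
    = prob {\<omega>\<in>space M. N \<omega> = j} * prob {\<omega>\<in>space M. (\<lambda>k\<in>{1..}. X k \<omega>) \<in> Q}"
proof -
  let ?a = "N -` {j} \<inter> space M" and ?b = "(\<lambda>\<omega>. \<lambda>k\<in>{1..}. X k \<omega>) -` Q \<inter> space M"
  have "?a \<in> sets (vimage_algebra (space M) N (count_space UNIV))"
    by (rule in_vimage_algebra) simp
  moreover have "?b \<in> sets (vimage_algebra (space M) (\<lambda>\<omega>. \<lambda>k\<in>{1..}. X k \<omega>) (Pi\<^sub>M {1..} (\<lambda>_. borel)))"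
    by (rule in_vimage_algebra[OF Q])
  ultimately have "prob (?a \<inter> ?b) = prob ?a * prob ?b"
    using ind unfolding indep_of_sequence_def by (rule indep_setD[rotated])
  moreover have "?a \<inter> ?b = {\<omega>\<in>space M. N \<omega> = j \<and> (\<lambda>k\<in>{1..}. X k \<omega>) \<in> Q}" by auto
  moreover have "?a = {\<omega>\<in>space M. N \<omega> = j}" "?b = {\<omega>\<in>space M. (\<lambda>k\<in>{1..}. X k \<omega>) \<in> Q}" by auto
  ultimately show ?thesis by simp
qed

lemma random_block_sum_eq: "random_block_sum X a n \<omega> = (\<Sum>i=Suc n..<Suc n + a n \<omega>. X i \<omega>)"
proof -
  have "(\<Sum>k=1..n + a n \<omega>. X k \<omega>) = (\<Sum>k=1..n. X k \<omega>) + (\<Sum>k=n+1..n + a n \<omega>. X k \<omega>)"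
    by (rule sum.ub_add_nat) simp
  then show ?thesis
    unfolding random_block_sum_def partial_sum_def by (simp add: atLeastLessThanSuc_atLeastAtMost)
qed

text \<open>
Along an infinite class the count takes every positive integer value, so this series runs through
all terms of the divergent series of \<open>1 / (m ln m)\<close>.
\<close>

lemma not_summable_class:
  assumes D: "filterlim (\<lambda>n. card (D \<inter> {1..n})) at_top sequentially"
  shows "\<not> summable (\<lambda>k. if k \<in> D \<inter> {1..} then 1 / (real (card (D \<inter> {1..k})) * ln (real (card (D \<inter> {1..k})))) else 0)"
proof
  define \<tau> where "\<tau> n = card (D \<inter> {1..n})" for n
  define f where "f m = 1 / (real m * ln (real m))" for m :: nat
  define p where "p k = (if k \<in> D \<inter> {1..} then f (\<tau> k) else 0)" for k
  have f0: "0 \<le> f m" for m by (cases "m = 0") (auto simp: f_def)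
  have p0: "0 \<le> p k" for k by (auto simp: p_def f0)
  assume "summable (\<lambda>k. if k \<in> D \<inter> {1..} then 1 / (real (card (D \<inter> {1..k})) * ln (real (card (D \<inter> {1..k})))) else 0)"
  then have ps: "summable p" unfolding p_def[abs_def] f_def \<tau>_def .
  have "summable f"
  proof (rule summableI_nonneg_bounded[OF f0])
    fix m
    obtain n where n: "m \<le> \<tau> n"
      using D by (auto simp: filterlim_at_top \<tau>_def eventually_sequentially)
    have "(\<Sum>i<m. f i) \<le> (\<Sum>i=1..\<tau> n. f i)"
    proof -
      have "(\<Sum>i<m. f i) \<le> (\<Sum>i\<in>insert 0 {1..\<tau> n}. f i)" using f0 n by (intro sum_mono2) auto
      then show ?thesis by (simp add: f_def)
    qed
    also have "\<dots> = (\<Sum>k\<in>D \<inter> {1..n}. f (\<tau> k))" unfolding \<tau>_def by (rule sum_over_class[symmetric])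
    also have "\<dots> = (\<Sum>k\<in>D \<inter> {1..n}. p k)" by (intro sum.cong) (auto simp: p_def)
    also have "\<dots> \<le> suminf p" using ps p0 by (intro sum_le_suminf) auto
    finally show "(\<Sum>i<m. f i) \<le> suminf p" .
  qed
  then show False using not_summable_inverse_n_ln by (simp add: f_def[abs_def])
qed

context normed_walk
begin

text \<open>
As \<open>\<theta> k powr \<alpha>\<close> is at most of the order \<open>\<tau>(k) ln k\<close> and \<open>ln k\<close> of the order
\<open>ln \<tau>(k)\<close>, a member of the class \<open>D\<close> exceeds
\<open>K \<theta> k\<close> with probability at least of the order \<open>1 / (\<tau>(k) ln \<tau>(k))\<close>, for every \<open>K\<close>; the second
Borel-Cantelli lemma applies.
\<close>

lemma large_terms:
  fixes D :: "nat set"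
  defines "\<tau> \<equiv> \<lambda>n. card (D \<inter> {1..n})"
  assumes \<kappa>: "0 < \<kappa>" and K: "0 < K" and \<alpha>: "0 < \<alpha>"
    and lower: "\<And>k u. k \<in> D \<inter> {1..} \<Longrightarrow> x0 \<le> u \<Longrightarrow> \<kappa> * u powr (- \<alpha>) \<le> prob {\<omega>\<in>space M. u < \<bar>X k \<omega>\<bar>}"
    and \<tau>_top: "filterlim \<tau> at_top sequentially" and C2: "0 < C2"
    and tight: "\<forall>\<^sub>F n in sequentially. \<theta> n powr \<alpha> \<le> C2 * real (\<tau> n) * ln (real n)"
    and ln_\<tau>: "\<forall>\<^sub>F n in sequentially. ln (real n) \<le> C2 * ln (real (\<tau> n))"
  shows "AE \<omega> in M. \<exists>\<^sub>\<infinity>k. k \<in> D \<inter> {1..} \<and> K * \<theta> k < \<bar>X k \<omega>\<bar>"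
proof -
  define S where "S k = (if k \<in> D then {x. K * \<theta> k < \<bar>x\<bar>} else {})" for k
  have "AE \<omega> in M. \<exists>\<^sub>\<infinity>k. k \<in> {1..} \<and> X k \<omega> \<in> S k"
  proof (rule borel_cantelli_indep[OF indep])
    show "S k \<in> sets borel" for k unfolding S_def by auto
    show "\<not> summable (\<lambda>k. if k \<in> {1..} then prob {\<omega>\<in>space M. X k \<omega> \<in> S k} else 0)"
    proof
      assume "summable (\<lambda>k. if k \<in> {1..} then prob {\<omega>\<in>space M. X k \<omega> \<in> S k} else 0)"
      then have "summable (\<lambda>k. C2 * C2 * K powr \<alpha> / \<kappa> * (if k \<in> {1..} then prob {\<omega>\<in>space M. X k \<omega> \<in> S k} else 0))"
        by (rule summable_mult)
      moreover have "\<forall>\<^sub>F k in sequentially. norm (if k \<in> D \<inter> {1..} then 1 / (real (card (D \<inter> {1..k})) * ln (real (card (D \<inter> {1..k})))) else 0)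
         \<le> C2 * C2 * K powr \<alpha> / \<kappa> * (if k \<in> {1..} then prob {\<omega>\<in>space M. X k \<omega> \<in> S k} else 0)"
        using tight ln_\<tau> \<theta>_ge[of "max 1 (x0 / K)"] ln_ge[of 1]
      proof eventually_elim
        case (elim k)
        show ?case
        proof (cases "k \<in> D \<inter> {1..}")
          case True
          have \<theta>k: "1 \<le> \<theta> k" "x0 \<le> K * \<theta> k" using elim K by (auto simp: field_simps)
          have ln\<tau>: "0 < ln (real (\<tau> k))" 
          proof -
            have "0 < C2 * ln (real (\<tau> k))" using elim by linarith
            then show ?thesis using C2 by (simp add: zero_less_mult_iff)
          qed
          have \<tau>0: "0 < real (\<tau> k)" using ln\<tau> by (cases "\<tau> k = 0") auto
          have "\<theta> k powr \<alpha> \<le> C2 * real (\<tau> k) * ln (real k)" using elim by simp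
          also have "\<dots> \<le> C2 * real (\<tau> k) * (C2 * ln (real (\<tau> k)))" using elim C2 \<tau>0 by (intro mult_left_mono) auto
          finally have "\<theta> k powr \<alpha> \<le> C2 * C2 * (real (\<tau> k) * ln (real (\<tau> k)))" by (simp add: mult_ac)
          then have "1 / (real (\<tau> k) * ln (real (\<tau> k))) \<le> C2 * C2 * \<theta> k powr (- \<alpha>)"
            using \<theta>k \<tau>0 ln\<tau> by (simp add: powr_minus field_simps)
          also have "\<dots> = C2 * C2 * K powr \<alpha> / \<kappa> * (\<kappa> * (K * \<theta> k) powr (- \<alpha>))"
            using \<theta>k K \<kappa> by (simp add: powr_mult powr_minus field_simps)
          also have "\<dots> \<le> C2 * C2 * K powr \<alpha> / \<kappa> * prob {\<omega>\<in>space M. K * \<theta> k < \<bar>X k \<omega>\<bar>}"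
            using C2 \<kappa> True \<theta>k by (intro mult_left_mono lower) auto
          finally show ?thesis using True \<tau>0 ln\<tau> by (simp add: S_def \<tau>_def)
        next
          case False
          have "0 \<le> C2 * C2 * K powr \<alpha> / \<kappa> * (if k \<in> {1..} then prob {\<omega>\<in>space M. X k \<omega> \<in> S k} else 0)"
            using C2 \<kappa> by simp
          then show ?thesis by (subst if_not_P[OF False]) simp
        qed
      qed
      ultimately have "summable (\<lambda>k. if k \<in> D \<inter> {1..} then 1 / (real (card (D \<inter> {1..k})) * ln (real (card (D \<inter> {1..k})))) else 0)"
        by (rule summable_comparison_test_ev[rotated])
      then show False using not_summable_class \<tau>_top unfolding \<tau>_def by blast
    qed
  qed
  then show ?thesis
  proof eventually_elim
    fix \<omega> assume "\<exists>\<^sub>\<infinity>k. k \<in> {1..} \<and> X k \<omega> \<in> S k"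
    then show "\<exists>\<^sub>\<infinity>k. k \<in> D \<inter> {1..} \<and> K * \<theta> k < \<bar>X k \<omega>\<bar>"
      by (rule INFM_mono) (auto simp: S_def split: if_splits)
  qed
qed

text \<open>
A large first term of a block is almost surely not cancelled by the rest, apart from finitely many
exceptions. For a fixed block length the first term and the rest are independent, and the
rest is large with probability of order \<open>1 / ln n\<close>, uniformly in the admissible lengths. As the single
length \<open>a n\<close> is independent of the sequence, the exceptional event has probability of order at most
\<open>1 / (rank (ln n)\<^sup>2)\<close>, and the first Borel-Cantelli lemma, valid for dependent events, applies.
The constant \<open>K\<close> must be large relative to the lengths: the truncated means of the rest
may be of the order \<open>\<theta> n\<close> itself when an exponent equals \<open>1\<close>.
\<close>

lemma rest_of_block:
  fixes N :: nat
  assumes a_meas: "\<And>n. 1 \<le> n \<Longrightarrow> a n \<in> measurable M (count_space UNIV)"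
    and a_pos: "\<And>n \<omega>. 1 \<le> n \<Longrightarrow> \<omega> \<in> space M \<Longrightarrow> 0 < a n \<omega>"
    and a_ind: "\<And>n. 1 \<le> n \<Longrightarrow> indep_of_sequence M (a n) X"
    and C': "1 \<le> C'"
    and regular: "\<forall>\<^sub>F n in sequentially. \<forall>m. real m \<le> real n + real N * L n \<longrightarrow> \<theta> m \<le> C' * \<theta> n"
  shows "\<exists>K0\<ge>1. \<forall>K\<ge>K0. AE \<omega> in M. \<forall>\<^sub>F n in sequentially.
     real (a n \<omega>) \<le> real N * L n \<longrightarrow> K * \<theta> (Suc n) < \<bar>X (Suc n) \<omega>\<bar> \<longrightarrow>
     K * \<theta> (Suc n) / 2 \<le> \<bar>random_block_sum X a n \<omega>\<bar>"
proof -
  \<comment> \<open>The factor by which the truncation level has to exceed the scale of the block in order to make the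
      truncated means small, as required by \<open>block_tail\<close>.\<close>
  define s where "s = max 1 ((2 * A * C * (C + 1)) powr (1 / \<alpha>1))"
  have s: "1 \<le> s" by (simp add: s_def)
  have s\<alpha>: "2 * A * C * (C + 1) * s powr (- \<alpha>1) \<le> 1"
  proof -
    have nn: "0 \<le> 2 * A * C * (C + 1)" using A_nonneg C_pos by simp
    have "2 * A * C * (C + 1) = ((2 * A * C * (C + 1)) powr (1 / \<alpha>1)) powr \<alpha>1"
      using nn exponents by (simp add: powr_powr)
    also have "\<dots> \<le> s powr \<alpha>1" using exponents by (intro powr_mono2) (auto simp: s_def)
    finally show ?thesis using s by (simp add: powr_minus field_simps)
  qed
  have "1 \<le> s powr \<alpha>1" using s exponents by (intro ge_one_powr_ge_zero) auto
  then have s1: "s powr (- \<alpha>1) \<le> 1" by (simp add: powr_minus inverse_le_1_iff)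
  show ?thesis
  proof (intro exI[of _ "4 * C' * s"] conjI allI impI)
    show "1 \<le> 4 * C' * s" using C' s mult_mono[of 1 C' 1 s] by simp
    fix K assume K: "4 * C' * s \<le> K"
    have K1: "1 \<le> K" using K \<open>1 \<le> 4 * C' * s\<close> by simp
    \<comment> \<open>\<open>J\<close>: admissible lengths; \<open>P\<close>: the first term is large; \<open>R\<close>: the rest of the block is large;
        \<open>F\<close>: cancellation is possible.\<close>
    define J where "J n = {j. 1 \<le> j \<and> real j \<le> real N * L n}" for n
    have J_fin: "finite (J n)" for n
      by (rule finite_subset[of _ "{..nat \<lfloor>real N * L n\<rfloor>}"]) (auto simp: J_def le_nat_floor)
    define P where "P n = {\<omega>\<in>space M. K * \<theta> (Suc n) < \<bar>X (Suc n) \<omega>\<bar>}" for n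
    define R where "R n j = {\<omega>\<in>space M. K * \<theta> (Suc n) / 2 < \<bar>\<Sum>i=Suc (Suc n)..<Suc n + j. X i \<omega>\<bar>}" for n j
    define F where "F n = (\<Union>j\<in>J n. {\<omega>\<in>space M. a n \<omega> = j} \<inter> (P n \<inter> R n j))" for n
    have am[measurable]: "{\<omega>\<in>space M. a n \<omega> = j} \<in> sets M" if "1 \<le> n" for n j
      using measurable_sets[OF a_meas[OF that], of "{j}"] by (simp add: vimage_def Int_def conj_commute)
    have Pm: "P n \<in> sets M" for n unfolding P_def using X_measurable[of "Suc n"] by measurable
    have Rm: "R n j \<in> sets M" for n j
    proof -
      have [measurable]: "(\<lambda>\<omega>. \<Sum>i=Suc (Suc n)..<Suc n + j. X i \<omega>) \<in> borel_measurable M"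
        by (intro borel_measurable_sum X_measurable) auto
      show ?thesis unfolding R_def by measurable
    qed
    have Fm: "F n \<in> sets M" if "1 \<le> n" for n
      unfolding F_def using J_fin[of n] am[OF that] Pm Rm by (intro sets.finite_UN) auto
    have PR: "prob (P n \<inter> R n j) = prob (P n) * prob (R n j)" for n j
    proof -
      have "indep_var borel (X (Suc n)) borel (\<lambda>\<omega>. \<Sum>i\<in>{Suc (Suc n)..<Suc n + j}. X i \<omega>)"
        by (intro indep_vars_sum indep_vars_subset[OF indep]) auto
      from prob_indep_random_variable[OF this, of "{x. K * \<theta> (Suc n) < \<bar>x\<bar>}" "{x. K * \<theta> (Suc n) / 2 < \<bar>x\<bar>}"]
      show ?thesis by (simp add: P_def R_def Int_def conj_ac)
    qed
    have F_le: "prob (F n) \<le> prob (P n) * r"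
      if n: "1 \<le> n" and r: "\<And>j. j \<in> J n \<Longrightarrow> prob (R n j) \<le> r" "0 \<le> r" for n r
    proof -
      have each: "prob ({\<omega>\<in>space M. a n \<omega> = j} \<inter> (P n \<inter> R n j)) = prob {\<omega>\<in>space M. a n \<omega> = j} * prob (P n \<inter> R n j)" for j
      proof -
        let ?Q = "{f \<in> space (Pi\<^sub>M {1..} (\<lambda>_. borel :: real measure)). K * \<theta> (Suc n) < \<bar>f (Suc n)\<bar> \<and>
            K * \<theta> (Suc n) / 2 < \<bar>\<Sum>i=Suc (Suc n)..<Suc n + j. f i\<bar>}"
        have [measurable]: "(\<lambda>f. f (Suc n)) \<in> borel_measurable (Pi\<^sub>M {1..} (\<lambda>_. borel :: real measure))"
          "(\<lambda>f. \<Sum>i=Suc (Suc n)..<Suc n + j. f i) \<in> borel_measurable (Pi\<^sub>M {1..} (\<lambda>_. borel :: real measure))"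
          by (intro borel_measurable_sum measurable_component_singleton; simp)+
        have "?Q \<in> sets (Pi\<^sub>M {1..} (\<lambda>_. borel))" by measurable
        note indep_event = indep_of_sequence_prob[OF a_ind[OF n] this X_measurable, of j]
        have Q_iff: "(\<lambda>k\<in>{1..}. X k \<omega>) \<in> ?Q \<longleftrightarrow> K * \<theta> (Suc n) < \<bar>X (Suc n) \<omega>\<bar> \<and>
            K * \<theta> (Suc n) / 2 < \<bar>\<Sum>i=Suc (Suc n)..<Suc n + j. X i \<omega>\<bar>" for \<omega>
        proof -
          have "(\<Sum>i=Suc (Suc n)..<Suc n + j. (\<lambda>k\<in>{1..}. X k \<omega>) i) = (\<Sum>i=Suc (Suc n)..<Suc n + j. X i \<omega>)"
            by (intro sum.cong) auto
          then show ?thesis by (simp add: space_PiM del: sum.op_ivl_Suc)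
        qed
        have "{\<omega>\<in>space M. a n \<omega> = j \<and> (\<lambda>k\<in>{1..}. X k \<omega>) \<in> ?Q} = {\<omega>\<in>space M. a n \<omega> = j} \<inter> (P n \<inter> R n j)"
          "{\<omega>\<in>space M. (\<lambda>k\<in>{1..}. X k \<omega>) \<in> ?Q} = P n \<inter> R n j"
          unfolding Q_iff P_def R_def by auto
        then show ?thesis using indep_event by simp
      qed
      have "prob (F n) \<le> (\<Sum>j\<in>J n. prob ({\<omega>\<in>space M. a n \<omega> = j} \<inter> (P n \<inter> R n j)))"
        unfolding F_def using J_fin am[OF n] Pm Rm by (intro measure_UNION_le) auto
      also have "\<dots> \<le> (\<Sum>j\<in>J n. prob {\<omega>\<in>space M. a n \<omega> = j} * (prob (P n) * r))"
        unfolding each PR using r by (intro sum_mono mult_left_mono) auto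
      also have "\<dots> = (\<Sum>j\<in>J n. prob {\<omega>\<in>space M. a n \<omega> = j}) * (prob (P n) * r)"
        by (simp add: sum_distrib_right)
      also have "(\<Sum>j\<in>J n. prob {\<omega>\<in>space M. a n \<omega> = j}) = prob (\<Union>j\<in>J n. {\<omega>\<in>space M. a n \<omega> = j})"
        using J_fin am[OF n] by (intro finite_measure_finite_Union[symmetric]) (auto simp: disjoint_family_on_def)
      also have "\<dots> * (prob (P n) * r) \<le> 1 * (prob (P n) * r)"
        using r by (intro mult_right_mono) auto
      finally show ?thesis by simp
    qed
    have w_ev: "\<forall>\<^sub>F n in sequentially. \<forall>m\<ge>n. \<forall>s\<ge>1. ln (real m) * (\<Sum>i=1..m. (s * \<theta> m) powr (- e i)) \<le> 2 * C * s powr (- \<alpha>1)"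
      using weights_le by (rule eventually_all_ge_at_top)
    have tails: "\<forall>\<^sub>F n in sequentially. \<forall>j\<in>J n. prob (R n j) \<le> 4 * A * C / ln (real (Suc n))"
      using regular w_ev ln_\<theta>[THEN eventually_all_ge_at_top] \<theta>_ge[of 1]
        ln_ge[of "1 + ln K"]
    proof eventually_elim
      case (elim n)
      show ?case
      proof
        fix j assume j: "j \<in> J n"
        define m where "m = n + j"
        define k where "k = Suc n"
        \<comment> \<open>Twice this level is the threshold in \<open>R\<close>.\<close>
        define t where "t = K * \<theta> k / 4"
        define w where "w = (\<Sum>i=Suc k..<k + j. t powr (- e i))"
        have km: "k \<le> m" "n \<le> m" using j by (auto simp: J_def k_def m_def)
        have \<theta>nk: "\<theta> n \<le> \<theta> k" using \<theta>_mono by (simp add: monoD k_def)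
        have \<theta>m: "\<theta> m \<le> C' * \<theta> n" using elim j by (auto simp: J_def m_def)
        have \<theta>m1: "1 \<le> \<theta> m" using elim monoD[OF \<theta>_mono km(2)] by linarith
        have \<theta>k1: "1 \<le> \<theta> k" using elim \<theta>nk by linarith
        have "ln (real n) \<le> ln (real k)" by (cases "n = 0") (auto simp: k_def)
        then have lnk: "1 + ln K \<le> ln (real k)" using elim by linarith
        have lnK: "0 \<le> ln K" using K1 by simp
        have lnk1: "1 \<le> ln (real k)" using lnk lnK by linarith
        have st: "s * \<theta> m \<le> t"
        proof -
          have "s * \<theta> m \<le> s * (C' * \<theta> k)"
            using \<theta>m \<theta>nk C' s by (intro mult_left_mono order_trans[OF \<theta>m]) auto
          also have "\<dots> = (4 * C' * s) * \<theta> k / 4" by simp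
          also have "\<dots> \<le> t" unfolding t_def using K \<theta>k1 by (intro divide_right_mono mult_right_mono) auto
          finally show ?thesis .
        qed
        have s\<theta>: "1 \<le> s * \<theta> m" using s \<theta>m1 mult_mono[of 1 s 1 "\<theta> m"] by simp
        have t1: "1 \<le> t" using st s\<theta> by linarith
        have "w \<le> (\<Sum>i=Suc k..<k + j. (s * \<theta> m) powr (- e i))"
          unfolding w_def
        proof (rule sum_mono)
          fix i assume "i \<in> {Suc k..<k + j}"
          then have "0 < e i" using exponents(1,2) exponents(3)[of i] by auto
          then show "t powr (- e i) \<le> (s * \<theta> m) powr (- e i)"
            using st s\<theta> by (intro powr_mono2') auto
        qed
        also have "\<dots> \<le> (\<Sum>i=1..m. (s * \<theta> m) powr (- e i))"
          by (intro sum_mono2) (auto simp: m_def k_def)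
        finally have w_le: "w \<le> (\<Sum>i=1..m. (s * \<theta> m) powr (- e i))" .
        have w0: "0 \<le> w" unfolding w_def by (intro sum_nonneg) auto
        have "ln (real k) * w \<le> ln (real m) * (\<Sum>i=1..m. (s * \<theta> m) powr (- e i))"
          using w_le w0 lnk1 km by (intro mult_mono) (auto simp: k_def)
        also have "\<dots> \<le> 2 * C * s powr (- \<alpha>1)" using elim km s by blast
        finally have lw: "ln (real k) * w \<le> 2 * C * s powr (- \<alpha>1)" .
        have "ln t \<le> ln (K * \<theta> k)" using t1 K1 \<theta>k1 by (subst ln_le_cancel_iff) (auto simp: t_def)
        also have "\<dots> = ln K + ln (\<theta> k)" using K1 \<theta>k1 by (intro ln_mult_pos) auto
        also have "ln (\<theta> k) \<le> C * ln (real k)" using elim(3)[rule_format, of k] by (simp add: k_def del: of_nat_Suc)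
        finally have lnt: "1 + ln t \<le> (C + 1) * ln (real k)" using lnk by (simp add: algebra_simps)
        have "A * w * (1 + ln t) \<le> A * w * ((C + 1) * ln (real k))"
          using lnt A_nonneg w0 by (intro mult_left_mono) auto
        also have "\<dots> = A * (C + 1) * (ln (real k) * w)" by simp
        also have "\<dots> \<le> A * (C + 1) * (2 * C * s powr (- \<alpha>1))"
          using lw A_nonneg C_pos by (intro mult_left_mono) auto
        also have "\<dots> \<le> 1" using s\<alpha> by (simp add: algebra_simps)
        finally have small: "A * w * (1 + ln t) \<le> 1" .
        have "prob {\<omega>\<in>space M. 2 * t < \<bar>\<Sum>i=Suc k..<k + j. X i \<omega>\<bar>} \<le> 2 * A * w"
          unfolding w_def by (rule block_tail[OF _ t1 small[unfolded w_def]]) simp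
        also have "{\<omega>\<in>space M. 2 * t < \<bar>\<Sum>i=Suc k..<k + j. X i \<omega>\<bar>} = R n j"
          by (simp add: R_def t_def k_def)
        also have "2 * A * w \<le> 2 * A * (2 * C / ln (real k))"
        proof -
          have "ln (real k) * w \<le> 2 * C"
          proof -
            have "2 * C * s powr (- \<alpha>1) \<le> 2 * C * 1" using s1 C_pos by (intro mult_left_mono) auto
            then show ?thesis using lw by linarith
          qed
          then have "w \<le> 2 * C / ln (real k)" using lnk1 by (simp add: field_simps)
          then show ?thesis using A_nonneg by (intro mult_left_mono) auto
        qed
        finally show "prob (R n j) \<le> 4 * A * C / ln (real (Suc n))" by (simp add: k_def)
      qed
    qed
    define h where "h k = (if 1 \<le> k then 1 / (real (class_rank k) * max 1 (ln (real (class_rank k))) powr 2) else 0)" for k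
    have own: "\<forall>\<^sub>F n in sequentially. 0 < ln (real (Suc n)) \<and> \<theta> (Suc n) powr (- e (Suc n)) \<le> C / (real (class_rank (Suc n)) * ln (real (Suc n)))"
      using own_weight_le by (subst eventually_sequentially_Suc)
    have rk: "\<forall>\<^sub>F n in sequentially. 1 / (real (class_rank (Suc n)) * ln (real (Suc n)) powr 2) \<le> 1 / (real (class_rank (Suc n)) * max 1 (ln (real (class_rank (Suc n)))) powr 2)"
      using class_rank_summand_le[of 2] by (subst eventually_sequentially_Suc) simp
    have F_sum: "summable (\<lambda>n. prob (if 1 \<le> n then F n else {}))"
    proof (rule summable_comparison_test_ev)
      have "summable h" unfolding h_def by (rule summable_class_rank) simp
      then show "summable (\<lambda>n. 4 * A\<^sup>2 * C\<^sup>2 * h (Suc n))"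
        by (intro summable_mult) (simp add: summable_Suc_iff)
      show "\<forall>\<^sub>F n in sequentially. norm (prob (if 1 \<le> n then F n else {})) \<le> 4 * A\<^sup>2 * C\<^sup>2 * h (Suc n)"
        using tails own rk \<theta>_ge[of 1] eventually_ge_at_top[of 1]
      proof eventually_elim
        case (elim n)
        define k where "k = Suc n"
        have lnk: "0 < ln (real k)" using elim by (simp add: k_def)
        have \<theta>k: "1 \<le> \<theta> k" using elim monoD[OF \<theta>_mono, of n k] by (simp add: k_def)
        have ek: "0 < e k" using exponents(1,2) exponents(3)[of k] by (auto simp: k_def)
        have "prob (P n) \<le> prob {\<omega>\<in>space M. K * \<theta> k \<le> \<bar>X k \<omega>\<bar>}"
          using X_measurable[of k] by (intro finite_measure_mono) (auto simp: P_def k_def)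
        also have "\<dots> \<le> A * (K * \<theta> k) powr (- e k)" using \<theta>k K1 by (intro tail) (auto simp: k_def)
        also have "(K * \<theta> k) powr (- e k) \<le> \<theta> k powr (- e k)"
          using \<theta>k K1 ek mult_mono[of 1 K "\<theta> k" "\<theta> k"] by (intro powr_mono2') auto
        also have "\<theta> k powr (- e k) \<le> C / (real (class_rank k) * ln (real k))" using elim by (simp add: k_def)
        finally have P_le: "prob (P n) \<le> A * (C / (real (class_rank k) * ln (real k)))"
          using A_nonneg by (simp add: mult_left_mono)
        have r0: "0 \<le> 4 * A * C / ln (real k)" using A_nonneg C_pos lnk by simp
        have "prob (F n) \<le> prob (P n) * (4 * A * C / ln (real k))"
          using elim r0 by (intro F_le) (auto simp: k_def)
        also have "\<dots> \<le> A * (C / (real (class_rank k) * ln (real k))) * (4 * A * C / ln (real k))"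
          using P_le r0 by (intro mult_right_mono)
        also have "\<dots> = 4 * A\<^sup>2 * C\<^sup>2 * (1 / (real (class_rank k) * ln (real k) powr 2))"
        proof -
          have "ln (real k) powr 2 = ln (real k) * ln (real k)"
            using powr_numeral[OF less_imp_le[OF lnk], of "num.Bit0 num.One"] by (simp add: power2_eq_square)
          then show ?thesis by (simp add: power2_eq_square mult_ac)
        qed
        also have "\<dots> \<le> 4 * A\<^sup>2 * C\<^sup>2 * h k"
          using elim by (intro mult_left_mono) (auto simp: h_def k_def)
        finally show ?case using elim by (simp add: k_def)
      qed
    qed
    have "AE \<omega> in M. \<forall>\<^sub>F n in sequentially. \<omega> \<in> space M - (if 1 \<le> n then F n else {})"
      using F_sum Fm by (intro borel_cantelli_AE1) (auto simp: emeasure_eq_measure)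
    then show "AE \<omega> in M. \<forall>\<^sub>F n in sequentially.
     real (a n \<omega>) \<le> real N * L n \<longrightarrow> K * \<theta> (Suc n) < \<bar>X (Suc n) \<omega>\<bar> \<longrightarrow>
     K * \<theta> (Suc n) / 2 \<le> \<bar>random_block_sum X a n \<omega>\<bar>"
    proof eventually_elim
      fix \<omega> assume "\<forall>\<^sub>F n in sequentially. \<omega> \<in> space M - (if 1 \<le> n then F n else {})"
      then show "\<forall>\<^sub>F n in sequentially.
         real (a n \<omega>) \<le> real N * L n \<longrightarrow> K * \<theta> (Suc n) < \<bar>X (Suc n) \<omega>\<bar> \<longrightarrow>
         K * \<theta> (Suc n) / 2 \<le> \<bar>random_block_sum X a n \<omega>\<bar>"
        using eventually_ge_at_top[of 1]
      proof eventually_elim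
        case (elim n)
        show ?case
        proof (intro impI)
          assume a: "real (a n \<omega>) \<le> real N * L n" and big: "K * \<theta> (Suc n) < \<bar>X (Suc n) \<omega>\<bar>"
          have w: "\<omega> \<in> space M" "\<omega> \<notin> F n" using elim by auto
          have ap: "1 \<le> a n \<omega>" using a_pos[OF _ w(1), of n] elim by simp
          then have "\<omega> \<notin> R n (a n \<omega>)" using w a big by (auto simp: F_def J_def P_def)
          then have rest: "\<bar>\<Sum>i=Suc (Suc n)..<Suc n + a n \<omega>. X i \<omega>\<bar> \<le> K * \<theta> (Suc n) / 2"
            using w by (auto simp: R_def)
          have "random_block_sum X a n \<omega> = X (Suc n) \<omega> + (\<Sum>i=Suc (Suc n)..<Suc n + a n \<omega>. X i \<omega>)"
            unfolding random_block_sum_eq using ap by (subst sum.atLeast_Suc_lessThan) auto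
          then show "K * \<theta> (Suc n) / 2 \<le> \<bar>random_block_sum X a n \<omega>\<bar>" using rest big by linarith
        qed
      qed
    qed
  qed
qed

text \<open>
The bound \<open>N\<close> on the lengths depends on the outcome, so the two preceding lemmas are used for all
natural \<open>N\<close> at once, with a threshold \<open>\<rho> N K\<close> that is at least \<open>2 K\<close> and admissible for \<open>N\<close>.
\<close>

theorem block_lower:
  fixes D :: "nat set"
  defines "\<tau> \<equiv> \<lambda>n. card (D \<inter> {1..n})"
  assumes \<kappa>: "0 < \<kappa>" and \<alpha>: "0 < \<alpha>"
    and lower: "\<And>k u. k \<in> D \<inter> {1..} \<Longrightarrow> x0 \<le> u \<Longrightarrow> \<kappa> * u powr (- \<alpha>) \<le> prob {\<omega>\<in>space M. u < \<bar>X k \<omega>\<bar>}"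
    and \<tau>_top: "filterlim \<tau> at_top sequentially" and C2: "0 < C2"
    and tight: "\<forall>\<^sub>F n in sequentially. \<theta> n powr \<alpha> \<le> C2 * real (\<tau> n) * ln (real n)"
    and ln_\<tau>: "\<forall>\<^sub>F n in sequentially. ln (real n) \<le> C2 * ln (real (\<tau> n))"
    and a_meas: "\<And>n. 1 \<le> n \<Longrightarrow> a n \<in> measurable M (count_space UNIV)"
    and a_pos: "\<And>n \<omega>. 1 \<le> n \<Longrightarrow> \<omega> \<in> space M \<Longrightarrow> 0 < a n \<omega>"
    and a_ind: "\<And>n. 1 \<le> n \<Longrightarrow> indep_of_sequence M (a n) X"
    and regular: "\<And>N::nat. \<exists>C'\<ge>1. \<forall>\<^sub>F n in sequentially. \<forall>m. real m \<le> real n + real N * L n \<longrightarrow> \<theta> m \<le> C' * \<theta> n"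
    and a: "AE \<omega> in M. \<exists>N::nat. \<forall>\<^sub>F n in sequentially. real (a n \<omega>) \<le> real N * L n"
  shows "AE \<omega> in M. \<forall>K::nat. \<exists>\<^sub>\<infinity>n. real K * \<theta> n \<le> \<bar>random_block_sum X a n \<omega>\<bar>"
proof -
  define good where "good N K \<omega> \<longleftrightarrow> (\<forall>\<^sub>F n in sequentially.
     real (a n \<omega>) \<le> real N * L n \<longrightarrow> K * \<theta> (Suc n) < \<bar>X (Suc n) \<omega>\<bar> \<longrightarrow>
     K * \<theta> (Suc n) / 2 \<le> \<bar>random_block_sum X a n \<omega>\<bar>)" for N :: nat and K \<omega>
  have "\<exists>K0\<ge>1. \<forall>K\<ge>K0. AE \<omega> in M. good N K \<omega>" for N
  proof -
    obtain C' where C': "1 \<le> C'" "\<forall>\<^sub>F n in sequentially. \<forall>m. real m \<le> real n + real N * L n \<longrightarrow> \<theta> m \<le> C' * \<theta> n"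
      using regular by blast
    show ?thesis unfolding good_def by (rule rest_of_block[OF a_meas a_pos a_ind C'])
  qed
  then obtain K0 where K0: "\<And>N. 1 \<le> K0 N" "\<And>N K. K0 N \<le> K \<Longrightarrow> AE \<omega> in M. good N K \<omega>" by metis
  \<comment> \<open>Half of the first term survives, whence the factor \<open>2\<close>.\<close>
  define \<rho> where "\<rho> N K = max (K0 N) (2 * real K)" for N K :: nat
  have \<rho>: "0 < \<rho> N K" for N K using K0(1)[of N] by (simp add: \<rho>_def)
  have "AE \<omega> in M. \<forall>N K. good N (\<rho> N K) \<omega>"
    by (intro AE_all_countable[THEN iffD2] allI K0(2)) (simp add: \<rho>_def)
  moreover have "AE \<omega> in M. \<forall>N K. \<exists>\<^sub>\<infinity>k. k \<in> D \<inter> {1..} \<and> \<rho> N K * \<theta> k < \<bar>X k \<omega>\<bar>"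
    by (intro AE_all_countable[THEN iffD2] allI large_terms[OF \<kappa> \<rho> \<alpha> lower \<tau>_top[unfolded \<tau>_def] C2
          tight[unfolded \<tau>_def] ln_\<tau>[unfolded \<tau>_def]])
  ultimately show ?thesis using a
  proof eventually_elim
    fix \<omega> assume gd: "\<forall>N K. good N (\<rho> N K) \<omega>"
      and big: "\<forall>N K. \<exists>\<^sub>\<infinity>k. k \<in> D \<inter> {1..} \<and> \<rho> N K * \<theta> k < \<bar>X k \<omega>\<bar>"
      and "\<exists>N::nat. \<forall>\<^sub>F n in sequentially. real (a n \<omega>) \<le> real N * L n"
    then obtain N :: nat where N: "\<forall>\<^sub>F n in sequentially. real (a n \<omega>) \<le> real N * L n" by blast
    show "\<forall>K::nat. \<exists>\<^sub>\<infinity>n. real K * \<theta> n \<le> \<bar>random_block_sum X a n \<omega>\<bar>"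
    proof
      fix K :: nat
      have "\<forall>\<^sub>F n in sequentially. \<rho> N K * \<theta> (Suc n) < \<bar>X (Suc n) \<omega>\<bar> \<longrightarrow>
          real K * \<theta> n \<le> \<bar>random_block_sum X a n \<omega>\<bar>"
        using gd[unfolded good_def, rule_format, of N K] N
      proof eventually_elim
        case (elim n)
        have "real K * \<theta> n \<le> \<rho> N K / 2 * \<theta> (Suc n)"
          using monoD[OF \<theta>_mono, of n "Suc n"] \<theta>_nonneg \<rho>[of N K] by (intro mult_mono) (auto simp: \<rho>_def)
        then show ?case using elim by auto
      qed
      then obtain n0 where n0: "\<And>n. n0 \<le> n \<Longrightarrow> \<rho> N K * \<theta> (Suc n) < \<bar>X (Suc n) \<omega>\<bar> \<Longrightarrow>
          real K * \<theta> n \<le> \<bar>random_block_sum X a n \<omega>\<bar>"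
        by (auto simp: eventually_sequentially)
      show "\<exists>\<^sub>\<infinity>n. real K * \<theta> n \<le> \<bar>random_block_sum X a n \<omega>\<bar>"
        unfolding INFM_nat_le
      proof
        fix m
        obtain k where k: "Suc (max m n0) \<le> k" "\<rho> N K * \<theta> k < \<bar>X k \<omega>\<bar>"
          using big[rule_format, of N K] unfolding INFM_nat_le by blast
        then obtain n where "k = Suc n" by (cases k) auto
        then show "\<exists>n\<ge>m. real K * \<theta> n \<le> \<bar>random_block_sum X a n \<omega>\<bar>"
          using k n0[of n] by (intro exI[of _ n]) auto
      qed
    qed
  qed
qed

end

section \<open>From two-sided bounds to the limits superior\<close>

lemma le_limsup_if_frequently:
  fixes f :: "nat \<Rightarrow> ereal"
  assumes "\<exists>\<^sub>\<infinity>n. c \<le> f n"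
  shows "c \<le> limsup f"
proof (rule ccontr)
  assume "\<not> c \<le> limsup f"
  then have "\<forall>\<^sub>F n in sequentially. f n < c" by (intro Limsup_lessD) simp
  then have "\<not> (\<exists>\<^sub>\<infinity>n. c \<le> f n)"
    by (simp add: cofinite_eq_sequentially frequently_def not_le)
  with assms show False by contradiction
qed

text \<open>
The last equation is deterministic: for every \<open>p\<close> the power \<open>1 / ln (ln n)\<close> of \<open>(ln n) powr p\<close> is
\<open>exp p\<close>. The lower bound is used with \<open>K = 1\<close>, the upper bound along \<open>\<delta> = 1 / (m + 1)\<close>.
\<close>

lemma limsup_triple:
  fixes T B :: "nat \<Rightarrow> real" and \<alpha> :: real
  defines "\<theta> \<equiv> \<lambda>n. B n * ln (real n) powr (1 / \<alpha>)"
  assumes \<alpha>: "0 < \<alpha>" and B0: "\<And>n. 0 \<le> B n" and B: "\<forall>\<^sub>F n in sequentially. 0 < B n"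
    and low: "\<And>K::nat. \<exists>\<^sub>\<infinity>n. real K * \<theta> n \<le> \<bar>T n\<bar>"
  shows "limsup (\<lambda>n. ereal (\<bar>T n\<bar> / (B n * ln (real n) powr (1 / \<alpha>)))) = \<infinity>"
    and "(\<And>m::nat. (\<lambda>n. T n / (\<theta> n * ln (real n) powr (1 / real (Suc m)))) \<longlonglongrightarrow> 0) \<Longrightarrow>
      limsup (\<lambda>n. ereal (\<bar>T n / B n\<bar> powr (1 / ln (ln (real n))))) = ereal (exp (1 / \<alpha>))"
proof -
  have big: "\<forall>\<^sub>F n in sequentially. 0 < B n \<and> 1 < ln (real n) \<and> 0 < ln (ln (real n))"
  proof -
    have "filterlim (\<lambda>n. ln (ln (real n))) at_top sequentially" by real_asymp
    then have "\<forall>\<^sub>F n in sequentially. 0 < ln (ln (real n))" by (auto simp: filterlim_at_top_dense)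
    moreover have "filterlim (\<lambda>n. ln (real n)) at_top sequentially" by real_asymp
    then have "\<forall>\<^sub>F n in sequentially. 1 < ln (real n)" by (auto simp: filterlim_at_top_dense)
    ultimately show ?thesis using B by eventually_elim auto
  qed
  show "limsup (\<lambda>n. ereal (\<bar>T n\<bar> / (B n * ln (real n) powr (1 / \<alpha>)))) = \<infinity>"
  proof (rule ereal_top[unfolded top_ereal_def])
    fix b :: real
    obtain K :: nat where K: "b \<le> real K" using real_arch_simple by blast
    show "ereal b \<le> limsup (\<lambda>n. ereal (\<bar>T n\<bar> / (B n * ln (real n) powr (1 / \<alpha>))))"
    proof (rule le_limsup_if_frequently)
      have "\<exists>\<^sub>\<infinity>n. real K * \<theta> n \<le> \<bar>T n\<bar> \<and> (0 < B n \<and> 1 < ln (real n) \<and> 0 < ln (ln (real n)))"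
        using frequently_eventually_conj[OF low[of K, unfolded cofinite_eq_sequentially] big]
        unfolding cofinite_eq_sequentially by (rule frequently_elim1) blast
      then show "\<exists>\<^sub>\<infinity>n. ereal b \<le> ereal (\<bar>T n\<bar> / (B n * ln (real n) powr (1 / \<alpha>)))"
      proof (rule INFM_mono)
        fix n assume n: "real K * \<theta> n \<le> \<bar>T n\<bar> \<and> (0 < B n \<and> 1 < ln (real n) \<and> 0 < ln (ln (real n)))"
        then have "0 < \<theta> n" by (simp add: \<theta>_def)
        then have "real K \<le> \<bar>T n\<bar> / \<theta> n" using n by (simp add: field_simps)
        then show "ereal b \<le> ereal (\<bar>T n\<bar> / (B n * ln (real n) powr (1 / \<alpha>)))" using K by (simp add: \<theta>_def)
      qed
    qed
  qed
  have power: "(ln (real n) powr p) powr (1 / ln (ln (real n))) = exp p"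
    if "1 < ln (real n)" "0 < ln (ln (real n))" for n p
    using that by (simp add: powr_powr) (simp add: powr_def)
  assume up: "\<And>m::nat. (\<lambda>n. T n / (\<theta> n * ln (real n) powr (1 / real (Suc m)))) \<longlonglongrightarrow> 0"
  show "limsup (\<lambda>n. ereal (\<bar>T n / B n\<bar> powr (1 / ln (ln (real n))))) = ereal (exp (1 / \<alpha>))"
  proof (rule antisym)
    show "ereal (exp (1 / \<alpha>)) \<le> limsup (\<lambda>n. ereal (\<bar>T n / B n\<bar> powr (1 / ln (ln (real n)))))"
    proof (rule le_limsup_if_frequently)
      have "\<exists>\<^sub>\<infinity>n. real 1 * \<theta> n \<le> \<bar>T n\<bar> \<and> (0 < B n \<and> 1 < ln (real n) \<and> 0 < ln (ln (real n)))"
        using frequently_eventually_conj[OF low[of 1, unfolded cofinite_eq_sequentially] big]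
        unfolding cofinite_eq_sequentially by (rule frequently_elim1) blast
      then show "\<exists>\<^sub>\<infinity>n. ereal (exp (1 / \<alpha>)) \<le> ereal (\<bar>T n / B n\<bar> powr (1 / ln (ln (real n))))"
      proof (rule INFM_mono)
        fix n assume n: "real 1 * \<theta> n \<le> \<bar>T n\<bar> \<and> (0 < B n \<and> 1 < ln (real n) \<and> 0 < ln (ln (real n)))"
        then have "ln (real n) powr (1 / \<alpha>) \<le> \<bar>T n / B n\<bar>" by (simp add: \<theta>_def field_simps)
        then have "(ln (real n) powr (1 / \<alpha>)) powr (1 / ln (ln (real n))) \<le> \<bar>T n / B n\<bar> powr (1 / ln (ln (real n)))"
          using n by (intro powr_mono2) auto
        then show "ereal (exp (1 / \<alpha>)) \<le> ereal (\<bar>T n / B n\<bar> powr (1 / ln (ln (real n))))"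
          using n power by simp
      qed
    qed
    show "limsup (\<lambda>n. ereal (\<bar>T n / B n\<bar> powr (1 / ln (ln (real n))))) \<le> ereal (exp (1 / \<alpha>))"
    proof (rule LIMSEQ_le_const)
      have "(\<lambda>m. exp (1 / \<alpha> + 1 / real (Suc m))) \<longlonglongrightarrow> exp (1 / \<alpha> + 0)"
        by (intro tendsto_intros LIMSEQ_inverse_real_of_nat[unfolded inverse_eq_divide])
      then show "(\<lambda>m. ereal (exp (1 / \<alpha> + 1 / real (Suc m)))) \<longlonglongrightarrow> ereal (exp (1 / \<alpha>))"
        by simp
      show "\<exists>N. \<forall>m\<ge>N. limsup (\<lambda>n. ereal (\<bar>T n / B n\<bar> powr (1 / ln (ln (real n))))) \<le> ereal (exp (1 / \<alpha> + 1 / real (Suc m)))"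
      proof (intro exI allI impI Limsup_bounded)
        fix m :: nat
        have "\<forall>\<^sub>F n in sequentially. \<bar>T n / (\<theta> n * ln (real n) powr (1 / real (Suc m)))\<bar> < 1"
          using tendstoD[OF up[of m], of 1] by (simp add: dist_real_def)
        then show "\<forall>\<^sub>F n in sequentially. ereal (\<bar>T n / B n\<bar> powr (1 / ln (ln (real n)))) \<le> ereal (exp (1 / \<alpha> + 1 / real (Suc m)))"
          using big
        proof eventually_elim
          case (elim n)
          have pos: "0 < \<theta> n * ln (real n) powr (1 / real (Suc m))" using elim by (simp add: \<theta>_def)
          then have "\<bar>T n\<bar> \<le> \<theta> n * ln (real n) powr (1 / real (Suc m))" using elim by (simp add: field_simps)
          also have "\<dots> = B n * ln (real n) powr (1 / \<alpha> + 1 / real (Suc m))" by (simp add: \<theta>_def powr_add)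
          finally have "\<bar>T n / B n\<bar> \<le> ln (real n) powr (1 / \<alpha> + 1 / real (Suc m))" using elim by (simp add: field_simps)
          then have "\<bar>T n / B n\<bar> powr (1 / ln (ln (real n))) \<le> (ln (real n) powr (1 / \<alpha> + 1 / real (Suc m))) powr (1 / ln (ln (real n)))"
            using elim by (intro powr_mono2) auto
          then show ?case using elim power by simp
        qed
      qed
    qed
  qed
qed

section \<open>Variables with an attracted law\<close>

text \<open>
One constant \<open>A\<close> serves all variables with the attracted law, which makes the bounds uniform over
a class of indices. The centering convention enters for \<open>\<alpha> > 1\<close>, where it makes the mean zero.
\<close>

lemma (in prob_space) attracted_variable_estimates:
  assumes na: "normally_attracted G \<alpha> c d" and cc: "centering_convention \<alpha> d"
    and \<alpha>: "0 < \<alpha>" "\<alpha> < 2" and c: "0 < c"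
  shows "\<exists>A\<ge>0. \<forall>Y\<in>borel_measurable M. distr M borel Y = G \<longrightarrow>
      (\<forall>u>0. prob {\<omega>\<in>space M. u \<le> \<bar>Y \<omega>\<bar>} \<le> A * u powr (- \<alpha>)) \<and>
      (\<forall>x>0. expectation (\<lambda>\<omega>. (Y \<omega> * indicator {- x..x} (Y \<omega>))\<^sup>2) \<le> A * x powr (2 - \<alpha>)) \<and>
      (\<forall>x\<ge>1. \<bar>expectation (\<lambda>\<omega>. Y \<omega> * indicator {- x..x} (Y \<omega>))\<bar>
         \<le> A * x powr (1 - \<alpha>) * (if \<alpha> = 1 then 1 + ln x else 1))"
proof -
  obtain C where C: "0 \<le> C" and tailG: "\<And>u. 0 < u \<Longrightarrow> measure G {y. u \<le> \<bar>y\<bar>} \<le> C * u powr (- \<alpha>)"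
    using attracted_two_sided_tails(1)[OF na \<alpha> c] by blast
  define A where "A = 1 + C + C * 2 / (2 - \<alpha>) + C / \<bar>\<alpha> - 1\<bar>"
  have A: "C \<le> A" "C * 2 / (2 - \<alpha>) \<le> A" "1 + C + C / \<bar>\<alpha> - 1\<bar> \<le> A" "0 \<le> A"
    using C \<alpha> by (simp_all add: A_def)
  show ?thesis
  proof (intro exI[of _ A] conjI ballI impI allI)
    fix Y assume Y[measurable]: "Y \<in> borel_measurable M" and G: "distr M borel Y = G"
    have tail: "prob {\<omega>\<in>space M. u \<le> \<bar>Y \<omega>\<bar>} \<le> C * u powr (- \<alpha>)" if "0 < u" for u
    proof -
      have "measure G {y. u \<le> \<bar>y\<bar>} = prob {\<omega>\<in>space M. u \<le> \<bar>Y \<omega>\<bar>}"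
        unfolding G[symmetric] by (subst measure_distr) (auto intro!: arg_cong[of _ _ prob])
      then show ?thesis using tailG[OF that] by simp
    qed
    show "prob {\<omega>\<in>space M. u \<le> \<bar>Y \<omega>\<bar>} \<le> A * u powr (- \<alpha>)" if "0 < u" for u
      using tail[OF that] mult_right_mono[OF A(1), of "u powr (- \<alpha>)"] by simp
    show "expectation (\<lambda>\<omega>. (Y \<omega> * indicator {- x..x} (Y \<omega>))\<^sup>2) \<le> A * x powr (2 - \<alpha>)" if "0 < x" for x
    proof -
      have "(\<lambda>\<omega>. (Y \<omega> * indicator {- x..x} (Y \<omega>))\<^sup>2) = (\<lambda>\<omega>. (Y \<omega>)\<^sup>2 * indicator {- x..x} (Y \<omega>))"
        by (auto simp: indicator_def fun_eq_iff)
      then show ?thesis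
        using truncated_second_moment[OF Y tail \<alpha>(2) that C] mult_right_mono[OF A(2), of "x powr (2 - \<alpha>)"] by simp
    qed
    show "\<bar>expectation (\<lambda>\<omega>. Y \<omega> * indicator {- x..x} (Y \<omega>))\<bar>
         \<le> A * x powr (1 - \<alpha>) * (if \<alpha> = 1 then 1 + ln x else 1)" if x: "1 \<le> x" for x
    proof -
      have mean0: "expectation Y = 0" if "1 < \<alpha>" "integrable M Y"
      proof -
        have "integrable G (\<lambda>y. y)" unfolding G[symmetric] using that by (subst integrable_distr_eq) auto
        then have "integral\<^sup>L G (\<lambda>y. y) = 0"
          using cc that by (intro attracted_mean_zero[OF na _ c]) (auto simp: centering_convention_def)
        then show ?thesis unfolding G[symmetric] by (subst (asm) integral_distr) auto
      qed
      have "\<bar>expectation (\<lambda>\<omega>. Y \<omega> * indicator {- x..x} (Y \<omega>))\<bar>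
        \<le> (1 + C + C / \<bar>\<alpha> - 1\<bar>) * x powr (1 - \<alpha>) * (if \<alpha> = 1 then 1 + ln x else 1)"
        by (rule truncated_mean[OF Y C tail mean0 x])
      also have "\<dots> \<le> A * x powr (1 - \<alpha>) * (if \<alpha> = 1 then 1 + ln x else 1)"
        using A x by (intro mult_right_mono) auto
      finally show ?thesis .
    qed
  qed (use A in auto)
qed

lemma (in prob_space) attracted_variable_lower:
  assumes na: "normally_attracted G \<alpha> c d" and \<alpha>: "0 < \<alpha>" "\<alpha> < 2" and c: "0 < c"
  shows "\<exists>\<kappa>>0. \<exists>x0. \<forall>Y\<in>borel_measurable M. distr M borel Y = G \<longrightarrow>
      (\<forall>u\<ge>x0. \<kappa> * u powr (- \<alpha>) \<le> prob {\<omega>\<in>space M. u < \<bar>Y \<omega>\<bar>})"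
proof -
  obtain \<kappa> x0 where \<kappa>: "0 < \<kappa>" and lowG: "\<And>u. x0 \<le> u \<Longrightarrow> \<kappa> * u powr (- \<alpha>) \<le> measure G {y. u < \<bar>y\<bar>}"
    using attracted_two_sided_tails(2)[OF na \<alpha> c] by blast
  have "measure G {y. u < \<bar>y\<bar>} = prob {\<omega>\<in>space M. u < \<bar>Y \<omega>\<bar>}"
    if [measurable]: "Y \<in> borel_measurable M" and G: "distr M borel Y = G" for u Y
    unfolding G[symmetric] by (subst measure_distr) (auto intro!: arg_cong[of _ _ prob])
  then show ?thesis using \<kappa> lowG by metis
qed

section \<open>The three regimes of the class counts\<close>

lemma eventually_le_weaken:
  fixes f g :: "nat \<Rightarrow> real"
  assumes "\<forall>\<^sub>F n in F. f n \<le> c * g n" "c \<le> c'" "\<And>n. 0 \<le> g n"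
  shows "\<forall>\<^sub>F n in F. f n \<le> c' * g n"
  using assms(1) by eventually_elim (use assms(2,3) in \<open>meson mult_right_mono order_trans\<close>)

lemma ln_le_ln_power:
  fixes \<tau> :: "nat \<Rightarrow> nat"
  assumes \<tau>: "filterlim \<tau> at_top sequentially" and p: "0 < p" and c: "0 < c"
    and le: "\<forall>\<^sub>F n in sequentially. real n \<le> c * real (\<tau> n) powr p"
  shows "\<forall>\<^sub>F n in sequentially. ln (real n) \<le> (p + 1) * ln (real (\<tau> n))"
proof -
  have "filterlim (\<lambda>n. ln (real (\<tau> n))) at_top sequentially"
    by (intro filterlim_compose[OF ln_at_top] filterlim_compose[OF filterlim_real_sequentially] \<tau>)
  then have "\<forall>\<^sub>F n in sequentially. ln c < ln (real (\<tau> n))" "\<forall>\<^sub>F n in sequentially. 0 < ln (real (\<tau> n))"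
    by (auto simp: filterlim_at_top_dense)
  then show ?thesis using le eventually_gt_at_top[of 0]
  proof eventually_elim
    case (elim n)
    have \<tau>0: "0 < real (\<tau> n)" using elim by (cases "\<tau> n = 0") auto
    have "ln (real n) \<le> ln (c * real (\<tau> n) powr p)" using elim by (subst ln_le_cancel_iff) auto
    also have "\<dots> = ln c + p * ln (real (\<tau> n))" using c \<tau>0 by (subst ln_mult_pos) (auto simp: ln_powr)
    also have "\<dots> \<le> (p + 1) * ln (real (\<tau> n))" using elim by (simp add: algebra_simps)
    finally show ?case .
  qed
qed

text \<open>
What has to be checked in a regime. The classes with exponents \<open>\<alpha>1\<close> and \<open>\<alpha>2\<close> are dominated
(\<open>r1\<close>, \<open>r2\<close>); the class \<open>D\<close> with exponent \<open>\<alpha>\<close> attains the scale (\<open>tight\<close>) and is not too thin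
(\<open>ln_\<tau>\<close>); and the scale varies slowly over blocks of admissible length (\<open>regular\<close>).
\<close>

theorem (in power_tailed) regime_limsups:
  fixes a :: "nat \<Rightarrow> 'a \<Rightarrow> nat" and B L :: "nat \<Rightarrow> real" and \<alpha> \<alpha>1 \<alpha>2 :: real and D :: "nat set" and \<tau>1 \<tau>2 :: "nat \<Rightarrow> nat"
  defines "\<theta> \<equiv> \<lambda>n. B n * ln (real n) powr (1 / \<alpha>)"
    and "\<tau> \<equiv> \<lambda>n. card (D \<inter> {1..n})"
    and "T \<equiv> random_block_sum X a"
  assumes exps: "0 < \<alpha>1" "\<alpha>1 < \<alpha>2" "\<And>k. 1 \<le> k \<Longrightarrow> e k \<in> {\<alpha>1, \<alpha>2}" and \<alpha>: "0 < \<alpha>"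
    and B: "mono B" "\<And>n. 0 \<le> B n"
    and count1: "\<And>n. card {i \<in> {1..n}. e i = \<alpha>1} \<le> \<tau>1 n" and count2: "\<And>n. card {i \<in> {1..n}. e i = \<alpha>2} \<le> \<tau>2 n"
    and \<tau>1_top: "filterlim \<tau>1 at_top sequentially" and \<tau>_top: "filterlim \<tau> at_top sequentially"
    and r1: "\<forall>\<^sub>F n in sequentially. real (\<tau>1 n) * ln (real n) \<le> C1 * \<theta> n powr \<alpha>1"
    and r2: "\<forall>\<^sub>F n in sequentially. real (\<tau>2 n) * ln (real n) \<le> C2 * \<theta> n powr \<alpha>2"
    and tight: "\<forall>\<^sub>F n in sequentially. \<theta> n powr \<alpha> \<le> C3 * (real (\<tau> n) * ln (real n))"
    and ln_\<tau>: "\<forall>\<^sub>F n in sequentially. ln (real n) \<le> C4 * ln (real (\<tau> n))"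
    and \<kappa>: "0 < \<kappa>"
    and lower: "\<And>k u. k \<in> D \<inter> {1..} \<Longrightarrow> threshold \<le> u \<Longrightarrow> \<kappa> * u powr (- \<alpha>) \<le> prob {\<omega>\<in>space M. u < \<bar>X k \<omega>\<bar>}"
    and a_meas: "\<And>n. 1 \<le> n \<Longrightarrow> a n \<in> measurable M (count_space UNIV)"
    and a_pos: "\<And>n \<omega>. 1 \<le> n \<Longrightarrow> \<omega> \<in> space M \<Longrightarrow> 0 < a n \<omega>"
    and a_ind: "\<And>n. 1 \<le> n \<Longrightarrow> indep_of_sequence M (a n) X"
    and L: "\<And>n. L n \<le> real n" "\<forall>\<^sub>F n in sequentially. 0 < L n"
    and regular: "\<And>N::nat. \<exists>C'\<ge>1. \<forall>\<^sub>F n in sequentially. \<forall>m. real m \<le> real n + real N * L n \<longrightarrow> \<theta> m \<le> C' * \<theta> n"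
    and limsup_a: "AE \<omega> in M. limsup (\<lambda>n. ereal (real (a n \<omega>) / L n)) < \<infinity>"
  shows "(\<forall>\<delta>>0. AE \<omega> in M. limsup (\<lambda>n. ereal (\<bar>T n \<omega>\<bar> / (B n * ln (real n) powr ((1 + \<delta>) / \<alpha>)))) = 0) \<and>
    (AE \<omega> in M. limsup (\<lambda>n. ereal (\<bar>T n \<omega>\<bar> / (B n * ln (real n) powr (1 / \<alpha>)))) = \<infinity>) \<and>
    (AE \<omega> in M. limsup (\<lambda>n. ereal (\<bar>T n \<omega> / B n\<bar> powr (1 / ln (ln (real n))))) = ereal (exp (1 / \<alpha>)))"
proof (intro conjI)
  have ln0: "0 \<le> ln (real n)" for n by (cases "n = 0") auto
  \<comment> \<open>The entry \<open>4 / \<alpha>\<close> bounds \<open>ln (\<theta> n) / ln n\<close> for large \<open>n\<close>, because \<open>\<theta> n powr \<alpha> \<le> C * n\<^sup>2\<close>.\<close>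
  define C where "C = max 1 (max (max C1 C2) (max C3 (max C4 (4 / \<alpha>))))"
  have C: "0 < C" "C1 \<le> C" "C2 \<le> C" "C3 \<le> C" "C4 \<le> C" "4 / \<alpha> \<le> C" by (auto simp: C_def)
  have \<theta>0: "0 \<le> \<theta> n" for n using B by (simp add: \<theta>_def)
  have ln_top: "filterlim (\<lambda>n. ln (real n)) at_top sequentially" by real_asymp
  then have ln_ge: "\<forall>\<^sub>F n in sequentially. z \<le> ln (real n)" for z by (auto simp: filterlim_at_top)
  note r1' = eventually_le_weaken[OF r1 C(2) powr_ge_zero] and r2' = eventually_le_weaken[OF r2 C(3) powr_ge_zero]
  have tight': "\<forall>\<^sub>F n in sequentially. \<theta> n powr \<alpha> \<le> C * (real (\<tau> n) * ln (real n))"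
    using ln0 by (intro eventually_le_weaken[OF tight C(4)]) auto
  have ln_\<tau>': "\<forall>\<^sub>F n in sequentially. ln (real n) \<le> C * ln (real (\<tau> n))"
    using C(5) by (intro eventually_le_weaken[OF ln_\<tau>]) (auto, case_tac "\<tau> n = 0", auto)
  have \<theta>_mono: "mono \<theta>"
  proof (rule monoI)
    fix m n :: nat assume "m \<le> n"
    then have "ln (real m) \<le> ln (real n)" by (cases "m = 0"; cases "n = 0") auto
    then show "\<theta> m \<le> \<theta> n" unfolding \<theta>_def
      using B \<open>m \<le> n\<close> \<alpha> ln0[of m] by (intro mult_mono powr_mono2) (auto dest: monoD)
  qed
  have \<theta>_top: "filterlim \<theta> at_top sequentially"
  proof (rule filterlim_at_top_mono)
    have "filterlim (\<lambda>x::real. (inverse C * x) powr (1 / \<alpha>1)) at_top at_top"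
      using C exps by real_asymp
    then show "filterlim (\<lambda>n. (inverse C * real (\<tau>1 n)) powr (1 / \<alpha>1)) at_top sequentially"
      by (rule filterlim_compose[OF _ filterlim_compose[OF filterlim_real_sequentially \<tau>1_top]])
    show "\<forall>\<^sub>F n in sequentially. (inverse C * real (\<tau>1 n)) powr (1 / \<alpha>1) \<le> \<theta> n"
      using r1' ln_ge[of 1]
    proof eventually_elim
      case (elim n)
      have "real (\<tau>1 n) * 1 \<le> real (\<tau>1 n) * ln (real n)" using elim by (intro mult_left_mono) auto
      then have "inverse C * real (\<tau>1 n) \<le> \<theta> n powr \<alpha>1" using elim C by (simp add: field_simps)
      then have "(inverse C * real (\<tau>1 n)) powr (1 / \<alpha>1) \<le> (\<theta> n powr \<alpha>1) powr (1 / \<alpha>1)"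
        using C exps by (intro powr_mono2) auto
      then show ?case using exps \<theta>0[of n] by (simp add: powr_powr)
    qed
  qed
  then have \<theta>_pos: "\<forall>\<^sub>F n in sequentially. 0 < \<theta> n" by (auto simp: filterlim_at_top_dense)
  interpret normed_walk M X e A \<alpha>1 \<alpha>2 \<theta> C
  proof
    show "\<forall>\<^sub>F n in sequentially. real (card {i \<in> {1..n}. e i = v}) * ln (real n) \<le> C * \<theta> n powr v" if "v \<in> {\<alpha>1, \<alpha>2}" for v
    proof -
      have "\<forall>\<^sub>F n in sequentially. real (card {i \<in> {1..n}. e i = \<alpha>1}) * ln (real n) \<le> C * \<theta> n powr \<alpha>1"
        using r1' by eventually_elim (use count1 ln0 in \<open>meson mult_right_mono of_nat_mono order_trans\<close>)
      moreover have "\<forall>\<^sub>F n in sequentially. real (card {i \<in> {1..n}. e i = \<alpha>2}) * ln (real n) \<le> C * \<theta> n powr \<alpha>2"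
        using r2' by eventually_elim (use count2 ln0 in \<open>meson mult_right_mono of_nat_mono order_trans\<close>)
      ultimately show ?thesis using that by blast
    qed
    show "\<forall>\<^sub>F n in sequentially. ln (\<theta> n) \<le> C * ln (real n)"
      using tight' \<theta>_pos ln_ge[of 1] ln_ge[of "ln C"] eventually_gt_at_top[of 0]
    proof eventually_elim
      case (elim n)
      have n0: "0 < real n" using elim by simp
      have "\<tau> n \<le> card {1..n}" unfolding \<tau>_def by (intro card_mono) auto
      then have "real (\<tau> n) * ln (real n) \<le> real n * real n"
        using ln0[of n] ln_le_minus_one[OF n0] by (intro mult_mono) auto
      then have "\<theta> n powr \<alpha> \<le> C * (real n * real n)" using elim C by (meson mult_left_mono less_imp_le order_trans)
      then have "ln (\<theta> n powr \<alpha>) \<le> ln (C * (real n * real n))" using elim C n0 by (subst ln_le_cancel_iff) auto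
      then have "\<alpha> * ln (\<theta> n) \<le> ln C + 2 * ln (real n)" using C n0 elim by (simp add: ln_powr ln_mult_pos)
      then have "\<alpha> * ln (\<theta> n) \<le> 4 * ln (real n)" using elim by linarith
      then have "ln (\<theta> n) \<le> 4 / \<alpha> * ln (real n)" using \<alpha> by (simp add: field_simps)
      also have "\<dots> \<le> C * ln (real n)" using C ln0 by (intro mult_right_mono) auto
      finally show ?case .
    qed
  qed (use exps \<theta>0 \<theta>_mono \<theta>_top C in auto)
  have a: "AE \<omega> in M. \<exists>N::nat. \<forall>\<^sub>F n in sequentially. real (a n \<omega>) \<le> real N * L n"
    using limsup_a
  proof eventually_elim
    fix \<omega> assume "limsup (\<lambda>n. ereal (real (a n \<omega>) / L n)) < \<infinity>"
    then obtain N :: nat where "limsup (\<lambda>n. ereal (real (a n \<omega>) / L n)) < ereal (real N)"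
      using less_PInf_Ex_of_nat by auto
    then have "\<forall>\<^sub>F n in sequentially. ereal (real (a n \<omega>) / L n) < ereal (real N)" by (rule Limsup_lessD)
    then have "\<forall>\<^sub>F n in sequentially. real (a n \<omega>) \<le> real N * L n"
      using L(2) by eventually_elim (simp add: field_simps)
    then show "\<exists>N::nat. \<forall>\<^sub>F n in sequentially. real (a n \<omega>) \<le> real N * L n" by blast
  qed
  have up: "AE \<omega> in M. (\<lambda>n. T n \<omega> / (\<theta> n * ln (real n) powr \<delta>)) \<longlonglongrightarrow> 0" if "0 < \<delta>" for \<delta>
    unfolding T_def by (rule block_upper[OF that L(1) regular a])
  have low: "AE \<omega> in M. \<forall>K::nat. \<exists>\<^sub>\<infinity>n. real K * \<theta> n \<le> \<bar>T n \<omega>\<bar>"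
    unfolding T_def using tight' ln_\<tau>' \<tau>_top unfolding \<tau>_def
    by (intro block_lower[OF \<kappa> \<alpha> lower _ C(1) _ _ a_meas a_pos a_ind regular a]) (simp_all add: mult.assoc)
  have B_pos: "\<forall>\<^sub>F n in sequentially. 0 < B n"
    using \<theta>_pos by eventually_elim (use B in \<open>auto simp: \<theta>_def zero_less_mult_iff dest: leD\<close>)
  show "\<forall>\<delta>>0. AE \<omega> in M. limsup (\<lambda>n. ereal (\<bar>T n \<omega>\<bar> / (B n * ln (real n) powr ((1 + \<delta>) / \<alpha>)))) = 0"
  proof (intro allI impI)
    fix \<delta> :: real assume \<delta>: "0 < \<delta>"
    have eq: "\<bar>T n \<omega>\<bar> / (B n * ln (real n) powr ((1 + \<delta>) / \<alpha>)) = \<bar>T n \<omega> / (\<theta> n * ln (real n) powr (\<delta> / \<alpha>))\<bar>" for n \<omega>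
      using B(2)[of n] by (simp add: \<theta>_def add_divide_distrib powr_add abs_mult)
    have "AE \<omega> in M. (\<lambda>n. T n \<omega> / (\<theta> n * ln (real n) powr (\<delta> / \<alpha>))) \<longlonglongrightarrow> 0" using \<delta> \<alpha> by (intro up) auto
    then show "AE \<omega> in M. limsup (\<lambda>n. ereal (\<bar>T n \<omega>\<bar> / (B n * ln (real n) powr ((1 + \<delta>) / \<alpha>)))) = 0"
    proof eventually_elim
      fix \<omega> assume "(\<lambda>n. T n \<omega> / (\<theta> n * ln (real n) powr (\<delta> / \<alpha>))) \<longlonglongrightarrow> 0"
      then have "(\<lambda>n. \<bar>T n \<omega> / (\<theta> n * ln (real n) powr (\<delta> / \<alpha>))\<bar>) \<longlonglongrightarrow> 0" by (rule tendsto_rabs_zero)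
      then have "(\<lambda>n. ereal (\<bar>T n \<omega>\<bar> / (B n * ln (real n) powr ((1 + \<delta>) / \<alpha>)))) \<longlonglongrightarrow> ereal 0"
        unfolding eq by simp
      then have "limsup (\<lambda>n. ereal (\<bar>T n \<omega>\<bar> / (B n * ln (real n) powr ((1 + \<delta>) / \<alpha>)))) = ereal 0"
        by (rule lim_imp_Limsup[OF trivial_limit_sequentially])
      then show "limsup (\<lambda>n. ereal (\<bar>T n \<omega>\<bar> / (B n * ln (real n) powr ((1 + \<delta>) / \<alpha>)))) = 0"
        by (simp only: zero_ereal_def)
    qed
  qed
  show "AE \<omega> in M. limsup (\<lambda>n. ereal (\<bar>T n \<omega>\<bar> / (B n * ln (real n) powr (1 / \<alpha>)))) = \<infinity>"
    using low
  proof eventually_elim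
    fix \<omega> assume "\<forall>K::nat. \<exists>\<^sub>\<infinity>n. real K * \<theta> n \<le> \<bar>T n \<omega>\<bar>"
    from limsup_triple(1)[OF \<alpha> B(2) B_pos spec[OF this[unfolded \<theta>_def]]]
    show "limsup (\<lambda>n. ereal (\<bar>T n \<omega>\<bar> / (B n * ln (real n) powr (1 / \<alpha>)))) = \<infinity>" .
  qed
  have "AE \<omega> in M. \<forall>m::nat. (\<lambda>n. T n \<omega> / (\<theta> n * ln (real n) powr (1 / real (Suc m)))) \<longlonglongrightarrow> 0"
    by (intro AE_all_countable[THEN iffD2] allI up) simp
  with low show "AE \<omega> in M. limsup (\<lambda>n. ereal (\<bar>T n \<omega> / B n\<bar> powr (1 / ln (ln (real n))))) = ereal (exp (1 / \<alpha>))"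
  proof eventually_elim
    fix \<omega> assume low: "\<forall>K::nat. \<exists>\<^sub>\<infinity>n. real K * \<theta> n \<le> \<bar>T n \<omega>\<bar>"
      and up: "\<forall>m::nat. (\<lambda>n. T n \<omega> / (\<theta> n * ln (real n) powr (1 / real (Suc m)))) \<longlonglongrightarrow> 0"
    from limsup_triple(2)[OF \<alpha> B(2) B_pos spec[OF low[unfolded \<theta>_def]] spec[OF up[unfolded \<theta>_def]]]
    show "limsup (\<lambda>n. ereal (\<bar>T n \<omega> / B n\<bar> powr (1 / ln (ln (real n))))) = ereal (exp (1 / \<alpha>))" .
  qed
qed

text \<open>
For large \<open>n\<close>, a block that starts at \<open>n\<close> ends before \<open>n\<^sup>2\<close>, so its logarithm at most doubles; only the growth
of the count \<open>c\<close> matters.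
\<close>

lemma regular_norming:
  fixes c :: "nat \<Rightarrow> nat" and N :: nat
  assumes \<alpha>: "0 < \<alpha>" and \<beta>: "0 < \<beta>" and L: "\<And>n. L n \<le> real n"
    and c: "\<exists>C'\<ge>1. \<forall>\<^sub>F n in sequentially. \<forall>m. real m \<le> real n + real N * L n \<longrightarrow> real (c m) \<le> C' * real (c n)"
  shows "\<exists>C'\<ge>1. \<forall>\<^sub>F n in sequentially. \<forall>m. real m \<le> real n + real N * L n \<longrightarrow>
    real (c m) powr (1 / \<beta>) * ln (real m) powr (1 / \<alpha>) \<le> C' * (real (c n) powr (1 / \<beta>) * ln (real n) powr (1 / \<alpha>))"
proof -
  obtain C' where C': "1 \<le> C'" and ev: "\<forall>\<^sub>F n in sequentially. \<forall>m. real m \<le> real n + real N * L n \<longrightarrow> real (c m) \<le> C' * real (c n)"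
    using c by blast
  let ?C = "C' powr (1 / \<beta>) * 2 powr (1 / \<alpha>)"
  have "1 \<le> C' powr (1 / \<beta>)" "1 \<le> (2::real) powr (1 / \<alpha>)"
    using C' \<alpha> \<beta> by (auto intro!: ge_one_powr_ge_zero)
  then have C1: "1 \<le> ?C" using mult_mono[of 1 "C' powr (1 / \<beta>)" 1 "2 powr (1 / \<alpha>)"] by simp
  show ?thesis
  proof (intro exI[of _ ?C] conjI C1)
    show "\<forall>\<^sub>F n in sequentially. \<forall>m. real m \<le> real n + real N * L n \<longrightarrow>
      real (c m) powr (1 / \<beta>) * ln (real m) powr (1 / \<alpha>) \<le> ?C * (real (c n) powr (1 / \<beta>) * ln (real n) powr (1 / \<alpha>))"
      using ev eventually_ge_at_top[of "N + 1"]
    proof eventually_elim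
      case (elim n)
      show ?case
      proof (intro allI impI)
        fix m assume m: "real m \<le> real n + real N * L n"
        have n0: "0 < real n" "1 \<le> real n" using elim by simp_all
        have ln0: "0 \<le> ln (real k)" for k by (cases "k = 0") auto
        have "real m \<le> real n + real N * real n" using m mult_left_mono[OF L[of n], of "real N"] by linarith
        also have "\<dots> = real (N + 1) * real n" by (simp add: algebra_simps)
        also have "\<dots> \<le> real n * real n" using elim by (intro mult_right_mono) auto
        finally have mn: "real m \<le> real n * real n" .
        have "ln (real m) \<le> 2 * ln (real n)"
        proof (cases "m = 0")
          case False
          then have "ln (real m) \<le> ln (real n * real n)" using n0 mn by (subst ln_le_cancel_iff) auto
          then show ?thesis using n0 by (simp add: ln_mult_pos)
        qed (use ln0[of n] in simp)
        then have "real (c m) powr (1 / \<beta>) * ln (real m) powr (1 / \<alpha>)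
            \<le> (C' * real (c n)) powr (1 / \<beta>) * (2 * ln (real n)) powr (1 / \<alpha>)"
          using elim m \<alpha> \<beta> ln0 by (intro mult_mono powr_mono2) auto
        also have "\<dots> = ?C * (real (c n) powr (1 / \<beta>) * ln (real n) powr (1 / \<alpha>))"
          using C' ln0[of n] by (simp add: powr_mult)
        finally show "real (c m) powr (1 / \<beta>) * ln (real m) powr (1 / \<alpha>)
            \<le> ?C * (real (c n) powr (1 / \<beta>) * ln (real n) powr (1 / \<alpha>))" .
      qed
    qed
  qed
qed

lemma powr_le_flip:
  fixes x y c p q :: real
  assumes "x powr p \<le> c * y powr q" "0 < p" "0 \<le> x" "0 \<le> c"
  shows "x \<le> c powr (1 / p) * y powr (q / p)"
proof -
  have "x = (x powr p) powr (1 / p)" using assms by (simp add: powr_powr)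
  also have "\<dots> \<le> (c * y powr q) powr (1 / p)" using assms by (intro powr_mono2) auto
  also have "\<dots> = c powr (1 / p) * y powr (q / p)" using assms by (simp add: powr_mult powr_powr)
  finally show ?thesis .
qed

lemma ratio_bounds:
  fixes s t :: "nat \<Rightarrow> nat" and p q c :: real
  assumes lim: "(\<lambda>n. ereal (real (s n) powr p / real (t n) powr q)) \<longlonglongrightarrow> l"
    and t: "filterlim t at_top sequentially"
  shows "l < ereal c \<Longrightarrow> \<forall>\<^sub>F n in sequentially. real (s n) powr p \<le> c * real (t n) powr q"
    and "ereal c < l \<Longrightarrow> \<forall>\<^sub>F n in sequentially. c * real (t n) powr q \<le> real (s n) powr p"
proof -
  have "\<forall>\<^sub>F n in sequentially. 1 \<le> t n" using t by (auto simp: filterlim_at_top)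
  then have t0: "\<forall>\<^sub>F n in sequentially. 0 < t n" by eventually_elim simp
  show "\<forall>\<^sub>F n in sequentially. real (s n) powr p \<le> c * real (t n) powr q" if "l < ereal c"
    using order_tendstoD(2)[OF lim that] t0 by eventually_elim (simp add: field_simps)
  show "\<forall>\<^sub>F n in sequentially. c * real (t n) powr q \<le> real (s n) powr p" if "ereal c < l"
    using order_tendstoD(1)[OF lim that] t0 by eventually_elim (simp add: field_simps)
qed

theorem corollary4p3:
  fixes M :: "'a measure"
    and X :: "nat \<Rightarrow> 'a \<Rightarrow> real"
    and a :: "nat \<Rightarrow> 'a \<Rightarrow> nat"
    and G1 G2 :: "real measure"
    and \<alpha>1 \<alpha>2 c1 c2 :: real
    and d1 d2 :: "nat \<Rightarrow> real"
    and \<tau>1 \<tau>2 :: "nat \<Rightarrow> nat"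
    and l :: ereal
    and B :: "nat \<Rightarrow> real"
    and T :: "nat \<Rightarrow> 'a \<Rightarrow> real"
  defines "\<tau>1 \<equiv> law_count M X G1"
    and "\<tau>2 \<equiv> law_count M X G2"
    and "B \<equiv> norming l \<alpha>1 \<alpha>2 \<tau>1 \<tau>2"
    and "T \<equiv> random_block_sum X a"
  assumes "prob_space M"
    and "0 < \<alpha>1" and "\<alpha>1 < \<alpha>2" and "\<alpha>2 < 2"
    and "0 < c1" and "0 < c2"
    and "normally_attracted G1 \<alpha>1 c1 d1" and "centering_convention \<alpha>1 d1"
    and "normally_attracted G2 \<alpha>2 c2 d2" and "centering_convention \<alpha>2 d2"
    and "prob_space.indep_vars M (\<lambda>_. borel) X {1..}"
    and "\<forall>k\<ge>1. distr M borel (X k) \<in> {G1, G2}"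
    and "filterlim \<tau>1 at_top sequentially"
    and "filterlim \<tau>2 at_top sequentially"
    and "(\<lambda>n. ereal (real (\<tau>1 n) powr \<alpha>2 / real (\<tau>2 n) powr \<alpha>1)) \<longlonglongrightarrow> l"
    and "\<forall>n\<ge>1. a n \<in> measurable M (count_space UNIV)"
    and "\<forall>n\<ge>1. \<forall>\<omega>\<in>space M. 0 < a n \<omega>"
    and "\<forall>n\<ge>1. indep_of_sequence M (a n) X"
  shows
    "(0 < l \<longrightarrow>
      (l < \<infinity> \<longrightarrow> (AE \<omega> in M. limsup (\<lambda>n. ereal (real (a n \<omega>) / real n)) < \<infinity>)) \<longrightarrow>
      (l = \<infinity> \<longrightarrow> (AE \<omega> in M. limsup (\<lambda>n. ereal (real (a n \<omega>) / real (\<tau>1 n))) < \<infinity>)) \<longrightarrow>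
        (\<forall>\<delta>>0.
          (AE \<omega> in M. limsup (\<lambda>n. ereal (\<bar>T n \<omega>\<bar> / (B n * ln (real n) powr ((1 + \<delta>) / \<alpha>1)))) = 0)) \<and>
        (AE \<omega> in M. limsup (\<lambda>n. ereal (\<bar>T n \<omega>\<bar> / (B n * ln (real n) powr (1 / \<alpha>1)))) = \<infinity>) \<and>
        (AE \<omega> in M. limsup (\<lambda>n. ereal (\<bar>T n \<omega> / B n\<bar> powr (1 / ln (ln (real n))))) = ereal (exp (1 / \<alpha>1))))
     \<and>
     (l = 0 \<longrightarrow>
      (AE \<omega> in M. limsup (\<lambda>n. ereal (real (a n \<omega>) / real n)) < \<infinity>) \<longrightarrow>
      (\<exists>\<mu>>(\<alpha>2 - \<alpha>1) / \<alpha>2.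
         \<forall>\<^sub>F n in sequentially. real (\<tau>1 n) < real n powr (\<alpha>1 / \<alpha>2) * ln (real n) powr (- \<mu>)) \<longrightarrow>
        (\<forall>\<delta>>0.
          (AE \<omega> in M. limsup (\<lambda>n. ereal (\<bar>T n \<omega>\<bar> / (B n * ln (real n) powr ((1 + \<delta>) / \<alpha>2)))) = 0)) \<and>
        (AE \<omega> in M. limsup (\<lambda>n. ereal (\<bar>T n \<omega>\<bar> / (B n * ln (real n) powr (1 / \<alpha>2)))) = \<infinity>) \<and>
        (AE \<omega> in M. limsup (\<lambda>n. ereal (\<bar>T n \<omega> / B n\<bar> powr (1 / ln (ln (real n))))) = ereal (exp (1 / \<alpha>2))))"
proof -
  interpret prob_space M by fact
  have \<alpha>: "0 < \<alpha>1" "0 < \<alpha>2" "\<alpha>1 < \<alpha>2" "\<alpha>1 < 2" "\<alpha>2 < 2" using assms(6-8) by auto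
  have na1: "normally_attracted G1 \<alpha>1 c1 d1" and cc1: "centering_convention \<alpha>1 d1"
    and na2: "normally_attracted G2 \<alpha>2 c2 d2" and cc2: "centering_convention \<alpha>2 d2"
    and c12: "0 < c1" "0 < c2" by fact+
  have ind: "indep_vars (\<lambda>_. borel) X {1..}" and laws: "\<And>k. 1 \<le> k \<Longrightarrow> distr M borel (X k) = G1 \<or> distr M borel (X k) = G2"
    using assms(15,16) by auto
  have \<tau>1_top: "filterlim \<tau>1 at_top sequentially" and \<tau>2_top: "filterlim \<tau>2 at_top sequentially"
    and lim: "(\<lambda>n. ereal (real (\<tau>1 n) powr \<alpha>2 / real (\<tau>2 n) powr \<alpha>1)) \<longlonglongrightarrow> l" by fact+
  have a_meas: "\<And>n. 1 \<le> n \<Longrightarrow> a n \<in> measurable M (count_space UNIV)"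
    and a_pos: "\<And>n \<omega>. 1 \<le> n \<Longrightarrow> \<omega> \<in> space M \<Longrightarrow> 0 < a n \<omega>"
    and a_ind: "\<And>n. 1 \<le> n \<Longrightarrow> indep_of_sequence M (a n) X"
    using assms(20-22) by auto
  have Xm: "X k \<in> borel_measurable M" if "1 \<le> k" for k using ind that by (auto simp: indep_vars_def)

  obtain A1 where A1: "0 \<le> A1" and est1: "\<And>Y. Y \<in> borel_measurable M \<Longrightarrow> distr M borel Y = G1 \<Longrightarrow>
      (\<forall>u>0. prob {\<omega>\<in>space M. u \<le> \<bar>Y \<omega>\<bar>} \<le> A1 * u powr (- \<alpha>1)) \<and>
      (\<forall>x>0. expectation (\<lambda>\<omega>. (Y \<omega> * indicator {- x..x} (Y \<omega>))\<^sup>2) \<le> A1 * x powr (2 - \<alpha>1)) \<and>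
      (\<forall>x\<ge>1. \<bar>expectation (\<lambda>\<omega>. Y \<omega> * indicator {- x..x} (Y \<omega>))\<bar>
         \<le> A1 * x powr (1 - \<alpha>1) * (if \<alpha>1 = 1 then 1 + ln x else 1))"
    using attracted_variable_estimates[OF na1 cc1 \<alpha>(1,4) c12(1)] by blast
  obtain A2 where A2: "0 \<le> A2" and est2: "\<And>Y. Y \<in> borel_measurable M \<Longrightarrow> distr M borel Y = G2 \<Longrightarrow>
      (\<forall>u>0. prob {\<omega>\<in>space M. u \<le> \<bar>Y \<omega>\<bar>} \<le> A2 * u powr (- \<alpha>2)) \<and>
      (\<forall>x>0. expectation (\<lambda>\<omega>. (Y \<omega> * indicator {- x..x} (Y \<omega>))\<^sup>2) \<le> A2 * x powr (2 - \<alpha>2)) \<and>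
      (\<forall>x\<ge>1. \<bar>expectation (\<lambda>\<omega>. Y \<omega> * indicator {- x..x} (Y \<omega>))\<bar>
         \<le> A2 * x powr (1 - \<alpha>2) * (if \<alpha>2 = 1 then 1 + ln x else 1))"
    using attracted_variable_estimates[OF na2 cc2 \<alpha>(2,5) c12(2)] by blast
  define e where "e k = (if distr M borel (X k) = G1 then \<alpha>1 else \<alpha>2)" for k
  define A where "A = max A1 A2"
  have est: "(\<forall>u>0. prob {\<omega>\<in>space M. u \<le> \<bar>X k \<omega>\<bar>} \<le> A * u powr (- e k)) \<and>
      (\<forall>x>0. expectation (\<lambda>\<omega>. (X k \<omega> * indicator {- x..x} (X k \<omega>))\<^sup>2) \<le> A * x powr (2 - e k)) \<and>
      (\<forall>x\<ge>1. \<bar>expectation (\<lambda>\<omega>. X k \<omega> * indicator {- x..x} (X k \<omega>))\<bar>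
         \<le> A * x powr (1 - e k) * (if e k = 1 then 1 + ln x else 1))" if k: "1 \<le> k" for k
  proof -
    have weaken: "y \<le> A * z" if "y \<le> A' * z" "A' \<le> A" "0 \<le> z" for y z A' :: real
      using that by (meson mult_right_mono order_trans)
    have AA: "A1 \<le> A" "A2 \<le> A" by (simp_all add: A_def)
    show ?thesis
    proof (cases "distr M borel (X k) = G1")
      case True
      then have "e k = \<alpha>1" by (simp add: e_def)
      then show ?thesis using est1[OF Xm[OF k] True] AA
        by (auto intro!: weaken[of _ A1] simp: mult.assoc)
    next
      case False
      then have "e k = \<alpha>2" "distr M borel (X k) = G2" using laws[OF k] by (auto simp: e_def)
      then show ?thesis using est2[OF Xm[OF k]] AA
        by (auto intro!: weaken[of _ A2] simp: mult.assoc)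
    qed
  qed
  interpret W: power_tailed M X e A
  proof
    show "0 \<le> A" using A1 by (simp add: A_def)
  qed (use ind est in auto)

  define D1 where "D1 = {k. distr M borel (X k) = G1}"
  define D2 where "D2 = {k. distr M borel (X k) = G2}"
  have \<tau>1_eq: "\<tau>1 = (\<lambda>n. card (D1 \<inter> {1..n}))" and \<tau>2_eq: "\<tau>2 = (\<lambda>n. card (D2 \<inter> {1..n}))"
    unfolding \<tau>1_def \<tau>2_def law_count_def D1_def D2_def
    by (auto simp: fun_eq_iff intro!: arg_cong[of _ _ card])
  have \<tau>_le: "\<tau>1 n \<le> n" "\<tau>2 n \<le> n" for n
    using card_mono[of "{1..n}" "D1 \<inter> {1..n}"] card_mono[of "{1..n}" "D2 \<inter> {1..n}"] by (auto simp: \<tau>1_eq \<tau>2_eq)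
  have \<tau>_mono: "\<tau>1 m \<le> \<tau>1 n" "\<tau>2 m \<le> \<tau>2 n" if "m \<le> n" for m n
    unfolding \<tau>1_eq \<tau>2_eq using that by (auto intro!: card_mono)
  have \<tau>1_step: "\<tau>1 (n + k) \<le> \<tau>1 n + k" for n k
  proof -
    have "\<tau>1 (n + k) \<le> card (D1 \<inter> {1..n} \<union> {n+1..n+k})" unfolding \<tau>1_eq by (intro card_mono) auto
    also have "\<dots> \<le> \<tau>1 n + card {n+1..n+k}" unfolding \<tau>1_eq by (rule card_Un_le)
    finally show ?thesis by simp
  qed
  have \<tau>_sum: "n \<le> \<tau>1 n + \<tau>2 n" for n
  proof -
    have "n = card {1..n}" by simp
    also have "\<dots> \<le> card (D1 \<inter> {1..n} \<union> D2 \<inter> {1..n})" by (intro card_mono) (auto simp: D1_def D2_def dest: laws[simplified])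
    also have "\<dots> \<le> \<tau>1 n + \<tau>2 n" unfolding \<tau>1_eq \<tau>2_eq by (rule card_Un_le)
    finally show ?thesis .
  qed
  have count1: "card {i \<in> {1..n}. e i = \<alpha>1} \<le> \<tau>1 n" and count2: "card {i \<in> {1..n}. e i = \<alpha>2} \<le> \<tau>2 n" for n
    unfolding \<tau>1_eq \<tau>2_eq using \<alpha>(3) laws by (auto intro!: card_mono simp: e_def D1_def D2_def split: if_splits)
  have e_in: "e k \<in> {\<alpha>1, \<alpha>2}" for k by (simp add: e_def)
  have top1: "filterlim (\<lambda>n. card (D1 \<inter> {1..n})) at_top sequentially" using \<tau>1_top by (simp add: \<tau>1_eq)
  have top2: "filterlim (\<lambda>n. card (D2 \<inter> {1..n})) at_top sequentially" using \<tau>2_top by (simp add: \<tau>2_eq)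
  obtain \<kappa>1 x1 where \<kappa>1: "0 < \<kappa>1" and low_law1: "\<And>Y u. Y \<in> borel_measurable M \<Longrightarrow> distr M borel Y = G1 \<Longrightarrow>
      x1 \<le> u \<Longrightarrow> \<kappa>1 * u powr (- \<alpha>1) \<le> prob {\<omega>\<in>space M. u < \<bar>Y \<omega>\<bar>}"
    using attracted_variable_lower[OF na1 \<alpha>(1,4) c12(1)] by blast
  have lower1: "\<kappa>1 * u powr (- \<alpha>1) \<le> prob {\<omega>\<in>space M. u < \<bar>X k \<omega>\<bar>}" if "k \<in> D1 \<inter> {1..}" "x1 \<le> u" for k u
    using that by (intro low_law1 Xm) (auto simp: D1_def)
  obtain \<kappa>2 x2 where \<kappa>2: "0 < \<kappa>2" and low_law2: "\<And>Y u. Y \<in> borel_measurable M \<Longrightarrow> distr M borel Y = G2 \<Longrightarrow>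
      x2 \<le> u \<Longrightarrow> \<kappa>2 * u powr (- \<alpha>2) \<le> prob {\<omega>\<in>space M. u < \<bar>Y \<omega>\<bar>}"
    using attracted_variable_lower[OF na2 \<alpha>(2,5) c12(2)] by blast
  have lower2: "\<kappa>2 * u powr (- \<alpha>2) \<le> prob {\<omega>\<in>space M. u < \<bar>X k \<omega>\<bar>}" if "k \<in> D2 \<inter> {1..}" "x2 \<le> u" for k u
    using that by (intro low_law2 Xm) (auto simp: D2_def)
  have pos: "\<forall>\<^sub>F n in sequentially. 1 \<le> real (\<tau>1 n) \<and> 1 \<le> real (\<tau>2 n) \<and> 1 \<le> ln (real n) \<and> 1 \<le> n"
  proof -
    have "\<forall>\<^sub>F n in sequentially. 1 \<le> \<tau>1 n" "\<forall>\<^sub>F n in sequentially. 1 \<le> \<tau>2 n"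
      using \<tau>1_top \<tau>2_top by (auto simp: filterlim_at_top)
    moreover have "filterlim (\<lambda>n. ln (real n)) at_top sequentially" by real_asymp
    then have "\<forall>\<^sub>F n in sequentially. 1 \<le> ln (real n)" by (auto simp: filterlim_at_top)
    ultimately show ?thesis using eventually_ge_at_top[of 1] by eventually_elim auto
  qed
  have pow: "(x powr (1 / p) * y powr (1 / q)) powr r = x powr (r / p) * y powr (r / q)" for x y p q r :: real
    by (simp add: powr_mult powr_powr)
  have B_mono: "mono B" and B0: "0 \<le> B n" for n
    unfolding B_def norming_def using \<tau>_mono \<alpha> by (auto intro!: monoI powr_mono2)
  note regime = W.regime_limsups[OF \<alpha>(1,3) e_in _ B_mono B0 count1 count2 \<tau>1_top]
  define limits where "limits \<alpha> \<longleftrightarrow>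
      (\<forall>\<delta>>0. AE \<omega> in M. limsup (\<lambda>n. ereal (\<bar>T n \<omega>\<bar> / (B n * ln (real n) powr ((1 + \<delta>) / \<alpha>)))) = 0) \<and>
      (AE \<omega> in M. limsup (\<lambda>n. ereal (\<bar>T n \<omega>\<bar> / (B n * ln (real n) powr (1 / \<alpha>)))) = \<infinity>) \<and>
      (AE \<omega> in M. limsup (\<lambda>n. ereal (\<bar>T n \<omega> / B n\<bar> powr (1 / ln (ln (real n))))) = ereal (exp (1 / \<alpha>)))" for \<alpha>

  \<comment> \<open>For a finite limit the second class makes up a positive fraction of all indices.\<close>
  have regular2: "\<exists>C'\<ge>1. \<forall>\<^sub>F n in sequentially. \<forall>m. real m \<le> real n + real N * real n \<longrightarrow>
      B m * ln (real m) powr (1 / \<alpha>) \<le> C' * (B n * ln (real n) powr (1 / \<alpha>))"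
    if l: "l < \<infinity>" and lin: "\<forall>\<^sub>F n in sequentially. real n \<le> c * real (\<tau>2 n)" and "0 < \<alpha>" "1 \<le> c" for N :: nat and c \<alpha>
  proof -
    have "\<exists>C'\<ge>1. \<forall>\<^sub>F n in sequentially. \<forall>m. real m \<le> real n + real N * real n \<longrightarrow> real (\<tau>2 m) \<le> C' * real (\<tau>2 n)"
    proof (intro exI conjI)
      show "1 \<le> real (N + 1) * c" using \<open>1 \<le> c\<close> mult_mono[of 1 "real (N + 1)" 1 c] by simp
      show "\<forall>\<^sub>F n in sequentially. \<forall>m. real m \<le> real n + real N * real n \<longrightarrow> real (\<tau>2 m) \<le> real (N + 1) * c * real (\<tau>2 n)"
        using lin
      proof eventually_elim
        case (elim n)
        have "real (\<tau>2 m) \<le> real (N + 1) * c * real (\<tau>2 n)" if "real m \<le> real n + real N * real n" for m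
        proof -
          have "real (\<tau>2 m) \<le> real m" using \<tau>_le by simp
          also have "\<dots> \<le> real (N + 1) * real n" using that by (simp add: algebra_simps)
          also have "\<dots> \<le> real (N + 1) * (c * real (\<tau>2 n))" using elim by (intro mult_left_mono) auto
          finally show ?thesis by (simp add: mult.assoc)
        qed
        then show ?case by blast
      qed
    qed
    from regular_norming[OF \<open>0 < \<alpha>\<close> \<alpha>(2) order_refl this] show ?thesis
      using l by (simp add: B_def norming_def)
  qed
  have fin: "\<exists>c\<ge>1. (\<forall>\<^sub>F n in sequentially. real n \<le> c * real (\<tau>2 n)) \<and>
      (\<forall>\<^sub>F n in sequentially. real (\<tau>1 n) \<le> c * real (\<tau>2 n) powr (\<alpha>1 / \<alpha>2))" if l: "l < \<infinity>"
  proof -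
    obtain c :: nat where c: "l < ereal (real c)" using less_PInf_Ex_of_nat l by auto
    define b where "b = real c powr (1 / \<alpha>2)"
    have b0: "0 \<le> b" by (simp add: b_def)
    have le: "\<forall>\<^sub>F n in sequentially. real (\<tau>1 n) \<le> b * real (\<tau>2 n) powr (\<alpha>1 / \<alpha>2)"
      using ratio_bounds(1)[OF lim \<tau>2_top c]
      by eventually_elim (use \<alpha> in \<open>auto simp: b_def intro: powr_le_flip\<close>)
    show ?thesis
    proof (intro exI[of _ "1 + b"] conjI)
      show "1 \<le> 1 + b" using b0 by simp
      show "\<forall>\<^sub>F n in sequentially. real (\<tau>1 n) \<le> (1 + b) * real (\<tau>2 n) powr (\<alpha>1 / \<alpha>2)"
        by (rule eventually_le_weaken[OF le]) auto
      show "\<forall>\<^sub>F n in sequentially. real n \<le> (1 + b) * real (\<tau>2 n)"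
        using le pos
      proof eventually_elim
        case (elim n)
        have "real (\<tau>2 n) powr (\<alpha>1 / \<alpha>2) \<le> real (\<tau>2 n) powr 1" using elim \<alpha> by (intro powr_mono) auto
        then have "b * real (\<tau>2 n) powr (\<alpha>1 / \<alpha>2) \<le> b * real (\<tau>2 n)" using b0 elim by (intro mult_left_mono) auto
        moreover have "real n \<le> real (\<tau>1 n) + real (\<tau>2 n)" using \<tau>_sum[of n] by linarith
        ultimately show ?case using elim by (simp add: algebra_simps)
      qed
    qed
  qed

  \<comment> \<open>The first class may have any order from \<open>n powr (\<alpha>1 / \<alpha>2)\<close> up to \<open>n\<close>; the lengths are measured
      by its count, which grows by at most the number of indices added.\<close>
  have case_inf: ?thesis if l: "l = \<infinity>"
  proof -
    have B_eq: "B n = real (\<tau>1 n) powr (1 / \<alpha>1)" for n using l by (simp add: B_def norming_def)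
    have "\<forall>\<^sub>F n in sequentially. 1 * real (\<tau>2 n) powr \<alpha>1 \<le> real (\<tau>1 n) powr \<alpha>2"
      using l by (intro ratio_bounds(2)[OF lim \<tau>2_top]) auto
    then have le: "\<forall>\<^sub>F n in sequentially. real (\<tau>2 n) \<le> real (\<tau>1 n) powr (\<alpha>2 / \<alpha>1)"
    proof eventually_elim
      case (elim n)
      then show ?case using powr_le_flip[of "real (\<tau>2 n)" \<alpha>1 1 "real (\<tau>1 n)" \<alpha>2] \<alpha> by simp
    qed
    have \<theta>1: "(B n * ln (real n) powr (1 / \<alpha>1)) powr \<alpha>1 = real (\<tau>1 n) * ln (real n)" if "1 \<le> n" for n
      unfolding B_eq pow using \<alpha> that by simp
    have r1: "\<forall>\<^sub>F n in sequentially. real (\<tau>1 n) * ln (real n) \<le> 1 * (B n * ln (real n) powr (1 / \<alpha>1)) powr \<alpha>1"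
      using pos by eventually_elim (simp add: \<theta>1)
    have r2: "\<forall>\<^sub>F n in sequentially. real (\<tau>2 n) * ln (real n) \<le> 1 * (B n * ln (real n) powr (1 / \<alpha>1)) powr \<alpha>2"
      using pos le
    proof eventually_elim
      case (elim n)
      have "ln (real n) powr 1 \<le> ln (real n) powr (\<alpha>2 / \<alpha>1)" using elim \<alpha> by (intro powr_mono) auto
      then have "real (\<tau>2 n) * ln (real n) \<le> real (\<tau>1 n) powr (\<alpha>2 / \<alpha>1) * ln (real n) powr (\<alpha>2 / \<alpha>1)"
        using elim by (intro mult_mono) auto
      then show ?case unfolding B_eq pow by simp
    qed
    have tight: "\<forall>\<^sub>F n in sequentially. (B n * ln (real n) powr (1 / \<alpha>1)) powr \<alpha>1 \<le> 1 * (real (card (D1 \<inter> {1..n})) * ln (real n))"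
      using pos by eventually_elim (simp add: \<theta>1 \<tau>1_eq)
    have "\<forall>\<^sub>F n in sequentially. real n \<le> 2 * real (\<tau>1 n) powr (\<alpha>2 / \<alpha>1)"
      using pos le
    proof eventually_elim
      case (elim n)
      have "real (\<tau>1 n) powr 1 \<le> real (\<tau>1 n) powr (\<alpha>2 / \<alpha>1)" using elim \<alpha> by (intro powr_mono) auto
      moreover have "real n \<le> real (\<tau>1 n) + real (\<tau>2 n)" using \<tau>_sum[of n] by linarith
      ultimately show ?case using elim by simp
    qed
    then have ln_\<tau>: "\<forall>\<^sub>F n in sequentially. ln (real n) \<le> (\<alpha>2 / \<alpha>1 + 1) * ln (real (card (D1 \<inter> {1..n})))"
      using \<alpha> by (intro ln_le_ln_power[OF top1, where c = 2]) (auto simp: \<tau>1_eq)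
    have "\<exists>C'\<ge>1. \<forall>\<^sub>F n in sequentially. \<forall>m. real m \<le> real n + real N * real (\<tau>1 n) \<longrightarrow> real (\<tau>1 m) \<le> C' * real (\<tau>1 n)" for N
    proof (intro exI[of _ "real (N + 1)"] conjI always_eventually allI impI)
      fix n m assume "real m \<le> real n + real N * real (\<tau>1 n)"
      then have "real m \<le> real (n + N * \<tau>1 n)" by simp
      then have "m \<le> n + N * \<tau>1 n" by (simp only: of_nat_le_iff)
      then have "\<tau>1 m \<le> \<tau>1 (n + N * \<tau>1 n)" by (rule \<tau>_mono)
      also have "\<dots> \<le> \<tau>1 n + N * \<tau>1 n" by (rule \<tau>1_step)
      finally have "real (\<tau>1 m) \<le> real (\<tau>1 n + N * \<tau>1 n)" by (simp only: of_nat_le_iff)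
      then show "real (\<tau>1 m) \<le> real (N + 1) * real (\<tau>1 n)" by (simp add: algebra_simps)
    qed simp
    then have regular: "\<exists>C'\<ge>1. \<forall>\<^sub>F n in sequentially. \<forall>m. real m \<le> real n + real N * real (\<tau>1 n) \<longrightarrow>
      B m * ln (real m) powr (1 / \<alpha>1) \<le> C' * (B n * ln (real n) powr (1 / \<alpha>1))" for N :: nat
      unfolding B_eq using \<tau>_le by (intro regular_norming[OF \<alpha>(1,1)]) auto
    have L: "real (\<tau>1 n) \<le> real n" for n using \<tau>_le by simp
    have Lp: "\<forall>\<^sub>F n in sequentially. 0 < real (\<tau>1 n)" using pos by eventually_elim auto
    have core: "limits \<alpha>1" if "AE \<omega> in M. limsup (\<lambda>n. ereal (real (a n \<omega>) / real (\<tau>1 n))) < \<infinity>"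
      unfolding limits_def T_def
      by (rule regime[where threshold = x1, OF \<alpha>(1) top1 r1 r2 tight ln_\<tau> \<kappa>1 _ _ _ _ L Lp regular that];
          fact lower1 a_meas a_pos a_ind)
    show ?thesis unfolding limits_def[symmetric]
    proof (intro conjI impI, goal_cases)
      case 1
      show ?case by (rule core[OF mp[OF 1(3) l]])
    next
      case 2
      show ?case using 2(1) l by simp
    qed
  qed

  \<comment> \<open>Both counts give the same norming: \<open>\<tau>1 powr (1 / \<alpha>1)\<close> is of the exact order of \<open>\<tau>2 powr (1 / \<alpha>2)\<close>.\<close>
  have case_mid: ?thesis if l: "0 < l" "l < \<infinity>"
  proof -
    have B_eq: "B n = real (\<tau>2 n) powr (1 / \<alpha>2)" for n using l by (simp add: B_def norming_def)
    obtain c where c: "1 \<le> c" and lin: "\<forall>\<^sub>F n in sequentially. real n \<le> c * real (\<tau>2 n)"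
      and le: "\<forall>\<^sub>F n in sequentially. real (\<tau>1 n) \<le> c * real (\<tau>2 n) powr (\<alpha>1 / \<alpha>2)" using fin[OF l(2)] by blast
    obtain b where b: "0 < b" "ereal b < l" using ereal_dense2[OF l(1)] by (metis ereal_less(2))
    define g where "g = (1 / b) powr (1 / \<alpha>1)"
    have g: "0 < g" using b by (simp add: g_def)
    have ge: "\<forall>\<^sub>F n in sequentially. real (\<tau>2 n) \<le> g * real (\<tau>1 n) powr (\<alpha>2 / \<alpha>1)"
      using ratio_bounds(2)[OF lim \<tau>2_top b(2)]
    proof eventually_elim
      case (elim n)
      then have "real (\<tau>2 n) powr \<alpha>1 \<le> 1 / b * real (\<tau>1 n) powr \<alpha>2" using b by (simp add: field_simps)
      then show ?case unfolding g_def using \<alpha> b by (intro powr_le_flip) auto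
    qed
    have r1: "\<forall>\<^sub>F n in sequentially. real (\<tau>1 n) * ln (real n) \<le> c * (B n * ln (real n) powr (1 / \<alpha>1)) powr \<alpha>1"
      using pos le
    proof eventually_elim
      case (elim n)
      then have "real (\<tau>1 n) * ln (real n) \<le> c * real (\<tau>2 n) powr (\<alpha>1 / \<alpha>2) * ln (real n)" by (intro mult_right_mono) auto
      then show ?case unfolding B_eq pow using \<alpha> elim by (simp add: mult.assoc)
    qed
    have r2: "\<forall>\<^sub>F n in sequentially. real (\<tau>2 n) * ln (real n) \<le> 1 * (B n * ln (real n) powr (1 / \<alpha>1)) powr \<alpha>2"
      using pos
    proof eventually_elim
      case (elim n)
      have "ln (real n) powr 1 \<le> ln (real n) powr (\<alpha>2 / \<alpha>1)" using elim \<alpha> by (intro powr_mono) auto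
      then have "real (\<tau>2 n) * ln (real n) \<le> real (\<tau>2 n) * ln (real n) powr (\<alpha>2 / \<alpha>1)"
        using elim by (intro mult_left_mono) auto
      then show ?case unfolding B_eq pow using \<alpha> by simp
    qed
    have tight: "\<forall>\<^sub>F n in sequentially. (B n * ln (real n) powr (1 / \<alpha>1)) powr \<alpha>1
        \<le> g powr (\<alpha>1 / \<alpha>2) * (real (card (D1 \<inter> {1..n})) * ln (real n))"
      using pos ge
    proof eventually_elim
      case (elim n)
      have "real (\<tau>2 n) powr (\<alpha>1 / \<alpha>2) \<le> (g * real (\<tau>1 n) powr (\<alpha>2 / \<alpha>1)) powr (\<alpha>1 / \<alpha>2)"
        using elim \<alpha> by (intro powr_mono2) auto
      also have "\<dots> = g powr (\<alpha>1 / \<alpha>2) * real (\<tau>1 n)" using g \<alpha> by (simp add: powr_mult powr_powr)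
      finally have "real (\<tau>2 n) powr (\<alpha>1 / \<alpha>2) * ln (real n) \<le> g powr (\<alpha>1 / \<alpha>2) * real (\<tau>1 n) * ln (real n)"
        using elim by (intro mult_right_mono) auto
      then show ?case unfolding B_eq pow using \<alpha> elim by (simp add: mult.assoc \<tau>1_eq)
    qed
    have "\<forall>\<^sub>F n in sequentially. real n \<le> c * g * real (\<tau>1 n) powr (\<alpha>2 / \<alpha>1)"
      using lin ge
    proof eventually_elim
      case (elim n)
      have "c * real (\<tau>2 n) \<le> c * (g * real (\<tau>1 n) powr (\<alpha>2 / \<alpha>1))" using elim c by (intro mult_left_mono) auto
      then show ?case using elim by (simp add: mult.assoc)
    qed
    then have ln_\<tau>: "\<forall>\<^sub>F n in sequentially. ln (real n) \<le> (\<alpha>2 / \<alpha>1 + 1) * ln (real (card (D1 \<inter> {1..n})))"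
      using \<alpha> c g by (intro ln_le_ln_power[OF top1, where c = "c * g"]) (auto simp: \<tau>1_eq)
    have Lp: "\<forall>\<^sub>F n in sequentially. 0 < real n" using pos by eventually_elim auto
    have core: "limits \<alpha>1" if "AE \<omega> in M. limsup (\<lambda>n. ereal (real (a n \<omega>) / real n)) < \<infinity>"
      unfolding limits_def T_def
      by (rule regime[where threshold = x1, OF \<alpha>(1) top1 r1 r2 tight ln_\<tau> \<kappa>1 _ _ _ _ order_refl Lp regular2[OF l(2) lin \<alpha>(1) c] that];
          fact lower1 a_meas a_pos a_ind)
    show ?thesis unfolding limits_def[symmetric]
    proof (intro conjI impI, goal_cases)
      case 1
      show ?case by (rule core[OF mp[OF 1(2) l(2)]])
    next
      case 2
      show ?case using 2(1) l by simp
    qed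
  qed

  \<comment> \<open>The second class prevails. The first one still has the heavier tails, and only its thinness keeps
      it dominated: \<open>\<tau>1 ln n\<close> is at most \<open>n powr (\<alpha>1 / \<alpha>2) (ln n) powr (1 - \<mu>)\<close>, where
      \<open>1 - \<mu> \<le> \<alpha>1 / \<alpha>2\<close>.\<close>
  have case_zero: ?thesis if l: "l = 0"
  proof -
    have B_eq: "B n = real (\<tau>2 n) powr (1 / \<alpha>2)" for n using l by (simp add: B_def norming_def)
    have l': "l < \<infinity>" using l by simp
    obtain c where c: "1 \<le> c" and lin: "\<forall>\<^sub>F n in sequentially. real n \<le> c * real (\<tau>2 n)" using fin[OF l'] by blast
    have \<theta>2: "(B n * ln (real n) powr (1 / \<alpha>2)) powr \<alpha>2 = real (\<tau>2 n) * ln (real n)" if "1 \<le> n" for n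
      unfolding B_eq pow using \<alpha> that by simp
    have r2: "\<forall>\<^sub>F n in sequentially. real (\<tau>2 n) * ln (real n) \<le> 1 * (B n * ln (real n) powr (1 / \<alpha>2)) powr \<alpha>2"
      using pos by eventually_elim (simp add: \<theta>2)
    have tight: "\<forall>\<^sub>F n in sequentially. (B n * ln (real n) powr (1 / \<alpha>2)) powr \<alpha>2 \<le> 1 * (real (card (D2 \<inter> {1..n})) * ln (real n))"
      using pos by eventually_elim (simp add: \<theta>2 \<tau>2_eq)
    have "\<forall>\<^sub>F n in sequentially. real n \<le> c * real (\<tau>2 n) powr 1" using lin by eventually_elim simp
    then have ln_\<tau>: "\<forall>\<^sub>F n in sequentially. ln (real n) \<le> (1 + 1) * ln (real (card (D2 \<inter> {1..n})))"
      using c by (intro ln_le_ln_power[OF top2, where c = c]) (auto simp: \<tau>2_eq)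
    have Lp: "\<forall>\<^sub>F n in sequentially. 0 < real n" using pos by eventually_elim auto
    have r1: "\<forall>\<^sub>F n in sequentially. real (\<tau>1 n) * ln (real n) \<le> c powr (\<alpha>1 / \<alpha>2) * (B n * ln (real n) powr (1 / \<alpha>2)) powr \<alpha>1"
      if \<mu>: "(\<alpha>2 - \<alpha>1) / \<alpha>2 < \<mu>"
        and thin: "\<forall>\<^sub>F n in sequentially. real (\<tau>1 n) < real n powr (\<alpha>1 / \<alpha>2) * ln (real n) powr (- \<mu>)" for \<mu>
      using pos lin thin
    proof eventually_elim
      case (elim n)
      have ex: "1 - \<mu> \<le> \<alpha>1 / \<alpha>2" using \<mu> \<alpha> by (simp add: field_simps)
      have ln1: "ln (real n) powr (- \<mu>) * ln (real n) = ln (real n) powr (1 - \<mu>)"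
        using elim by (simp add: powr_diff powr_minus field_simps)
      have "real (\<tau>1 n) * ln (real n) \<le> real n powr (\<alpha>1 / \<alpha>2) * ln (real n) powr (- \<mu>) * ln (real n)"
        using elim by (intro mult_right_mono) auto
      also have "\<dots> = real n powr (\<alpha>1 / \<alpha>2) * ln (real n) powr (1 - \<mu>)" by (simp only: mult.assoc ln1)
      also have "\<dots> \<le> (c * real (\<tau>2 n)) powr (\<alpha>1 / \<alpha>2) * ln (real n) powr (\<alpha>1 / \<alpha>2)"
        using elim ex \<alpha> by (intro mult_mono powr_mono2 powr_mono) auto
      also have "\<dots> = c powr (\<alpha>1 / \<alpha>2) * (B n * ln (real n) powr (1 / \<alpha>2)) powr \<alpha>1"
        unfolding B_eq pow using c by (simp add: powr_mult mult.assoc)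
      finally show ?case .
    qed
    have core: "limits \<alpha>2"
      if a: "AE \<omega> in M. limsup (\<lambda>n. ereal (real (a n \<omega>) / real n)) < \<infinity>"
        and \<mu>: "(\<alpha>2 - \<alpha>1) / \<alpha>2 < \<mu>"
          "\<forall>\<^sub>F n in sequentially. real (\<tau>1 n) < real n powr (\<alpha>1 / \<alpha>2) * ln (real n) powr (- \<mu>)" for \<mu>
      unfolding limits_def T_def
      by (rule regime[where threshold = x2, OF \<alpha>(2) top2 r1[OF \<mu>] r2 tight ln_\<tau> \<kappa>2 _ _ _ _ order_refl Lp regular2[OF l' lin \<alpha>(2) c] a];
          fact lower2 a_meas a_pos a_ind)
    show ?thesis unfolding limits_def[symmetric]
    proof (intro conjI impI, goal_cases)
      case 1
      show ?case using 1(1) l by simp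
    next
      case 2
      then obtain \<mu> where "(\<alpha>2 - \<alpha>1) / \<alpha>2 < \<mu>"
        "\<forall>\<^sub>F n in sequentially. real (\<tau>1 n) < real n powr (\<alpha>1 / \<alpha>2) * ln (real n) powr (- \<mu>)" by blast
      then show ?case by (rule core[OF 2(2)])
    qed
  qed

  have "0 \<le> l" by (rule LIMSEQ_le_const[OF lim]) auto
  then consider "l = \<infinity>" | "0 < l" "l < \<infinity>" | "l = 0" by (cases l) (auto simp: less_le)
  then show ?thesis by cases (fact case_inf case_mid case_zero)+
qed

end
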